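(* Let $S$ be a non-trivial (i.e. non-constant) singular inner function on the unit disc $\mathbb{D}$ that is cyclic in the Bergman space $L^2_a=\{g\in\mathrm{Hol}(\mathbb{D}):\int_{\mathbb{D}}|g|^2\frac{dx\,dy}{\pi}<\infty\}$. Then the function $f(z,w)=S(z)$, which belongs to $H^\infty(\mathbb{B}_2)$, is cyclic in $H^2(\partial\mathbb{B}_2)$, but it is not weak$^\ast$ sequentially cyclic in $H^\infty(\mathbb{B}_2)$.
   Context: $\mathbb{B}_2$ is the open unit ball of $\mathbb{C}^2$, $\sigma$ is the normalized rotation-invariant measure on $\partial\mathbb{B}_2$, and $H^2(\partial\mathbb{B}_2)$ is the Hardy space of holomorphic functions $h$ on $\mathbb{B}_2$ with $\|h\|^2=\sup_{0\le r<1}\int_{\partial\mathbb{B}_2}|h(rz)|^2d\sigma(z)<\infty$. $H^\infty(\mathbb{B}_2)$ is the algebra of bounded holomorphic functions on $\mathbb{B}_2$. For a Hilbert space $H$ of holomorphic functions (with continuous point evaluations) on a domain $\Omega$, $\mathrm{Mult}(H)=\{\phi:\Omega\to\mathbb{C}:\ \phi f\in H\text{ for all }f\in H\}$, and $f\in H$ is cyclic in $H$ if $\{uf:u\in\mathrm{Mult}(H)\}$ is dense in $H$. One has $\mathrm{Mult}(L^2_a)=H^\infty(\mathbb{D})$ and $\mathrm{Mult}(H^2(\partial\mathbb{B}_2))=H^\infty(\mathbb{B}_2)$, the latter with the supremum norm. $H^\infty(\mathbb{B}_2)$ carries the weak$^\ast$ topology it inherits, via $\phi\mapsto M_\phi$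 (multiplication operator), from the bounded operators on $H^2(\partial\mathbb{B}_2)$ (the dual of the trace class); a sequence $\phi_n$ converges weak$^\ast$ to $\phi$ if and only if $\sup_n\|\phi_n\|_\infty<\infty$ and $\phi_n\to\phi$ pointwise on $\mathbb{B}_2$. A function $\phi\in H^\infty(\mathbb{B}_2)$ is weak$^\ast$ sequentially cyclic in $H^\infty(\mathbb{B}_2)$ if there is a sequence $\{u_n\}\subseteq H^\infty(\mathbb{B}_2)$ with $u_n\phi\to1$ weak$^\ast$. *)

theory Defs
  imports "HOL-Analysis.Analysis" "HOL-Probability.Probability_Measure"
begin

section \<open>The normalized rotation-invariant measure on a sphere\<close>

text \<open>The normalized surface measure of the unit sphere is the image of the normalized volume of
  the unit ball under the radial projection \<open>sgn x = x / norm x\<close>. It is a measure on the sphere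
  itself, and it is shown below to be a probability measure that is invariant under orthogonal
  transformations (in particular under unitary maps of \<open>complex \<times> complex\<close>).\<close>

definition sphere_measure :: "'a::euclidean_space measure" where
  "sphere_measure =
     restrict_space (distr (uniform_measure lborel (ball 0 1)) borel sgn) (sphere 0 1)"

lemma space_sphere_measure: "space sphere_measure = sphere (0::'a::euclidean_space) 1"
  by (simp add: sphere_measure_def space_restrict_space)

lemma sets_sphere_measure:
  "sets sphere_measure = sets (restrict_space borel (sphere (0::'a::euclidean_space) 1))"
  by (simp add: sphere_measure_def sets_restrict_space)

lemma measurable_sgn_borel: "(sgn :: 'a::euclidean_space \<Rightarrow> 'a) \<in> borel_measurable borel"
  unfolding sgn_div_norm by measurable

lemma emeasure_lborel_unit_ball:
  "emeasure lborel (ball (0::'a::euclidean_space) 1) \<noteq> 0"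
  "emeasure lborel (ball (0::'a::euclidean_space) 1) \<noteq> \<infinity>"
proof -
  show "emeasure lborel (ball (0::'a) 1) \<noteq> \<infinity>"
    using emeasure_lborel_ball_finite[of "0::'a" 1] by simp
  show "emeasure lborel (ball (0::'a) 1) \<noteq> 0"
  proof
    assume "emeasure lborel (ball (0::'a) 1) = 0"
    then have "negligible (ball (0::'a) 1)"
      by (intro negligible_iff_null_sets[THEN iffD2] null_sets_completionI)
         (auto simp: null_sets_def)
    then show False
      using open_not_negligible[of "ball (0::'a) 1"] by simp
  qed
qed

lemma emeasure_sphere_measure:
  assumes A: "A \<in> sets borel" "A \<subseteq> sphere (0::'a::euclidean_space) 1"
  shows "emeasure sphere_measure A = emeasure (uniform_measure lborel (ball 0 1)) (sgn -` A)"
proof -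
  have "emeasure sphere_measure A
      = emeasure (distr (uniform_measure lborel (ball 0 1)) borel sgn) A"
    unfolding sphere_measure_def using A by (intro emeasure_restrict_space) auto
  also have "\<dots> = emeasure (uniform_measure lborel (ball 0 1)) (sgn -` A)"
    using A measurable_sgn_borel by (subst emeasure_distr) (auto cong: measurable_cong_sets)
  finally show ?thesis .
qed

lemma prob_space_sphere_measure: "prob_space (sphere_measure :: 'a::euclidean_space measure)"
proof (rule prob_spaceI)
  have sgn: "sgn -` sphere (0::'a) 1 = UNIV - {0}"
    by (auto simp: norm_sgn)
  have U: "prob_space (uniform_measure lborel (ball (0::'a) 1))"
    using emeasure_lborel_unit_ball by (intro prob_space_uniform_measure) auto
  have "emeasure (uniform_measure lborel (ball (0::'a) 1)) (UNIV - {0})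
      = emeasure lborel (ball (0::'a) 1 - {0}) / emeasure lborel (ball (0::'a) 1)"
    by (subst emeasure_uniform_measure) (auto intro!: arg_cong2[where f="(/)"] arg_cong2[where f=emeasure])
  also have "emeasure lborel (ball (0::'a) 1 - {0}) = emeasure lborel (ball (0::'a) 1)"
    by (intro emeasure_Diff_null_set) (auto simp: null_sets_def)
  also have "\<dots> / emeasure lborel (ball (0::'a) 1) = 1"
    using emeasure_lborel_unit_ball[where 'a='a] by (intro ennreal_divide_self) (auto simp: less_top)
  finally show "emeasure (sphere_measure :: 'a measure) (space sphere_measure) = 1"
    by (simp add: space_sphere_measure emeasure_sphere_measure sgn)
qed

text \<open>Uniqueness of translation-invariant measures, specialised to the image of \<open>lborel\<close>.\<close>

lemma lborel_translation: "distr lborel borel (\<lambda>x. x + c) = (lborel :: 'a::euclidean_space measure)"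
  proof -
  have "(\<lambda>x. x + c) = (+) c" by (auto simp: add.commute)
  then show ?thesis using lborel_distr_plus[of c] by simp
qed

lemma lborel_orthogonal_transformation:
  fixes T :: "'a::euclidean_space \<Rightarrow> 'a"
  assumes T: "orthogonal_transformation T"
  shows "distr lborel borel T = lborel"
proof -
  define \<nu> where "\<nu> = distr lborel borel T"
  have lin: "linear T" and bij: "bij T"
    using T orthogonal_transformation_linear orthogonal_transformation_bij by auto
  have Tm [measurable]: "T \<in> borel_measurable borel"
    using lin by (intro borel_measurable_continuous_onI linear_continuous_on)
                 (simp add: linear_conv_bounded_linear)
  have sets_nu [measurable_cong]: "sets \<nu> = sets borel" by (simp add: \<nu>_def)
  have trans: "distr \<nu> borel (\<lambda>x. x + c) = \<nu>" for c
  proof -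
    obtain d where d: "c = T d" using bij by (metis bij_pointE)
    have "distr \<nu> borel (\<lambda>x. x + c) = distr lborel borel (T \<circ> (\<lambda>x. x + d))"
      unfolding \<nu>_def by (subst distr_distr) (auto simp: o_def d linear_add[OF lin])
    also have "\<dots> = distr (distr lborel borel (\<lambda>x. x + d)) borel T"
      by (subst distr_distr) auto
    finally show ?thesis by (simp add: lborel_translation \<nu>_def)
  qed
  define B where "B = ball (0::'a) 1"
  have B [measurable]: "B \<in> sets borel" by (simp add: B_def)
  have Bs: "- x \<in> B \<longleftrightarrow> x \<in> B" for x by (simp add: B_def)
  have nuB: "emeasure \<nu> B = emeasure lborel B"
  proof -
    have "T -` B = B" using T by (auto simp: B_def orthogonal_transformation_norm)
    then show ?thesis by (simp add: \<nu>_def emeasure_distr)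
  qed
  have sf: "sigma_finite_measure \<nu>"
  proof -
    obtain S where S: "orthogonal_transformation S" "\<And>x. S (T x) = x" "\<And>x. T (S x) = x"
      using T orthogonal_transformation_inv[OF T] bij
      by (metis bij_inv_eq_iff)
    have [measurable]: "S \<in> borel_measurable borel"
      using orthogonal_transformation_linear[OF S(1)]
      by (intro borel_measurable_continuous_onI linear_continuous_on)
         (simp add: linear_conv_bounded_linear)
    have "distr \<nu> borel S = lborel"
      unfolding \<nu>_def by (subst distr_distr) (auto simp: o_def S distr_id2)
    then show ?thesis
      using sigma_finite_lborel
      by (intro sigma_finite_measure_distr[of \<nu> borel S]) (auto simp: \<nu>_def)
  qed
  interpret sigma_finite_measure \<nu> by (rule sf)
  interpret P: pair_sigma_finite "lborel :: 'a measure" \<nu>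
    by (simp add: pair_sigma_finite_def sf sigma_finite_lborel)
  have key: "emeasure lborel A * emeasure \<nu> B = emeasure lborel B * emeasure \<nu> A"
    if A [measurable]: "A \<in> sets borel" for A
  proof -
    have nu_ball: "(\<integral>\<^sup>+y. indicator B (x - y) \<partial>\<nu>) = emeasure \<nu> B" for x
    proof -
      have "(\<integral>\<^sup>+y. indicator B (x - y) \<partial>\<nu>)
          = (\<integral>\<^sup>+y. indicator B (x - y) \<partial>distr \<nu> borel (\<lambda>y. y + x))"
        by (simp add: trans)
      also have "\<dots> = (\<integral>\<^sup>+y. indicator B (- y) \<partial>\<nu>)"
        by (subst nn_integral_distr) auto
      also have "\<dots> = (\<integral>\<^sup>+y. indicator B y \<partial>\<nu>)"
        by (simp add: indicator_def Bs)
      finally show ?thesis by (simp add: sets_nu)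
    qed
    have nu_A: "(\<integral>\<^sup>+y. indicator A (x + y) \<partial>\<nu>) = emeasure \<nu> A" for x
    proof -
      have "(\<integral>\<^sup>+y. indicator A (x + y) \<partial>\<nu>)
          = (\<integral>\<^sup>+y. indicator A y \<partial>distr \<nu> borel (\<lambda>y. y + x))"
        by (subst nn_integral_distr) (auto simp: add.commute)
      then show ?thesis by (simp add: trans sets_nu)
    qed
    have "emeasure lborel A * emeasure \<nu> B
        = (\<integral>\<^sup>+x. \<integral>\<^sup>+y. indicator A x * indicator B (x - y) \<partial>\<nu> \<partial>lborel)"
      by (simp add: nn_integral_cmult nu_ball nn_integral_multc)
    also have "\<dots> = (\<integral>\<^sup>+y. \<integral>\<^sup>+x. indicator A x * indicator B (x - y) \<partial>lborel \<partial>\<nu>)"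
      by (rule P.Fubini'[symmetric]) measurable
    also have "\<dots> = (\<integral>\<^sup>+y. \<integral>\<^sup>+x. indicator A (x + y) * indicator B x \<partial>lborel \<partial>\<nu>)"
    proof (rule nn_integral_cong)
      fix y
      have "(\<integral>\<^sup>+x. indicator A x * indicator B (x - y) \<partial>lborel)
          = (\<integral>\<^sup>+x. indicator A x * indicator B (x - y) \<partial>distr lborel borel (\<lambda>x. x + y))"
        by (simp add: lborel_translation)
      also have "\<dots> = (\<integral>\<^sup>+x. indicator A (x + y) * indicator B x \<partial>lborel)"
        by (subst nn_integral_distr) auto
      finally show "(\<integral>\<^sup>+x. indicator A x * indicator B (x - y) \<partial>lborel)
          = (\<integral>\<^sup>+x. indicator A (x + y) * indicator B x \<partial>lborel)" .
    qed
    also have "\<dots> = (\<integral>\<^sup>+x. \<integral>\<^sup>+y. indicator A (x + y) * indicator B x \<partial>\<nu> \<partial>lborel)"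
      by (rule P.Fubini') measurable
    also have "\<dots> = emeasure lborel B * emeasure \<nu> A"
      by (simp add: nn_integral_multc nu_A nn_integral_cmult mult.commute)
    finally show ?thesis .
  qed
  have "emeasure \<nu> A = emeasure lborel A" if "A \<in> sets borel" for A
  proof -
    have "emeasure lborel B * emeasure \<nu> A = emeasure lborel B * emeasure lborel A"
      using key[OF that] unfolding nuB by (metis mult.commute)
    then show ?thesis
      using emeasure_lborel_unit_ball[where 'a='a] by (simp add: ennreal_mult_cancel_left B_def)
  qed
  then show ?thesis
    unfolding \<nu>_def[symmetric] by (intro measure_eqI) (auto simp: sets_nu)
qed

lemma sphere_measure_invariant:
  fixes T :: "'a::euclidean_space \<Rightarrow> 'a"
  assumes T: "orthogonal_transformation T"
  shows "distr sphere_measure sphere_measure T = sphere_measure"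
proof (rule measure_eqI)
  have lin: "linear T" using T orthogonal_transformation_linear by auto
  have Tm [measurable]: "T \<in> borel_measurable borel"
    using lin by (intro borel_measurable_continuous_onI linear_continuous_on)
                 (simp add: linear_conv_bounded_linear)
  have nT: "norm (T x) = norm x" for x using T by (rule orthogonal_transformation_norm)
  have Tsphere: "T \<in> measurable sphere_measure sphere_measure"
    by (subst measurable_cong_sets[OF sets_sphere_measure sets_sphere_measure])
       (intro measurable_restrict_space3, auto simp: nT)
  fix A assume "A \<in> sets (distr sphere_measure sphere_measure T)"
  then have "A \<in> sets (restrict_space borel (sphere (0::'a) 1))"
    by (simp add: sets_sphere_measure)
  then have A: "A \<in> sets borel" "A \<subseteq> sphere 0 1"
    by (auto simp: sets_restrict_space)
  have TA: "T -` A \<in> sets borel" "T -` A \<subseteq> sphere 0 1"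
    using measurable_sets[OF Tm, of A] A by (auto simp: nT)
  have sA: "sgn -` A \<in> sets borel" "sgn -` (T -` A) \<in> sets borel"
    using measurable_sets[OF measurable_sgn_borel A(1)]
      measurable_sets[OF measurable_sgn_borel TA(1)] by auto
  have "emeasure (distr sphere_measure sphere_measure T) A = emeasure sphere_measure (T -` A)"
    using A TA by (subst emeasure_distr[OF Tsphere])
      (auto simp: sets_sphere_measure sets_restrict_space space_sphere_measure Int_absorb2)
  also have "\<dots> = emeasure (uniform_measure lborel (ball 0 1)) (sgn -` (T -` A))"
    using TA by (rule emeasure_sphere_measure)
  also have "sgn -` (T -` A) = T -` (sgn -` A)"
    by (auto simp: sgn_div_norm nT linear_scale[OF lin])
  also have "emeasure (uniform_measure lborel (ball 0 1)) (T -` (sgn -` A))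
      = emeasure lborel (T -` (ball 0 1 \<inter> sgn -` A)) / emeasure lborel (ball (0::'a) 1)"
  proof -
    have "T -` (sgn -` A) \<in> sets borel" using measurable_sets[OF Tm sA(1)] by simp
    moreover have "ball 0 1 \<inter> T -` (sgn -` A) = T -` (ball 0 1 \<inter> sgn -` A)"
      by (auto simp: nT)
    ultimately show ?thesis by (subst emeasure_uniform_measure) auto
  qed
  also have "emeasure lborel (T -` (ball 0 1 \<inter> sgn -` A))
      = emeasure (distr lborel borel T) (ball 0 1 \<inter> sgn -` A)"
    using sA by (subst emeasure_distr) auto
  also have "\<dots> = emeasure lborel (ball 0 1 \<inter> sgn -` A)"
    by (simp add: lborel_orthogonal_transformation[OF T])
  also have "\<dots> / emeasure lborel (ball (0::'a) 1)
      = emeasure (uniform_measure lborel (ball 0 1)) (sgn -` A)"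
    using sA by (subst emeasure_uniform_measure) auto
  also have "\<dots> = emeasure sphere_measure A"
    using A by (rule emeasure_sphere_measure[symmetric])
  finally show "emeasure (distr sphere_measure sphere_measure T) A = emeasure sphere_measure A" .
qed simp


section \<open>Cyclicity in a Hilbert space of holomorphic functions\<close>

text \<open>A space of functions on a domain \<open>\<Omega>\<close> is modelled as a set of total functions on the ambient
  type, membership in which depends only on the values on \<open>\<Omega>\<close>; values outside \<open>\<Omega>\<close> are
  irrelevant throughout. The norm is given as a separate argument.\<close>

definition Mult :: "('a \<Rightarrow> complex) set \<Rightarrow> ('a \<Rightarrow> complex) set" where
  "Mult H = {\<phi>. \<forall>f\<in>H. (\<lambda>x. \<phi> x * f x) \<in> H}"

definition cyclic_in ::
  "('a \<Rightarrow> complex) set \<Rightarrow> (('a \<Rightarrow> complex) \<Rightarrow> real) \<Rightarrow> ('a \<Rightarrow> complex) \<Rightarrow> bool" where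
  "cyclic_in H nrm f \<longleftrightarrow>
     f \<in> H \<and> (\<forall>g\<in>H. \<forall>\<epsilon>>0. \<exists>u\<in>Mult H. nrm (\<lambda>x. g x - u x * f x) < \<epsilon>)"


section \<open>The Bergman space and singular inner functions on the disc\<close>

definition bergman_sqnorm :: "(complex \<Rightarrow> complex) \<Rightarrow> ennreal" where
  "bergman_sqnorm g = (\<integral>\<^sup>+z\<in>ball 0 1. ennreal ((norm (g z))\<^sup>2 / pi) \<partial>lborel)"

definition bergman_norm :: "(complex \<Rightarrow> complex) \<Rightarrow> real" where
  "bergman_norm g = sqrt (enn2real (bergman_sqnorm g))"

definition bergman_space :: "(complex \<Rightarrow> complex) set" where
  "bergman_space = {g. g holomorphic_on ball 0 1 \<and> bergman_sqnorm g < \<infinity>}"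

definition arc_length :: "complex measure" where
  "arc_length =
     distr (uniform_measure lborel {0..2*pi}) (restrict_space borel (sphere 0 1)) cis"

text \<open>A singular inner function is, up to a unimodular constant,
  \<open>z \<mapsto> exp (- \<integral> (\<zeta> + z) / (\<zeta> - z) d\<mu>(\<zeta>))\<close> for a finite positive Borel measure \<open>\<mu>\<close> on the circle
  that is concentrated on a set of arc length zero.\<close>

definition singular_inner :: "(complex \<Rightarrow> complex) \<Rightarrow> bool" where
  "singular_inner S \<longleftrightarrow>
     (\<exists>c \<mu>. norm c = 1 \<and> finite_measure \<mu> \<and>
        sets \<mu> = sets (restrict_space borel (sphere (0::complex) 1)) \<and>
        (\<exists>N\<in>null_sets arc_length. emeasure \<mu> (space \<mu> - N) = 0) \<and>
        (\<forall>z\<in>ball 0 1. S z = c * exp (- (\<integral>\<zeta>. (\<zeta> + z) / (\<zeta> - z) \<partial>\<mu>))))"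


section \<open>Function spaces on the unit ball of \<open>complex \<times> complex\<close>\<close>

text \<open>The product norm on \<open>complex \<times> complex\<close> is the Euclidean one, so \<open>ball 0 1\<close> is the
  Euclidean unit ball. Holomorphy on an open set means complex differentiability: the derivative
  is a complex-linear functional.\<close>

definition holomorphic2_on ::
  "(complex \<times> complex \<Rightarrow> complex) \<Rightarrow> (complex \<times> complex) set \<Rightarrow> bool" where
  "holomorphic2_on f U \<longleftrightarrow>
     (\<forall>p\<in>U. \<exists>a b. (f has_derivative (\<lambda>(h, k). a * h + b * k)) (at p))"

definition hardy_sqnorm :: "(complex \<times> complex \<Rightarrow> complex) \<Rightarrow> ennreal" where
  "hardy_sqnorm h =
     (SUP r\<in>{0..<1::real}. \<integral>\<^sup>+z. ennreal ((norm (h (r *\<^sub>R z)))\<^sup>2) \<partial>sphere_measure)"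

definition hardy_norm :: "(complex \<times> complex \<Rightarrow> complex) \<Rightarrow> real" where
  "hardy_norm h = sqrt (enn2real (hardy_sqnorm h))"

definition hardy_space :: "(complex \<times> complex \<Rightarrow> complex) set" where
  "hardy_space = {h. holomorphic2_on h (ball 0 1) \<and> hardy_sqnorm h < \<infinity>}"

text \<open>The integral means of \<open>norm h ^ 2\<close> increase with \<open>r\<close>, so their supremum is their limit as
  \<open>r\<close> tends to 1; the following is therefore the inner product that induces \<open>hardy_norm\<close>.\<close>

definition hardy_inner ::
  "(complex \<times> complex \<Rightarrow> complex) \<Rightarrow> (complex \<times> complex \<Rightarrow> complex) \<Rightarrow> complex" where
  "hardy_inner g h =
     Lim (at_left (1::real)) (\<lambda>r. \<integral>z. g (r *\<^sub>R z) * cnj (h (r *\<^sub>R z)) \<partial>sphere_measure)"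

definition H_inf :: "(complex \<times> complex \<Rightarrow> complex) set" where
  "H_inf = {\<phi>. holomorphic2_on \<phi> (ball 0 1) \<and> bounded (\<phi> ` ball 0 1)}"

text \<open>Weak-star convergence of the multiplication operators, where the bounded operators on the
  Hardy space are the dual of the trace class under \<open>(A, T) \<mapsto> tr (A T)\<close>. The trace class
  operators are \<open>T = (\<Sum>k. \<langle>\<cdot>, y k\<rangle> x k)\<close> with \<open>x\<close>, \<open>y\<close> square summable in norm, and then
  \<open>tr (A T) = (\<Sum>k. \<langle>A (x k), y k\<rangle>)\<close>.\<close>

definition trace_pairing ::
  "(complex \<times> complex \<Rightarrow> complex) \<Rightarrow>
   (nat \<Rightarrow> complex \<times> complex \<Rightarrow> complex) \<Rightarrow> (nat \<Rightarrow> complex \<times> complex \<Rightarrow> complex) \<Rightarrow> complex" where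
  "trace_pairing \<phi> x y = (\<Sum>k. hardy_inner (\<lambda>p. \<phi> p * x k p) (y k))"

definition weak_star_tendsto ::
  "(nat \<Rightarrow> complex \<times> complex \<Rightarrow> complex) \<Rightarrow> (complex \<times> complex \<Rightarrow> complex) \<Rightarrow> bool" where
  "weak_star_tendsto \<Phi> \<phi> \<longleftrightarrow>
     (\<forall>x y. range x \<subseteq> hardy_space \<and> range y \<subseteq> hardy_space \<and>
        summable (\<lambda>k. (hardy_norm (x k))\<^sup>2) \<and> summable (\<lambda>k. (hardy_norm (y k))\<^sup>2) \<longrightarrow>
        (\<lambda>n. trace_pairing (\<Phi> n) x y) \<longlonglongrightarrow> trace_pairing \<phi> x y)"

definition weak_star_seq_cyclic :: "(complex \<times> complex \<Rightarrow> complex) \<Rightarrow> bool" where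
  "weak_star_seq_cyclic \<phi> \<longleftrightarrow>
     (\<exists>u. range u \<subseteq> H_inf \<and> weak_star_tendsto (\<lambda>n p. u n p * \<phi> p) (\<lambda>p. 1))"

end

theory Submission
  imports Defs "HOL-Complex_Analysis.Complex_Analysis"
begin

text \<open>Cyclicity. The weight that the first coordinate induces on the disc from the sphere of
  \<open>complex \<times> complex\<close> is the area measure, so \<open>h \<mapsto> (\<lambda>(z, w). h z)\<close> maps the Bergman space
  isometrically into the Hardy space; the inequality \<open>hardy_fst_le_bergman\<close> is what matters. A
  multiplier \<open>u\<close> with \<open>u S\<close> close to \<open>1\<close> in the Bergman space thus makes \<open>u(z) S(z)\<close> close to \<open>1\<close>
  on the ball. Dilations \<open>x \<mapsto> g (r x)\<close> converge to \<open>g\<close> in the Hardy norm, since they multiply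
  the orthogonal homogeneous terms of \<open>g\<close> by \<open>r ^ k\<close>, and they are bounded. Therefore a function
  \<open>g\<close> of the Hardy space is approximated by \<open>g (\<rho> x) u (s z) S(z)\<close>, where the factor in front of
  \<open>S\<close> is bounded and hence a multiplier (\<open>cyclic_hardy_fst\<close>).

  Failure of sequential weak-star cyclicity. Suppose that \<open>u\<^sub>n f \<rightarrow> 1\<close> weak-star. Testing
  against sums of rank one operators built from the normalized reproducing kernels at points
  \<open>(p, 0)\<close> turns this into the convergence of \<open>\<Sum>l. w\<^sub>l (u\<^sub>n f)(p\<^sub>l, 0)\<close> for all summable \<open>w\<close>
  (\<open>weak_star_tendsto_points\<close>). The uniform boundedness principle for \<open>l\<^sup>1\<close>
  (\<open>uniform_boundedness_l1\<close>) gives \<open>C\<close> with \<open>norm (v\<^sub>n S) \<le> C\<close> on the disc, where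
  \<open>v\<^sub>n(z) = u\<^sub>n(z, 0)\<close>, and \<open>v\<^sub>n S \<rightarrow> 1\<close> pointwise. As \<open>S\<close> is inner, dividing by it does not increase
  quadratic circle means in the limit (\<open>quotient_mean_le\<close>), so the means of \<open>norm v\<^sub>n ^ 2\<close> are at
  most \<open>C ^ 2\<close>, and by Fatou's lemma so are those of \<open>1 / norm S ^ 2 = exp (2 P)\<close>, where
  \<open>P = - ln (norm S)\<close> is the Poisson integral of the singular measure. But the means of
  \<open>1 - exp (- 2 P)\<close> tend to \<open>0\<close> because the measure is singular. Interpolating between these two
  facts, the mean of \<open>P\<close>, which is the total mass of the measure on every circle, has to vanish
  (\<open>total_mass_zero\<close>). Then \<open>S\<close> is constant, which is excluded.\<close>

section \<open>Fourier series on the circle\<close>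

definition angle :: "real measure" where
  "angle = uniform_measure lborel {0..2*pi}"

lemma sets_angle [simp, measurable_cong]: "sets angle = sets borel"
  by (simp add: angle_def)

lemma space_angle [simp]: "space angle = UNIV"
  by (simp add: angle_def)

lemma prob_space_angle: "prob_space angle"
  unfolding angle_def by (intro prob_space_uniform_measure) auto

interpretation angle: prob_space angle
  by (rule prob_space_angle)

text \<open>The value by definition, as an integral over an interval: this is the form to which the
  fundamental theorem of calculus applies.\<close>

lemma integral_angle:
  fixes f :: "real \<Rightarrow> complex"
  assumes [measurable]: "f \<in> borel_measurable borel"
  shows "integral\<^sup>L angle f = (LINT t:{0..2*pi}|lborel. f t) /\<^sub>R (2*pi)"
proof -
  define w where "w = (\<lambda>t. indicator {0..2*pi} t / (2*pi) :: real)"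
  have [measurable]: "w \<in> borel_measurable borel"
    unfolding w_def by measurable
  have w: "0 \<le> w t" for t by (simp add: w_def)
  have angle_eq: "angle = density lborel (\<lambda>t. ennreal (w t))"
    unfolding angle_def uniform_measure_def w_def
    by (intro density_cong) (auto simp: indicator_def divide_ennreal ennreal_1[symmetric] simp del: ennreal_1)
  have "integral\<^sup>L angle f = (LINT t|lborel. w t *\<^sub>R f t)"
    unfolding angle_eq by (rule integral_density) (use w in auto)
  also have "\<dots> = (LINT t|lborel. (indicator {0..2*pi} t *\<^sub>R f t) /\<^sub>R (2*pi))"
    by (intro Bochner_Integration.integral_cong refl) (simp add: w_def divide_inverse mult.commute[of "inverse _"] del: inverse_mult_distrib)
  also have "\<dots> = (LINT t|lborel. (indicator {0..2*pi} t *\<^sub>R f t)) /\<^sub>R (2*pi)"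
    by (rule integral_scaleR_right)
  finally show ?thesis unfolding set_lebesgue_integral_def .
qed

lemma cis_measurable [measurable]: "cis \<in> borel_measurable borel"
  by (intro borel_measurable_continuous_onI continuous_intros)

lemma integral_angle_cis:
  "(\<integral>t. cis (of_int n * t) \<partial>angle) = (if n = 0 then 1 else 0)"
proof (cases "n = 0")
  case True
  then show ?thesis using angle.prob_space by simp
next
  case False
  have "has_bochner_integral lborel (\<lambda>t. indicator {0..2*pi} t *\<^sub>R cis (of_int n * t))
     (cis (of_int n * (2*pi)) / (\<i> * of_int n) - cis (of_int n * 0) / (\<i> * of_int n))"
  proof (rule has_bochner_integral_FTC_Icc)
    fix t :: real
    show "((\<lambda>t. cis (of_int n * t) / (\<i> * of_int n)) has_vector_derivative cis (of_int n * t))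
            (at t within {0..2*pi})"
      using False unfolding cis_conv_exp
      by (auto intro!: derivative_eq_intros has_vector_derivative_real_field simp: field_simps)
  qed (auto intro!: continuous_intros)
  moreover have "cis (of_int n * (2*pi)) = 1"
    by (metis cis_multiple_2pi mult.commute Ints_of_int)
  ultimately have "(LINT t:{0..2*pi}|lborel. cis (of_int n * t)) = 0"
    unfolding set_lebesgue_integral_def by (simp add: has_bochner_integral_iff)
  then show ?thesis using False by (simp add: integral_angle)
qed

lemma integral_angle_fourier_coeff:
  fixes c :: "nat \<Rightarrow> complex"
  assumes c: "summable (\<lambda>k. norm (c k))"
  shows "(\<integral>t. (\<Sum>k. c k * cis (of_nat k * t)) * cis (- of_nat j * t) \<partial>angle) = c j"
proof -
  have "(\<integral>t. (\<Sum>k. c k * cis (of_nat k * t)) * cis (- of_nat j * t) \<partial>angle)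
      = (\<integral>t. (\<Sum>k. c k * cis (of_int (int k - int j) * t)) \<partial>angle)"
  proof (intro Bochner_Integration.integral_cong refl)
    fix t
    have "summable (\<lambda>k. c k * cis (of_nat k * t))"
      by (rule summable_norm_cancel) (use c in \<open>simp add: norm_mult\<close>)
    then have s: "(\<lambda>k. c k * cis (of_nat k * t) * cis (- of_nat j * t)) sums
        ((\<Sum>k. c k * cis (of_nat k * t)) * cis (- of_nat j * t))"
      by (intro sums_mult2 summable_sums)
    have e: "c k * cis (of_nat k * t) * cis (- of_nat j * t) = c k * cis (of_int (int k - int j) * t)" for k
    proof -
      have "of_nat k * t + - of_nat j * t = of_int (int k - int j) * t"
        by (simp add: left_diff_distrib)
      then show ?thesis by (metis cis_mult mult.assoc)
    qed
    show "(\<Sum>k. c k * cis (of_nat k * t)) * cis (- of_nat j * t)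
        = (\<Sum>k. c k * cis (of_int (int k - int j) * t))"
      using s unfolding e by (rule sums_unique)
  qed
  also have "\<dots> = (\<Sum>k. \<integral>t. c k * cis (of_int (int k - int j) * t) \<partial>angle)"
  proof (rule integral_suminf)
    show "integrable angle (\<lambda>t. c k * cis (of_int (int k - int j) * t))" for k
      by (rule angle.integrable_const_bound[where B = "norm (c k)"]) (auto simp: norm_mult)
    show "AE t in angle. summable (\<lambda>k. norm (c k * cis (of_int (int k - int j) * t)))"
      using c by (simp add: norm_mult)
    show "summable (\<lambda>k. \<integral>t. norm (c k * cis (of_int (int k - int j) * t)) \<partial>angle)"
      using c angle.prob_space by (simp add: norm_mult)
  qed
  also have "\<dots> = (\<Sum>k. if k = j then c k else 0)"
    by (intro suminf_cong) (simp add: integral_angle_cis del: of_int_diff)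
  also have "\<dots> = c j"
    by (rule sums_unique[symmetric]) (use sums_single[of j c] in simp)
  finally show ?thesis .
qed

text \<open>Expand the second factor and integrate term by term: each integral is a Fourier coefficient of
  the first factor. Absolute summability, which holds inside the disc of convergence, gives
  dominated convergence.\<close>

lemma parseval_polarized:
  fixes c d :: "nat \<Rightarrow> complex"
  assumes c: "summable (\<lambda>k. norm (c k))" and d: "summable (\<lambda>k. norm (d k))"
  shows "(\<integral>t. (\<Sum>k. c k * cis (of_nat k * t)) * cnj (\<Sum>k. d k * cis (of_nat k * t)) \<partial>angle)
     = (\<Sum>k. c k * cnj (d k))"
proof -
  define f where "f t = (\<Sum>k. c k * cis (of_nat k * t))" for t
  have fsum: "summable (\<lambda>k. c k * cis (of_nat k * t))" for t
    by (rule summable_norm_cancel) (use c in \<open>simp add: norm_mult\<close>)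
  have fb: "norm (f t) \<le> (\<Sum>k. norm (c k))" for t
    unfolding f_def by (rule order_trans[OF summable_norm]) (use c in \<open>auto simp: norm_mult\<close>)
  have [measurable]: "f \<in> borel_measurable borel"
    unfolding f_def by measurable
  have dsum: "summable (\<lambda>k. d k * cis (of_nat k * t))" for t
    by (rule summable_norm_cancel) (use d in \<open>simp add: norm_mult\<close>)
  define C where "C = (\<Sum>k. norm (c k))"
  have C: "C \<ge> 0" unfolding C_def using c by (intro suminf_nonneg) auto
  have "(\<integral>t. f t * cnj (\<Sum>k. d k * cis (of_nat k * t)) \<partial>angle)
      = (\<integral>t. (\<Sum>k. f t * cnj (d k) * cis (- of_nat k * t)) \<partial>angle)"
  proof (intro Bochner_Integration.integral_cong refl)
    fix t
    have "(\<lambda>k. cnj (d k * cis (of_nat k * t))) sums cnj (\<Sum>k. d k * cis (of_nat k * t))"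
      by (subst sums_cnj) (rule summable_sums[OF dsum])
    then have "(\<lambda>k. f t * cnj (d k * cis (of_nat k * t))) sums (f t * cnj (\<Sum>k. d k * cis (of_nat k * t)))"
      by (rule sums_mult)
    then show "f t * cnj (\<Sum>k. d k * cis (of_nat k * t)) = (\<Sum>k. f t * cnj (d k) * cis (- of_nat k * t))"
      by (auto simp: sums_iff cis_cnj mult.assoc)
  qed
  also have "\<dots> = (\<Sum>k. \<integral>t. f t * cnj (d k) * cis (- of_nat k * t) \<partial>angle)"
  proof (rule integral_suminf)
    show "integrable angle (\<lambda>t. f t * cnj (d k) * cis (- of_nat k * t))" for k
      by (rule angle.integrable_const_bound[where B = "C * norm (d k)"])
         (auto simp: norm_mult fb C_def intro!: mult_right_mono)
    show "AE t in angle. summable (\<lambda>k. norm (f t * cnj (d k) * cis (- of_nat k * t)))"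
      using d by (auto simp: norm_mult intro!: summable_mult)
    have *: "(\<integral>t. norm (f t * cnj (d k) * cis (- of_nat k * t)) \<partial>angle) \<le> C * norm (d k)" for k
    proof -
      have "(\<integral>t. norm (f t * cnj (d k) * cis (- of_nat k * t)) \<partial>angle) \<le> (\<integral>t. C * norm (d k) \<partial>angle)"
        by (rule integral_mono')
           (auto simp: norm_mult fb[folded C_def] C intro!: mult_right_mono)
      then show ?thesis using angle.prob_space by simp
    qed
    show "summable (\<lambda>k. \<integral>t. norm (f t * cnj (d k) * cis (- of_nat k * t)) \<partial>angle)"
      by (rule summable_comparison_test'[OF summable_mult[OF d, of C]]) (use * in auto)
  qed
  also have "\<dots> = (\<Sum>k. c k * cnj (d k))"
  proof (intro suminf_cong)
    fix k
    have "(\<integral>t. f t * cnj (d k) * cis (- of_nat k * t) \<partial>angle)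
        = (\<integral>t. cnj (d k) * (f t * cis (- of_nat k * t)) \<partial>angle)"
      by (simp add: mult_ac)
    also have "\<dots> = cnj (d k) * (\<integral>t. f t * cis (- of_nat k * t) \<partial>angle)"
      by simp
    also have "(\<integral>t. f t * cis (- of_nat k * t) \<partial>angle) = c k"
      unfolding f_def by (rule integral_angle_fourier_coeff[OF c])
    finally show "(\<integral>t. f t * cnj (d k) * cis (- of_nat k * t) \<partial>angle) = c k * cnj (d k)"
      by (simp add: mult.commute)
  qed
  finally show ?thesis by (simp add: f_def)
qed

text \<open>The diagonal case, stated for nonnegative integrals so that monotone convergence
  applies when it is integrated over a family of circles.\<close>

lemma parseval:
  fixes c :: "nat \<Rightarrow> complex"
  assumes c: "summable (\<lambda>k. norm (c k))"
  shows "(\<integral>\<^sup>+t. ennreal ((norm (\<Sum>k. c k * cis (of_nat k * t)))\<^sup>2) \<partial>angle)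
     = (\<Sum>k. ennreal ((norm (c k))\<^sup>2))"
proof -
  define f where "f t = (\<Sum>k. c k * cis (of_nat k * t))" for t
  have fb: "norm (f t) \<le> (\<Sum>k. norm (c k))" for t
    unfolding f_def by (rule order_trans[OF summable_norm]) (use c in \<open>auto simp: norm_mult\<close>)
  have [measurable]: "f \<in> borel_measurable borel"
    unfolding f_def by measurable
  have int: "integrable angle (\<lambda>t. (norm (f t))\<^sup>2)"
    by (rule angle.integrable_const_bound[where B = "(\<Sum>k. norm (c k))\<^sup>2"])
       (auto intro!: power_mono fb)
  have nn: "0 \<le> (\<integral>t. (norm (f t))\<^sup>2 \<partial>angle)" by simp
  have ev: "eventually (\<lambda>k. norm (c k) < 1) sequentially"
    using summable_LIMSEQ_zero[OF c] by (rule order_tendstoD) simp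
  have sq: "summable (\<lambda>k. (norm (c k))\<^sup>2)"
  proof (rule summable_comparison_test_ev[OF _ c])
    show "\<forall>\<^sub>F n in sequentially. norm ((cmod (c n))\<^sup>2) \<le> cmod (c n)"
      using ev by eventually_elim (auto simp: power2_eq_square intro: mult_left_le)
  qed
  have "complex_of_real (\<integral>t. (norm (f t))\<^sup>2 \<partial>angle) = (\<integral>t. f t * cnj (f t) \<partial>angle)"
    by (simp only: integral_complex_of_real[symmetric] complex_norm_square)
  also have "\<dots> = (\<Sum>k. c k * cnj (c k))"
    unfolding f_def by (rule parseval_polarized[OF c c])
  also have "\<dots> = (\<Sum>k. complex_of_real ((norm (c k))\<^sup>2))"
    by (simp add: complex_norm_square del: of_real_power)
  also have "\<dots> = complex_of_real (\<Sum>k. (norm (c k))\<^sup>2)"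
    using sq by (rule suminf_of_real[symmetric])
  finally have eq: "(\<integral>t. (norm (f t))\<^sup>2 \<partial>angle) = (\<Sum>k. (norm (c k))\<^sup>2)"
    by (simp only: of_real_eq_iff)
  have "(\<integral>\<^sup>+t. ennreal ((norm (f t))\<^sup>2) \<partial>angle) = ennreal (\<integral>t. (norm (f t))\<^sup>2 \<partial>angle)"
    by (rule nn_integral_eq_integral[OF int]) simp
  also have "\<dots> = (\<Sum>k. ennreal ((norm (c k))\<^sup>2))"
    unfolding eq by (rule suminf_ennreal2[symmetric]) (use sq in auto)
  finally show ?thesis by (simp add: f_def)
qed

section \<open>Taylor coefficients on the disc\<close>

definition tcoeff :: "(complex \<Rightarrow> complex) \<Rightarrow> nat \<Rightarrow> complex" where
  "tcoeff F k = (deriv ^^ k) F 0 / fact k"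

lemma tcoeff_sums:
  assumes "F holomorphic_on ball 0 1" "norm z < 1"
  shows "(\<lambda>k. tcoeff F k * z ^ k) sums F z"
  using holomorphic_power_series[OF assms(1), of z] assms(2) by (simp add: tcoeff_def)

lemma tcoeff_summable:
  assumes F: "F holomorphic_on ball 0 1" and z: "norm z < 1"
  shows "summable (\<lambda>k. norm (tcoeff F k * z ^ k))"
proof -
  obtain r where r: "norm z < r" "r < 1" using z dense by blast
  have "0 \<le> r" using r(1) norm_ge_zero[of z] by linarith
  have "summable (\<lambda>k. tcoeff F k * complex_of_real r ^ k)"
    using tcoeff_sums[OF F, of "complex_of_real r"] r \<open>0 \<le> r\<close> by (auto simp: sums_iff)
  then show ?thesis
    by (rule powser_insidea) (use r \<open>0 \<le> r\<close> in auto)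
qed

text \<open>On a circle inside the disc, a power series is an absolutely convergent Fourier series with
  nonnegative frequencies.\<close>

lemma circle_series:
  assumes F: "F holomorphic_on ball 0 1" and z: "norm z < 1"
  shows "summable (\<lambda>k. norm (tcoeff F k * z ^ k))"
    "F (z * cis t) = (\<Sum>k. (tcoeff F k * z ^ k) * cis (of_nat k * t))"
proof -
  show "summable (\<lambda>k. norm (tcoeff F k * z ^ k))" by (rule tcoeff_summable[OF F z])
  have "(\<lambda>k. tcoeff F k * (z * cis t) ^ k) sums F (z * cis t)"
    by (rule tcoeff_sums[OF F]) (use z in \<open>simp add: norm_mult\<close>)
  then show "F (z * cis t) = (\<Sum>k. (tcoeff F k * z ^ k) * cis (of_nat k * t))"
    by (simp add: sums_iff power_mult_distrib Complex.DeMoivre mult_ac)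
qed

lemma circle_mean_value:
  assumes F: "F holomorphic_on ball 0 1" and z: "norm z < 1"
  shows "(\<integral>t. F (z * cis t) \<partial>angle) = F 0"
proof -
  have "tcoeff F 0 = F 0" by (simp add: tcoeff_def)
  moreover have "(\<integral>t. F (z * cis t) * cis (- of_nat 0 * t) \<partial>angle) = tcoeff F 0 * z ^ 0"
    unfolding circle_series(2)[OF F z]
    by (rule integral_angle_fourier_coeff[OF circle_series(1)[OF F z]])
  ultimately show ?thesis by simp
qed

section \<open>Averaging over circle actions\<close>

text \<open>What averaging over the circle uses: Fubini's theorem needs joint measurability, and the change
  of variables needs the invariance of the measure.\<close>

definition circle_action :: "'a measure \<Rightarrow> (real \<Rightarrow> 'a \<Rightarrow> 'a) \<Rightarrow> bool" where
  "circle_action M rot \<longleftrightarrow> sigma_finite_measure M \<and>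
     (\<lambda>(t, x). rot t x) \<in> measurable (angle \<Otimes>\<^sub>M M) M \<and> (\<forall>t. distr M M (rot t) = M)"

lemma circle_action_measurable:
  assumes "circle_action M rot"
  shows "rot t \<in> measurable M M"
proof -
  have "(\<lambda>(t, x). rot t x) \<in> measurable (angle \<Otimes>\<^sub>M M) M"
    using assms by (simp add: circle_action_def)
  from measurable_compose[OF measurable_Pair1'[of t angle M] this] show ?thesis by simp
qed

lemma nn_integral_circle_average:
  assumes act: "circle_action M rot" and F [measurable]: "F \<in> borel_measurable M"
  shows "(\<integral>\<^sup>+x. F x \<partial>M) = (\<integral>\<^sup>+x. \<integral>\<^sup>+t. F (rot t x) \<partial>angle \<partial>M)"
proof -
  interpret M: sigma_finite_measure M using act by (simp add: circle_action_def)
  interpret P: pair_sigma_finite angle M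
    by (simp add: pair_sigma_finite_def M.sigma_finite_measure_axioms angle.sigma_finite_measure_axioms)
  have rot [measurable]: "(\<lambda>(t, x). rot t x) \<in> measurable (angle \<Otimes>\<^sub>M M) M"
    using act by (simp add: circle_action_def)
  have rot1 [measurable]: "rot t \<in> measurable M M" for t
    using act by (rule circle_action_measurable)
  have m: "(\<lambda>(t, x). F (rot t x)) \<in> borel_measurable (angle \<Otimes>\<^sub>M M)"
    using measurable_compose[OF rot F] by (simp add: case_prod_beta')
  have "(\<integral>\<^sup>+x. F x \<partial>M) = (\<integral>\<^sup>+x. F x \<partial>distr M M (rot t))" for t
    using act by (simp add: circle_action_def)
  then have "(\<integral>\<^sup>+x. F x \<partial>M) = (\<integral>\<^sup>+x. F (rot t x) \<partial>M)" for t
    by (simp add: nn_integral_distr)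
  then have "(\<integral>\<^sup>+x. F x \<partial>M) = (\<integral>\<^sup>+t. \<integral>\<^sup>+x. F (rot t x) \<partial>M \<partial>angle)"
    using angle.emeasure_space_1 by simp
  also have "\<dots> = (\<integral>\<^sup>+x. \<integral>\<^sup>+t. F (rot t x) \<partial>angle \<partial>M)"
    by (rule P.Fubini'[OF m, symmetric])
  finally show ?thesis .
qed

lemma integral_circle_average:
  fixes F :: "'a \<Rightarrow> complex"
  assumes act: "circle_action M rot" and F [measurable]: "F \<in> borel_measurable M"
    and fin: "finite_measure M" and B: "\<And>x. x \<in> space M \<Longrightarrow> norm (F x) \<le> B"
  shows "(\<integral>x. F x \<partial>M) = (\<integral>x. \<integral>t. F (rot t x) \<partial>angle \<partial>M)"
proof -
  interpret M: finite_measure M by fact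
  interpret P: pair_sigma_finite angle M
    by (simp add: pair_sigma_finite_def M.sigma_finite_measure_axioms angle.sigma_finite_measure_axioms)
  have rot [measurable]: "(\<lambda>(t, x). rot t x) \<in> measurable (angle \<Otimes>\<^sub>M M) M"
    using act by (simp add: circle_action_def)
  have rot1 [measurable]: "rot t \<in> measurable M M" for t
    using act by (rule circle_action_measurable)
  have m: "(\<lambda>(t, x). F (rot t x)) \<in> borel_measurable (angle \<Otimes>\<^sub>M M)"
    using measurable_compose[OF rot F] by (simp add: case_prod_beta')
  have int: "integrable (angle \<Otimes>\<^sub>M M) (\<lambda>(t, x). F (rot t x))"
  proof -
    interpret PF: finite_measure "angle \<Otimes>\<^sub>M M"
      by (rule finite_measure_pair_measure) (simp_all add: angle.finite_measure_axioms fin)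
    show ?thesis
      by (rule PF.integrable_const_bound[where B = B])
         (use m B measurable_space[OF rot1] in \<open>auto simp: space_pair_measure\<close>)
  qed
  have "(\<integral>x. F x \<partial>M) = (\<integral>x. F x \<partial>distr M M (rot t))" for t
    using act by (simp add: circle_action_def)
  then have "(\<integral>x. F x \<partial>M) = (\<integral>x. F (rot t x) \<partial>M)" for t
    by (simp add: integral_distr)
  then have "(\<integral>x. F x \<partial>M) = (\<integral>t. \<integral>x. F (rot t x) \<partial>M \<partial>angle)"
    using angle.prob_space by simp
  also have "\<dots> = (\<integral>x. \<integral>t. F (rot t x) \<partial>angle \<partial>M)"
    using P.Fubini_integral[OF int] by simp
  finally show ?thesis .
qed

text \<open>Average \<open>norm g ^ 2\<close> over each orbit, where Parseval's identity applies. The coefficients are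
  measurable because they are Fourier integrals over the orbits.\<close>

lemma parseval_circle_action:
  fixes g :: "'a \<Rightarrow> complex"
  assumes act: "circle_action M rot" and g [measurable]: "g \<in> borel_measurable M"
    and c: "\<And>x. x \<in> space M \<Longrightarrow> summable (\<lambda>k. norm (c k x))"
    and series: "\<And>x t. x \<in> space M \<Longrightarrow> g (rot t x) = (\<Sum>k. c k x * cis (of_nat k * t))"
  shows "c j \<in> borel_measurable M"
    and "(\<integral>\<^sup>+x. ennreal ((norm (g x))\<^sup>2) \<partial>M) = (\<Sum>k. \<integral>\<^sup>+x. ennreal ((norm (c k x))\<^sup>2) \<partial>M)"
proof -
  have rot [measurable]: "(\<lambda>(t, x). rot t x) \<in> measurable (angle \<Otimes>\<^sub>M M) M"
    using act by (simp add: circle_action_def)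
  have rot': "(\<lambda>(x, t). rot t x) \<in> measurable (M \<Otimes>\<^sub>M angle) M"
    using measurable_compose[OF measurable_pair_swap' rot] by (simp add: case_prod_beta')
  have m: "(\<lambda>(x, t). g (rot t x)) \<in> borel_measurable (M \<Otimes>\<^sub>M angle)"
    using measurable_compose[OF rot' g] by (simp add: case_prod_beta')
  have cm: "c j \<in> borel_measurable M" for j
  proof -
    have G: "(\<lambda>x. \<integral>t. g (rot t x) * cis (- of_nat j * t) \<partial>angle) \<in> borel_measurable M"
      by (rule angle.borel_measurable_lebesgue_integral) (use m in measurable)
    have "(\<integral>t. g (rot t x) * cis (- of_nat j * t) \<partial>angle) = c j x" if "x \<in> space M" for x
      unfolding series[OF that] by (rule integral_angle_fourier_coeff[OF c[OF that]])
    then have "c j \<in> borel_measurable M \<longleftrightarrow>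
        (\<lambda>x. \<integral>t. g (rot t x) * cis (- of_nat j * t) \<partial>angle) \<in> borel_measurable M"
      by (intro measurable_cong) (rule sym)
    then show ?thesis using G by blast
  qed
  then show "c j \<in> borel_measurable M" .
  have "(\<integral>\<^sup>+x. ennreal ((norm (g x))\<^sup>2) \<partial>M)
      = (\<integral>\<^sup>+x. \<integral>\<^sup>+t. ennreal ((norm (g (rot t x)))\<^sup>2) \<partial>angle \<partial>M)"
    by (rule nn_integral_circle_average[OF act]) measurable
  also have "\<dots> = (\<integral>\<^sup>+x. (\<Sum>k. ennreal ((norm (c k x))\<^sup>2)) \<partial>M)"
    by (rule nn_integral_cong) (simp add: series parseval[OF c])
  also have "\<dots> = (\<Sum>k. \<integral>\<^sup>+x. ennreal ((norm (c k x))\<^sup>2) \<partial>M)"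
    by (rule nn_integral_suminf) (use cm in measurable)
  finally show "(\<integral>\<^sup>+x. ennreal ((norm (g x))\<^sup>2) \<partial>M) = (\<Sum>k. \<integral>\<^sup>+x. ennreal ((norm (c k x))\<^sup>2) \<partial>M)" .
qed

section \<open>The circle acting on the sphere and on the disc\<close>

abbreviation \<sigma> :: "(complex \<times> complex) measure" where
  "\<sigma> \<equiv> sphere_measure"

interpretation sig: prob_space \<sigma>
  by (rule prob_space_sphere_measure)

text \<open>Complex scalar multiplication; the unit circle acts on the sphere through it.\<close>

definition cscale :: "complex \<Rightarrow> complex \<times> complex \<Rightarrow> complex \<times> complex" where
  "cscale l x = (l * fst x, l * snd x)"

lemma norm_cscale: "norm (cscale l x) = norm l * norm x"
proof -
  have "norm (cscale l x) = sqrt ((norm l)\<^sup>2 * ((norm (fst x))\<^sup>2 + (norm (snd x))\<^sup>2))"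
    by (simp add: cscale_def norm_Pair norm_mult power_mult_distrib distrib_left)
  then show ?thesis
    by (simp add: real_sqrt_mult norm_prod_def)
qed

lemma cscale_cscale: "cscale a (cscale b x) = cscale (a * b) x"
  by (simp add: cscale_def mult.assoc)

lemma scaleR_eq_cscale: "r *\<^sub>R x = cscale (of_real r) x"
  by (cases x) (simp add: cscale_def scaleR_conv_of_real)

text \<open>The sphere carries the trace of the Borel sets, so measurability is checked in the ambient
  space, where it follows from continuity.\<close>

lemma sphere_action_measurable:
  fixes rot :: "real \<Rightarrow> complex \<times> complex \<Rightarrow> complex \<times> complex"
  assumes c: "continuous_on UNIV (\<lambda>(t, x). rot t x)" and n: "\<And>t x. norm (rot t x) = norm x"
  shows "(\<lambda>(t, x). rot t x) \<in> measurable (angle \<Otimes>\<^sub>M \<sigma>) \<sigma>"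
proof -
  have id: "(\<lambda>x. x) \<in> measurable \<sigma> borel"
    by (subst measurable_cong_sets[OF sets_sphere_measure refl]) (auto intro: measurable_restrict_space1)
  have fb: "(\<lambda>(t, x). rot t x) \<in> measurable (borel \<Otimes>\<^sub>M borel) borel"
    using borel_measurable_continuous_onI[OF c] by (simp add: borel_prod)
  have "(\<lambda>p. (fst p, snd p)) \<in> measurable (angle \<Otimes>\<^sub>M \<sigma>) (borel \<Otimes>\<^sub>M borel)"
    using id by (intro measurable_Pair) (auto intro: measurable_compose[OF measurable_snd])
  from measurable_compose[OF this fb]
  have "(\<lambda>(t, x). rot t x) \<in> measurable (angle \<Otimes>\<^sub>M \<sigma>) borel"
    by (simp add: case_prod_beta')
  then have "(\<lambda>(t, x). rot t x) \<in> measurable (angle \<Otimes>\<^sub>M \<sigma>) (restrict_space borel (sphere 0 1))"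
    by (intro measurable_restrict_space2)
       (auto simp: space_pair_measure space_sphere_measure n)
  then show ?thesis
    by (subst measurable_cong_sets[OF refl sets_sphere_measure])
qed

lemma circle_action_sphere:
  fixes rot :: "real \<Rightarrow> complex \<times> complex \<Rightarrow> complex \<times> complex"
  assumes "continuous_on UNIV (\<lambda>(t, x). rot t x)" "\<And>t. linear (rot t)" "\<And>t x. norm (rot t x) = norm x"
  shows "circle_action \<sigma> rot"
  unfolding circle_action_def
proof (intro conjI allI)
  show "sigma_finite_measure \<sigma>" by (rule sig.sigma_finite_measure_axioms)
  show "(\<lambda>(t, x). rot t x) \<in> measurable (angle \<Otimes>\<^sub>M \<sigma>) \<sigma>"
    using assms(1,3) by (rule sphere_action_measurable)
  show "distr \<sigma> \<sigma> (rot t) = \<sigma>" for t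
    using assms(2,3) by (intro sphere_measure_invariant) (simp add: orthogonal_transformation)
qed

lemma circle_action_cscale: "circle_action \<sigma> (\<lambda>t. cscale (cis t))"
proof (rule circle_action_sphere)
  show "linear (cscale (cis t))" for t
    by (intro linearI) (auto simp: cscale_def distrib_left)
  show "continuous_on UNIV (\<lambda>(t, x). cscale (cis t) x)"
    unfolding cscale_def case_prod_beta' by (intro continuous_intros)
qed (simp add: norm_cscale)

text \<open>Rotating the second coordinate alone averages a holomorphic function to its value at
  \<open>(z, 0)\<close>.\<close>

definition snd_rotation :: "real \<Rightarrow> complex \<times> complex \<Rightarrow> complex \<times> complex" where
  "snd_rotation t x = (fst x, cis t * snd x)"

lemma circle_action_snd_rotation: "circle_action \<sigma> snd_rotation"
proof (rule circle_action_sphere)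
  show "linear (snd_rotation t)" for t
    by (intro linearI) (auto simp: snd_rotation_def distrib_left)
  show "continuous_on UNIV (\<lambda>(t, x). snd_rotation t x)"
    unfolding snd_rotation_def case_prod_beta' by (intro continuous_intros)
  show "norm (snd_rotation t x) = norm x" for t x
    by (cases x) (simp add: snd_rotation_def norm_Pair norm_mult)
qed

lemma circle_action_disc:
  "circle_action (restrict_space lborel (ball (0::complex) 1)) (\<lambda>t z. z * cis t)"
proof -
  let ?M = "restrict_space lborel (ball (0::complex) 1)"
  have ot: "orthogonal_transformation (\<lambda>z. z * cis t)" for t
    unfolding orthogonal_transformation by (auto simp: norm_mult intro!: linearI simp: distrib_right)
  have m2: "(\<lambda>(t, z). z * cis t) \<in> measurable (angle \<Otimes>\<^sub>M ?M) ?M"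
  proof (rule measurable_restrict_space2)
    show "(\<lambda>(t, z). z * cis t) \<in> space (angle \<Otimes>\<^sub>M ?M) \<rightarrow> ball 0 1"
      by (auto simp: space_pair_measure space_restrict_space norm_mult)
    have id: "(\<lambda>x. x) \<in> measurable ?M borel"
      by (rule measurable_restrict_space1) simp
    have "(\<lambda>p. snd p * cis (fst p)) \<in> borel_measurable (angle \<Otimes>\<^sub>M ?M)"
      using measurable_compose[OF measurable_snd id] by measurable
    then show "(\<lambda>(t, z). z * cis t) \<in> measurable (angle \<Otimes>\<^sub>M ?M) lborel"
      by (simp add: case_prod_beta')
  qed
  have inv: "distr ?M ?M (\<lambda>z. z * cis t) = ?M" for t
  proof (rule measure_eqI)
    fix A assume "A \<in> sets (distr ?M ?M (\<lambda>z. z * cis t))"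
    then have A: "A \<in> sets borel" "A \<subseteq> ball 0 1" by (auto simp: sets_restrict_space)
    have [measurable]: "(\<lambda>z. z * cis t) \<in> measurable ?M ?M"
      using measurable_compose[OF measurable_Pair1'[of t angle ?M] m2] by simp
    have [measurable]: "(\<lambda>z::complex. z * cis t) \<in> measurable borel borel" by measurable
    have pre: "(\<lambda>z. z * cis t) -` A \<inter> ball 0 1 = (\<lambda>z. z * cis t) -` A"
    proof -
      have "norm z < 1" if "z * cis t \<in> A" for z
      proof -
        have "z * cis t \<in> ball 0 1" using A(2) that by (rule subsetD)
        then show ?thesis by (simp add: norm_mult)
      qed
      then show ?thesis by (simp add: Int_absorb2 subset_iff)
    qed
    have preb: "(\<lambda>z. z * cis t) -` A \<in> sets borel"
      using measurable_sets[of "\<lambda>z. z * cis t" borel borel A] A(1) by simp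
    have "emeasure (distr ?M ?M (\<lambda>z. z * cis t)) A = emeasure ?M ((\<lambda>z. z * cis t) -` A \<inter> ball 0 1)"
      using A by (subst emeasure_distr) (auto simp: sets_restrict_space space_restrict_space)
    also have "\<dots> = emeasure lborel ((\<lambda>z. z * cis t) -` A)"
      unfolding pre using pre preb by (intro emeasure_restrict_space) auto
    also have "\<dots> = emeasure (distr lborel borel (\<lambda>z. z * cis t)) A"
      using A by (subst emeasure_distr) auto
    also have "\<dots> = emeasure ?M A"
      unfolding lborel_orthogonal_transformation[OF ot] using A
      by (intro emeasure_restrict_space[symmetric]) auto
    finally show "emeasure (distr ?M ?M (\<lambda>z. z * cis t)) A = emeasure ?M A" .
  qed simp
  have "sigma_finite_measure ?M"
    by (rule sigma_finite_measure_restrict_space) (auto simp: sigma_finite_lborel)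
  then show ?thesis using m2 inv by (simp add: circle_action_def)
qed

section \<open>Homogeneous expansions in the Hardy space\<close>

text \<open>Complex lines through the origin reduce holomorphy on the ball to one variable.\<close>

lemma holomorphic2_slice:
  assumes h: "holomorphic2_on h (ball 0 1)" and x: "norm x \<le> 1"
  shows "(\<lambda>l. h (cscale l x)) holomorphic_on ball 0 1"
proof (rule holomorphic_onI)
  fix l :: complex assume l: "l \<in> ball 0 1"
  have "norm l * norm x \<le> norm l * 1" using x by (intro mult_left_mono) auto
  then have "cscale l x \<in> ball 0 1" using l by (simp add: norm_cscale)
  then obtain a b where ab: "(h has_derivative (\<lambda>(u, v). a * u + b * v)) (at (cscale l x))"
    using h unfolding holomorphic2_on_def by blast
  have "((\<lambda>l. cscale l x) has_derivative (\<lambda>d. cscale d x)) (at l)"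
    unfolding cscale_def by (auto intro!: derivative_eq_intros)
  from diff_chain_at[OF this ab]
  have "((\<lambda>l. h (cscale l x)) has_derivative (\<lambda>d. (a * fst x + b * snd x) * d)) (at l)"
    by (simp add: o_def cscale_def algebra_simps)
  then have "((\<lambda>l. h (cscale l x)) has_field_derivative (a * fst x + b * snd x)) (at l)"
    by (simp add: has_field_derivative_def)
  then show "(\<lambda>l. h (cscale l x)) field_differentiable at l within ball 0 1"
    by (meson field_differentiable_at_within field_differentiable_def)
qed

lemma holomorphic2_continuous_on:
  assumes h: "holomorphic2_on h U"
  shows "continuous_on U h"
proof (intro continuous_at_imp_continuous_on ballI)
  fix x assume "x \<in> U"
  then show "isCont h x"
    using h unfolding holomorphic2_on_def by (meson has_derivative_continuous)
qed

lemma continuous_on_dilate: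
  fixes h :: "'a::real_normed_vector \<Rightarrow> 'b::topological_space"
  assumes h: "continuous_on (ball 0 1) h" and r: "0 \<le> r" "r < 1"
  shows "continuous_on (cball 0 1) (\<lambda>x. h (r *\<^sub>R x))"
proof (rule continuous_on_compose2[OF h])
  have "r * norm x < 1" if "norm x \<le> 1" for x :: 'a
    using mult_left_mono[OF that r(1)] r(2) by simp
  then show "(*\<^sub>R) r ` cball 0 1 \<subseteq> ball (0::'a) 1" using r by auto
qed (auto intro!: continuous_intros)

lemma measurable_sphere_continuous:
  fixes f :: "complex \<times> complex \<Rightarrow> 'b::topological_space"
  assumes "continuous_on (cball 0 1) f"
  shows "f \<in> borel_measurable \<sigma>"
proof -
  have "continuous_on (sphere 0 1) f" using assms by (rule continuous_on_subset) auto
  then have "f \<in> borel_measurable (restrict_space borel (sphere 0 1))"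
    by (rule borel_measurable_continuous_on_restrict)
  then show ?thesis by (simp add: measurable_cong_sets[OF sets_sphere_measure refl])
qed

text \<open>On the sphere this is the \<open>k\<close>-th homogeneous polynomial in the expansion of \<open>h\<close>; it is
  computed as a Taylor coefficient along the complex line through \<open>x\<close>.\<close>

definition hom_term :: "(complex \<times> complex \<Rightarrow> complex) \<Rightarrow> nat \<Rightarrow> complex \<times> complex \<Rightarrow> complex" where
  "hom_term h k x = tcoeff (\<lambda>l. h (cscale l x)) k"

definition hom_mass :: "(complex \<times> complex \<Rightarrow> complex) \<Rightarrow> nat \<Rightarrow> ennreal" where
  "hom_mass h k = (\<integral>\<^sup>+x. ennreal ((norm (hom_term h k x))\<^sup>2) \<partial>\<sigma>)"

lemma dilation_series:
  assumes h: "holomorphic2_on h (ball 0 1)" and r: "0 \<le> r" "r < 1" and x: "x \<in> space \<sigma>"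
  shows "summable (\<lambda>k. norm (hom_term h k x * of_real r ^ k))"
    "h (r *\<^sub>R cscale (cis t) x) = (\<Sum>k. (hom_term h k x * of_real r ^ k) * cis (of_nat k * t))"
proof -
  have hol: "(\<lambda>l. h (cscale l x)) holomorphic_on ball 0 1"
    using x by (intro holomorphic2_slice[OF h]) (simp add: space_sphere_measure)
  have r': "norm (complex_of_real r) < 1" using r by simp
  show "summable (\<lambda>k. norm (hom_term h k x * of_real r ^ k))"
    unfolding hom_term_def using circle_series(1)[OF hol r'] .
  show "h (r *\<^sub>R cscale (cis t) x) = (\<Sum>k. (hom_term h k x * of_real r ^ k) * cis (of_nat k * t))"
    unfolding hom_term_def scaleR_eq_cscale cscale_cscale by (rule circle_series(2)[OF hol r'])
qed

lemma measurable_dilate: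
  assumes h: "holomorphic2_on h (ball 0 1)" and r: "0 \<le> r" "r < 1"
  shows "(\<lambda>x. h (r *\<^sub>R x)) \<in> borel_measurable \<sigma>"
  by (intro measurable_sphere_continuous continuous_on_dilate holomorphic2_continuous_on h r)

text \<open>Measurability is inherited from the Fourier integrals at one fixed radius, here \<open>1 / 2\<close>.\<close>

lemma hom_term_measurable:
  assumes h: "holomorphic2_on h (ball 0 1)"
  shows "hom_term h k \<in> borel_measurable \<sigma>"
proof -
  have "(\<lambda>x. hom_term h k x * of_real (1/2) ^ k) \<in> borel_measurable \<sigma>"
    by (rule parseval_circle_action(1)[OF circle_action_cscale measurable_dilate[OF h, of "1/2"],
          where c = "\<lambda>k x. hom_term h k x * of_real (1/2) ^ k"])
       (use dilation_series[OF h, of "1/2"] in auto)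
  then have "(\<lambda>x. (hom_term h k x * of_real (1/2) ^ k) * 2 ^ k) \<in> borel_measurable \<sigma>"
    by (rule borel_measurable_times) auto
  then show ?thesis by (simp add: mult.assoc flip: power_mult_distrib)
qed

text \<open>The homogeneous terms are orthogonal on the sphere, and dilation by \<open>r\<close> multiplies the \<open>k\<close>-th
  one by \<open>r ^ k\<close>. The real parameter \<open>b\<close> allows a single dilation (\<open>b = 0\<close>) and the difference
  of two (\<open>b = 1\<close>) to be treated together.\<close>

lemma dilation_parseval:
  assumes h: "holomorphic2_on h (ball 0 1)" and r: "0 \<le> r" "r < 1" and s: "0 \<le> s" "s < 1"
  shows "(\<integral>\<^sup>+x. ennreal ((norm (h (r *\<^sub>R x) - of_real b * h (s *\<^sub>R x)))\<^sup>2) \<partial>\<sigma>)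
     = (\<Sum>k. ennreal ((r ^ k - b * s ^ k)\<^sup>2) * hom_mass h k)"
proof -
  let ?c = "\<lambda>k x. hom_term h k x * of_real r ^ k - of_real b * (hom_term h k x * of_real s ^ k)"
  have "(\<integral>\<^sup>+x. ennreal ((norm (h (r *\<^sub>R x) - of_real b * h (s *\<^sub>R x)))\<^sup>2) \<partial>\<sigma>)
      = (\<Sum>k. \<integral>\<^sup>+x. ennreal ((norm (?c k x))\<^sup>2) \<partial>\<sigma>)"
  proof (rule parseval_circle_action(2)[OF circle_action_cscale])
    show "(\<lambda>x. h (r *\<^sub>R x) - of_real b * h (s *\<^sub>R x)) \<in> borel_measurable \<sigma>"
      using measurable_dilate[OF h r] measurable_dilate[OF h s] by measurable
    fix x :: "complex \<times> complex" assume x: "x \<in> space \<sigma>"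
    note r1 = dilation_series[OF h r x] and s1 = dilation_series[OF h s x]
    have "summable (\<lambda>k. norm (hom_term h k x * of_real r ^ k) + norm (of_real b * (hom_term h k x * of_real s ^ k)))"
      using r1(1) summable_mult[OF s1(1), of "norm (complex_of_real b)"]
      by (intro summable_add) (simp_all add: norm_mult)
    then show "summable (\<lambda>k. norm (?c k x))"
      by (rule summable_comparison_test') (simp add: norm_triangle_ineq4)
    fix t :: real
    have S: "summable (\<lambda>k. c k * cis (of_nat k * t))" if "summable (\<lambda>k. norm (c k))" for c :: "nat \<Rightarrow> complex"
      by (rule summable_norm_cancel) (use that in \<open>simp add: norm_mult\<close>)
    have "(\<lambda>k. (hom_term h k x * of_real r ^ k) * cis (of_nat k * t)
          - of_real b * ((hom_term h k x * of_real s ^ k) * cis (of_nat k * t)))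
        sums (h (r *\<^sub>R cscale (cis t) x) - of_real b * h (s *\<^sub>R cscale (cis t) x))"
      unfolding r1(2) s1(2) by (intro sums_diff sums_mult summable_sums S r1(1) s1(1))
    then have "(\<lambda>k. ?c k x * cis (of_nat k * t))
        sums (h (r *\<^sub>R cscale (cis t) x) - of_real b * h (s *\<^sub>R cscale (cis t) x))"
      by (simp only: left_diff_distrib mult.assoc)
    then show "h (r *\<^sub>R cscale (cis t) x) - of_real b * h (s *\<^sub>R cscale (cis t) x)
        = (\<Sum>k. ?c k x * cis (of_nat k * t))"
      by (rule sums_unique)
  qed
  also have "\<dots> = (\<Sum>k. ennreal ((r ^ k - b * s ^ k)\<^sup>2) * hom_mass h k)"
  proof (rule suminf_cong)
    fix k
    have "?c k x = of_real (r ^ k - b * s ^ k) * hom_term h k x" for x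
      by (simp add: algebra_simps)
    then have "ennreal ((norm (?c k x))\<^sup>2)
        = ennreal ((r ^ k - b * s ^ k)\<^sup>2) * ennreal ((norm (hom_term h k x))\<^sup>2)" for x
      by (simp only: norm_mult power_mult_distrib norm_of_real power2_abs ennreal_mult' zero_le_power2)
    then show "(\<integral>\<^sup>+x. ennreal ((norm (?c k x))\<^sup>2) \<partial>\<sigma>) = ennreal ((r ^ k - b * s ^ k)\<^sup>2) * hom_mass h k"
      unfolding hom_mass_def using hom_term_measurable[OF h, of k]
      by (simp only:) (rule nn_integral_cmult, measurable)
  qed
  finally show ?thesis .
qed

text \<open>Finite partial sums of the masses are limits of partial sums at radius \<open>r < 1\<close>, which the Hardy
  norm bounds.\<close>

lemma hardy_space_summable:
  assumes h: "h \<in> hardy_space"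
  obtains \<alpha> where "\<And>k. hom_mass h k = ennreal (\<alpha> k)" "\<And>k. 0 \<le> \<alpha> k" "summable \<alpha>"
proof -
  have hol: "holomorphic2_on h (ball 0 1)" and fin: "hardy_sqnorm h < \<infinity>"
    using h by (auto simp: hardy_space_def)
  obtain H where H: "hardy_sqnorm h = ennreal H" "0 \<le> H"
    using fin by (cases "hardy_sqnorm h") auto
  have le: "(\<Sum>k. ennreal ((r ^ k)\<^sup>2) * hom_mass h k) \<le> ennreal H" if r: "0 \<le> r" "r < 1" for r
  proof -
    have "(\<Sum>k. ennreal ((r ^ k)\<^sup>2) * hom_mass h k) = (\<integral>\<^sup>+x. ennreal ((norm (h (r *\<^sub>R x)))\<^sup>2) \<partial>\<sigma>)"
      using dilation_parseval[OF hol r r, of 0] by simp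
    also have "\<dots> \<le> hardy_sqnorm h"
      unfolding hardy_sqnorm_def using r by (intro SUP_upper) auto
    finally show ?thesis by (simp add: H)
  qed
  have fin1: "hom_mass h k < \<infinity>" for k
  proof -
    have "ennreal (((1/2) ^ k)\<^sup>2) * hom_mass h k \<le> (\<Sum>k. ennreal (((1/2) ^ k)\<^sup>2) * hom_mass h k)"
      using sum_le_suminf[of "\<lambda>k. ennreal (((1/2) ^ k)\<^sup>2) * hom_mass h k" "{k}"] by auto
    also have "\<dots> \<le> ennreal H" by (rule le) auto
    also have "\<dots> < \<infinity>" by simp
    finally show ?thesis by (auto simp: ennreal_mult_less_top)
  qed
  define \<alpha> where "\<alpha> k = enn2real (hom_mass h k)" for k
  have \<alpha>: "hom_mass h k = ennreal (\<alpha> k)" "0 \<le> \<alpha> k" for k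
    using fin1[of k] by (auto simp: \<alpha>_def)
  have part: "(\<Sum>k<N. \<alpha> k) \<le> H" for N
  proof -
    have "(\<Sum>k<N. (r ^ k)\<^sup>2 * \<alpha> k) \<le> H" if r: "0 \<le> r" "r < 1" for r
    proof -
      have "ennreal (\<Sum>k<N. (r ^ k)\<^sup>2 * \<alpha> k) = (\<Sum>k<N. ennreal ((r ^ k)\<^sup>2) * hom_mass h k)"
        using \<alpha> by (simp add: ennreal_mult flip: sum_ennreal)
      also have "\<dots> \<le> (\<Sum>k. ennreal ((r ^ k)\<^sup>2) * hom_mass h k)"
        by (rule sum_le_suminf) auto
      also have "\<dots> \<le> ennreal H" by (rule le[OF r])
      finally show ?thesis using H by simp
    qed
    then have "eventually (\<lambda>r. (\<Sum>k<N. (r ^ k)\<^sup>2 * \<alpha> k) \<le> H) (at_left 1)"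
      using eventually_at_left_real[of 0 1] by (auto elim!: eventually_mono)
    moreover have "((\<lambda>r. \<Sum>k<N. (r ^ k)\<^sup>2 * \<alpha> k) \<longlongrightarrow> (\<Sum>k<N. (1 ^ k)\<^sup>2 * \<alpha> k)) (at_left (1::real))"
      by (intro tendsto_intros)
    ultimately have "(\<Sum>k<N. (1 ^ k)\<^sup>2 * \<alpha> k) \<le> H"
      by (intro tendsto_upperbound) auto
    then show ?thesis by simp
  qed
  have "summable \<alpha>"
    using \<alpha>(2) part by (intro summableI_nonneg_bounded[where x = H]) auto
  then show ?thesis using that \<alpha> by blast
qed

text \<open>Each weight tends to \<open>0\<close> and is at most \<open>1\<close>, so the summable masses dominate (Tannery).\<close>

lemma one_minus_power_weight_tendsto:
  fixes \<alpha> :: "nat \<Rightarrow> real"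
  assumes nn: "\<And>k. 0 \<le> \<alpha> k" and s: "summable \<alpha>"
  shows "((\<lambda>\<rho>. \<Sum>k. (1 - \<rho> ^ k)\<^sup>2 * \<alpha> k) \<longlongrightarrow> 0) (at_left 1)"
    and "0 \<le> \<rho> \<Longrightarrow> \<rho> \<le> 1 \<Longrightarrow> summable (\<lambda>k. (1 - \<rho> ^ k)\<^sup>2 * \<alpha> k)"
proof -
  have b: "norm ((1 - \<rho> ^ k)\<^sup>2 * \<alpha> k) \<le> \<alpha> k" if "0 \<le> \<rho>" "\<rho> \<le> 1" for \<rho> :: real and k
  proof -
    have "(1 - \<rho> ^ k)\<^sup>2 \<le> 1"
      using that by (intro power_le_one) (auto simp: power_le_one)
    from mult_right_mono[OF this nn[of k]] show ?thesis using nn[of k] by (simp add: abs_mult)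
  qed
  show "summable (\<lambda>k. (1 - \<rho> ^ k)\<^sup>2 * \<alpha> k)" if "0 \<le> \<rho>" "\<rho> \<le> 1"
    by (rule summable_comparison_test'[OF s]) (use b that in auto)
  have ev: "eventually (\<lambda>\<rho>. 0 < \<rho> \<and> \<rho> < (1::real)) (at_left 1)"
    using eventually_at_left_real[of 0 1] by simp
  have lim: "((\<lambda>\<rho>. (1 - \<rho> ^ k)\<^sup>2 * \<alpha> k) \<longlongrightarrow> (1 - 1 ^ k)\<^sup>2 * \<alpha> k) (at_left (1::real))" for k
    by (intro tendsto_intros)
  have bd: "eventually (\<lambda>(k, \<rho>). norm ((1 - \<rho> ^ k)\<^sup>2 * \<alpha> k) \<le> \<alpha> k) (at_top \<times>\<^sub>F at_left (1::real))"
  proof -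
    have "eventually (\<lambda>p. True \<and> (0 < snd p \<and> snd p < 1)) (at_top \<times>\<^sub>F at_left (1::real))"
      by (rule eventually_prodI[OF _ ev]) simp
    then show ?thesis
      by (rule eventually_mono) (use b in force)
  qed
  have "((\<lambda>\<rho>. \<Sum>k. (1 - \<rho> ^ k)\<^sup>2 * \<alpha> k) \<longlongrightarrow> (\<Sum>k. (1 - 1 ^ k)\<^sup>2 * \<alpha> k)) (at_left (1::real))"
    using tannerys_theorem[OF lim bd s] by auto
  then show "((\<lambda>\<rho>. \<Sum>k. (1 - \<rho> ^ k)\<^sup>2 * \<alpha> k) \<longlongrightarrow> 0) (at_left 1)" by simp
qed

text \<open>Dilations converge in the Hardy norm: by orthogonality the squared distance is at most the sum
  of the masses with the weights \<open>(1 - \<rho> ^ k) ^ 2\<close>.\<close>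

lemma hardy_dilate_approx:
  assumes h: "h \<in> hardy_space" and e: "0 < \<epsilon>"
  obtains \<rho> where "0 < \<rho>" "\<rho> < 1" "hardy_sqnorm (\<lambda>x. h x - h (\<rho> *\<^sub>R x)) < ennreal \<epsilon>"
proof -
  have hol: "holomorphic2_on h (ball 0 1)" using h by (auto simp: hardy_space_def)
  obtain \<alpha> where \<alpha>: "\<And>k. hom_mass h k = ennreal (\<alpha> k)" "\<And>k. 0 \<le> \<alpha> k" "summable \<alpha>"
    using hardy_space_summable[OF h] by blast
  note W = one_minus_power_weight_tendsto[OF \<alpha>(2,3)]
  have "eventually (\<lambda>\<rho>. (\<Sum>k. (1 - \<rho> ^ k)\<^sup>2 * \<alpha> k) < \<epsilon>) (at_left 1)"
    using W(1) e by (rule order_tendstoD)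
  moreover have "eventually (\<lambda>\<rho>. \<rho> \<in> {0<..<1}) (at_left (1::real))"
    by (rule eventually_at_left_real) simp
  ultimately have "eventually (\<lambda>\<rho>. (\<Sum>k. (1 - \<rho> ^ k)\<^sup>2 * \<alpha> k) < \<epsilon> \<and> \<rho> \<in> {0<..<1}) (at_left (1::real))"
    by (rule eventually_conj)
  then obtain \<rho> where \<rho>: "(\<Sum>k. (1 - \<rho> ^ k)\<^sup>2 * \<alpha> k) < \<epsilon>" "0 < \<rho>" "\<rho> < 1"
    using eventually_happens'[OF trivial_limit_at_left_real] by fastforce
  have "hardy_sqnorm (\<lambda>x. h x - h (\<rho> *\<^sub>R x)) \<le> ennreal (\<Sum>k. (1 - \<rho> ^ k)\<^sup>2 * \<alpha> k)"
    unfolding hardy_sqnorm_def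
  proof (rule SUP_least)
    fix r :: real assume "r \<in> {0..<1}"
    then have r: "0 \<le> r" "r < 1" by auto
    have rr: "0 \<le> \<rho> * r" "\<rho> * r < 1" using r \<rho> mult_strict_mono[of \<rho> 1 r 1] by auto
    have "(\<integral>\<^sup>+x. ennreal ((norm (h (r *\<^sub>R x) - h (\<rho> *\<^sub>R (r *\<^sub>R x))))\<^sup>2) \<partial>\<sigma>)
        = (\<Sum>k. ennreal ((r ^ k - (\<rho> * r) ^ k)\<^sup>2) * hom_mass h k)"
      using dilation_parseval[OF hol r rr, of 1] by simp
    also have "\<dots> \<le> (\<Sum>k. ennreal ((1 - \<rho> ^ k)\<^sup>2 * \<alpha> k))"
    proof (rule suminf_le)
      fix k
      have "(r ^ k - (\<rho> * r) ^ k)\<^sup>2 = (r ^ k)\<^sup>2 * (1 - \<rho> ^ k)\<^sup>2"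
        by (simp add: power_mult_distrib right_diff_distrib mult.commute flip: power_mult_distrib)
      moreover have "(r ^ k)\<^sup>2 \<le> 1" using r by (simp add: power_le_one)
      ultimately have "(r ^ k - (\<rho> * r) ^ k)\<^sup>2 \<le> (1 - \<rho> ^ k)\<^sup>2"
        using mult_right_mono[of "(r ^ k)\<^sup>2" 1 "(1 - \<rho> ^ k)\<^sup>2"] by simp
      then show "ennreal ((r ^ k - (\<rho> * r) ^ k)\<^sup>2) * hom_mass h k \<le> ennreal ((1 - \<rho> ^ k)\<^sup>2 * \<alpha> k)"
        using \<alpha>(2)[of k] by (simp add: \<alpha>(1) mult_right_mono flip: ennreal_mult)
    qed auto
    also have "\<dots> = ennreal (\<Sum>k. (1 - \<rho> ^ k)\<^sup>2 * \<alpha> k)"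
      by (rule suminf_ennreal2) (use W(2)[of \<rho>] \<rho> \<alpha> in auto)
    finally show "(\<integral>\<^sup>+x. ennreal ((norm (h (r *\<^sub>R x) - h (\<rho> *\<^sub>R (r *\<^sub>R x))))\<^sup>2) \<partial>\<sigma>)
        \<le> ennreal (\<Sum>k. (1 - \<rho> ^ k)\<^sup>2 * \<alpha> k)" .
  qed
  also have "\<dots> < ennreal \<epsilon>"
    using \<rho>(1) e by (intro ennreal_lessI)
  finally show ?thesis using that \<rho> by blast
qed

section \<open>Comparison of the Hardy and Bergman norms\<close>

text \<open>The squared norms of \<open>z ^ k\<close> in the Hardy space of the ball and in the Bergman space of the
  disc; both are equal to \<open>1 / (k + 1)\<close>.\<close>

definition fst_moment_enn :: "nat \<Rightarrow> ennreal" where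
  "fst_moment_enn k = (\<integral>\<^sup>+x. ennreal ((norm (fst x ^ k))\<^sup>2) \<partial>\<sigma>)"

definition disc_moment :: "nat \<Rightarrow> ennreal" where
  "disc_moment k = (\<integral>\<^sup>+z\<in>ball (0::complex) 1. ennreal ((norm (z ^ k))\<^sup>2 / pi) \<partial>lborel)"

text \<open>The surface measure is the radial image of the volume of the ball.\<close>

lemma nn_integral_sphere_le:
  assumes [measurable]: "F \<in> borel_measurable borel"
  shows "(\<integral>\<^sup>+x. F x \<partial>\<sigma>) \<le> (\<integral>\<^sup>+x\<in>ball 0 1. F (sgn x) \<partial>lborel) / emeasure lborel (ball (0::complex \<times> complex) 1)"
proof -
  note measurable_sgn_borel [measurable]
  have "(\<integral>\<^sup>+x. F x \<partial>\<sigma>) = (\<integral>\<^sup>+x. F x * indicator (sphere 0 1) x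
      \<partial>distr (uniform_measure lborel (ball 0 1)) borel sgn)"
    unfolding sphere_measure_def by (rule nn_integral_restrict_space) auto
  also have "\<dots> \<le> (\<integral>\<^sup>+x. F x \<partial>distr (uniform_measure lborel (ball 0 1)) borel sgn)"
    by (rule nn_integral_mono) (auto simp: indicator_def)
  also have "\<dots> = (\<integral>\<^sup>+x. F (sgn x) \<partial>uniform_measure lborel (ball 0 1))"
  proof (rule nn_integral_distr)
    show "sgn \<in> measurable (uniform_measure lborel (ball (0::complex \<times> complex) 1)) borel"
      by (subst measurable_cong_sets[of _ borel borel borel]) (auto intro: measurable_sgn_borel)
  qed (simp add: assms)
  also have "\<dots> = (\<integral>\<^sup>+x\<in>ball 0 1. F (sgn x) \<partial>lborel) / emeasure lborel (ball (0::complex \<times> complex) 1)"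
    by (rule nn_integral_uniform_measure) auto
  finally show ?thesis .
qed

lemma nn_integral_lborel_scale:
  fixes f :: "'a::euclidean_space \<Rightarrow> ennreal"
  assumes [measurable]: "f \<in> borel_measurable borel" and s: "0 < s"
  shows "(\<integral>\<^sup>+x. f x \<partial>lborel) = ennreal (s ^ DIM('a)) * (\<integral>\<^sup>+x. f (s *\<^sub>R x) \<partial>lborel)"
proof -
  have "(\<integral>\<^sup>+x. f x \<partial>lborel) = (\<integral>\<^sup>+x. f x \<partial>density (distr lborel borel (\<lambda>x. 0 + s *\<^sub>R x)) (\<lambda>_. ennreal (\<bar>s\<bar> ^ DIM('a))))"
    using s by (subst lborel_affine[of s 0]) auto
  also have "\<dots> = ennreal (s ^ DIM('a)) * (\<integral>\<^sup>+x. f (s *\<^sub>R x) \<partial>lborel)"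
    using s by (simp add: nn_integral_density nn_integral_distr nn_integral_cmult)
  finally show ?thesis .
qed

lemma emeasure_disc: "0 \<le> r \<Longrightarrow> emeasure lborel (ball (0::complex) r) = ennreal (pi * r\<^sup>2)"
  by (simp add: emeasure_ball unit_ball_vol_2)

text \<open>The shell \<open>s \<le> norm x < 1\<close> meets the complex line through \<open>(z, 0)\<close> with constant first
  coordinate in an annulus of area \<open>pi * (1 - s ^ 2)\<close> if \<open>norm z \<le> s\<close>, and in a smaller disc
  otherwise. This independence of \<open>z\<close> is why the first coordinate of the sphere is uniformly
  distributed over the disc.\<close>

lemma emeasure_shell_section:
  fixes z :: complex
  assumes s: "0 < s" "s < 1"
  shows "emeasure lborel {w. (z, w) \<in> ball (0::complex \<times> complex) 1 - ball 0 s} \<le> ennreal (pi * (1 - s\<^sup>2))"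
proof -
  have s2: "s\<^sup>2 < 1" using s by (simp add: power_less_one_iff abs_square_less_1)
  have in_ball: "(z, w) \<in> ball 0 r \<longleftrightarrow> (norm z)\<^sup>2 + (norm w)\<^sup>2 < r\<^sup>2" if "0 < r" for w r
    using that real_sqrt_less_iff[of "(norm z)\<^sup>2 + (norm w)\<^sup>2" "r\<^sup>2"] by (simp add: norm_Pair)
  have disc: "{w::complex. (norm z)\<^sup>2 + (norm w)\<^sup>2 < q} = ball 0 (sqrt (q - (norm z)\<^sup>2))" if "(norm z)\<^sup>2 \<le> q" for q
  proof (intro set_eqI iffI)
    fix w assume "w \<in> {w::complex. (norm z)\<^sup>2 + (norm w)\<^sup>2 < q}"
    then have "sqrt ((norm w)\<^sup>2) < sqrt (q - (norm z)\<^sup>2)" by (intro real_sqrt_less_mono) auto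
    then show "w \<in> ball 0 (sqrt (q - (norm z)\<^sup>2))" by simp
  next
    fix w :: complex assume "w \<in> ball 0 (sqrt (q - (norm z)\<^sup>2))"
    then have "sqrt ((norm w)\<^sup>2) < sqrt (q - (norm z)\<^sup>2)" by simp
    then have "(norm w)\<^sup>2 < q - (norm z)\<^sup>2" by (simp only: real_sqrt_less_iff)
    then show "w \<in> {w::complex. (norm z)\<^sup>2 + (norm w)\<^sup>2 < q}" by simp
  qed
  define W where "W = {w. (z, w) \<in> ball (0::complex \<times> complex) 1 - ball 0 s}"
  have eq: "W = {w. (norm z)\<^sup>2 + (norm w)\<^sup>2 < 1} - {w. (norm z)\<^sup>2 + (norm w)\<^sup>2 < s\<^sup>2}"
    using in_ball[of 1] in_ball[of s] s unfolding W_def by auto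
  consider "(norm z)\<^sup>2 > 1" | "s\<^sup>2 < (norm z)\<^sup>2" "(norm z)\<^sup>2 \<le> 1" | "(norm z)\<^sup>2 \<le> s\<^sup>2" by linarith
  then have "emeasure lborel W \<le> ennreal (pi * (1 - s\<^sup>2))"
  proof cases
    case 1
    have "\<not> (norm z)\<^sup>2 + (norm w)\<^sup>2 < 1" for w :: complex
      using 1 zero_le_power2[of "norm w"] by linarith
    then have "W = {}" unfolding eq by simp
    then show ?thesis by simp
  next
    case 2
    have "emeasure lborel W \<le> emeasure lborel (ball (0::complex) (sqrt (1 - (norm z)\<^sup>2)))"
      unfolding eq using 2 by (intro emeasure_mono) (auto simp flip: disc)
    also have "\<dots> = ennreal (pi * (1 - (norm z)\<^sup>2))"
      using 2 by (subst emeasure_disc) auto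
    also have "\<dots> \<le> ennreal (pi * (1 - s\<^sup>2))"
      using 2 by (intro ennreal_leI mult_left_mono) auto
    finally show ?thesis .
  next
    case 3
    have "emeasure lborel W
        = emeasure lborel (ball (0::complex) (sqrt (1 - (norm z)\<^sup>2)) - ball 0 (sqrt (s\<^sup>2 - (norm z)\<^sup>2)))"
      unfolding eq using 3 s2 by (subst disc, simp)+ simp
    also have "\<dots> = emeasure lborel (ball (0::complex) (sqrt (1 - (norm z)\<^sup>2)))
        - emeasure lborel (ball (0::complex) (sqrt (s\<^sup>2 - (norm z)\<^sup>2)))"
      using s2 3 by (intro emeasure_Diff) (auto simp: emeasure_disc intro!: subset_ball real_sqrt_le_mono)
    also have "\<dots> = ennreal (pi * (1 - (norm z)\<^sup>2)) - ennreal (pi * (s\<^sup>2 - (norm z)\<^sup>2))"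
      using 3 s2 by (subst (1 2) emeasure_disc) auto
    also have "\<dots> = ennreal (pi * (1 - s\<^sup>2))"
      using 3 by (subst ennreal_minus) (auto simp: algebra_simps)
    finally show ?thesis by simp
  qed
  then show ?thesis by (simp add: W_def)
qed

lemma disc_moment_finite: "disc_moment k < \<infinity>"
proof -
  have "disc_moment k \<le> (\<integral>\<^sup>+z\<in>ball (0::complex) 1. 1 \<partial>lborel)"
    unfolding disc_moment_def
  proof (rule nn_integral_mono)
    fix z :: complex
    have "(norm (z ^ k))\<^sup>2 / pi \<le> 1" if "norm z < 1"
    proof -
      have "(norm (z ^ k))\<^sup>2 \<le> 1" using that by (simp add: norm_power power_le_one)
      then show ?thesis using pi_gt3 by (simp add: divide_le_eq)
    qed
    then show "ennreal ((norm (z ^ k))\<^sup>2 / pi) * indicator (ball 0 1) z \<le> 1 * indicator (ball 0 1) z"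
      by (auto simp: indicator_def)
  qed
  also have "\<dots> < \<infinity>"
    using emeasure_disc[of 1] by simp
  finally show ?thesis .
qed

lemma norm_fst_le_norm: "norm (fst p) \<le> norm p"
  by (cases p) (simp add: norm_fst_le)

lemma norm_fst_less: "norm (p :: complex \<times> complex) < 1 \<Longrightarrow> norm (fst p) < 1"
  using norm_fst_le_norm[of p] by (rule le_less_trans)

text \<open>The integral over a thin shell \<open>s \<le> norm x < 1\<close> is computed in two ways. Radially, it is
  \<open>1 - s ^ 4\<close> times the integral over the ball, up to the factor \<open>s ^ (2 * k)\<close> by which
  \<open>norm z ^ (2 * k)\<close> may shrink; by sections, it is at most \<open>pi * (1 - s ^ 2)\<close> times an integral
  over the disc. Divide by \<open>1 - s ^ 2\<close> and let \<open>s\<close> tend to \<open>1\<close>.\<close>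

lemma fst_moment_le_disc_moment: "fst_moment_enn k \<le> disc_moment k"
proof -
  let ?B = "ball (0::complex \<times> complex) 1"
  let ?F = "\<lambda>x::complex \<times> complex. ennreal ((norm (fst x ^ k))\<^sup>2)"
  note measurable_sgn_borel [measurable]
  have Fm [measurable]: "?F \<in> borel_measurable borel"
  proof -
    have "(\<lambda>x::complex \<times> complex. (norm (fst x ^ k))\<^sup>2) \<in> borel_measurable borel"
      by (intro borel_measurable_continuous_onI continuous_intros)
    then show ?thesis by measurable
  qed
  have Fg: "(\<lambda>x. ?F (sgn x) * indicator A x) \<in> borel_measurable borel" if "A \<in> sets borel" for A
    using measurable_compose[OF measurable_sgn_borel Fm]
    by (rule borel_measurable_times_ennreal) (rule borel_measurable_indicator[OF that])
  then have Fgl: "(\<lambda>x. ?F (sgn x) * indicator A x) \<in> borel_measurable lborel" if "A \<in> sets borel" for A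
    using that by (simp only: measurable_lborel2)
  define J where "J = (\<integral>\<^sup>+x\<in>?B. ?F (sgn x) \<partial>lborel)"
  have b: "emeasure lborel ?B = ennreal (pi\<^sup>2 / 2)"
    by (simp add: emeasure_ball unit_ball_vol_4)
  have "J \<le> (\<integral>\<^sup>+x\<in>?B. 1 \<partial>lborel)"
    unfolding J_def
  proof (rule nn_integral_mono)
    fix x :: "complex \<times> complex"
    have "norm (fst (sgn x)) \<le> 1"
      using norm_fst_le_norm[of "sgn x"] by (simp add: norm_sgn split: if_splits)
    then have "(norm (fst (sgn x) ^ k))\<^sup>2 \<le> 1"
      by (simp only: norm_power power_le_one norm_ge_zero zero_le_power)
    then show "?F (sgn x) * indicator ?B x \<le> 1 * indicator ?B x"
      by (auto simp: indicator_def)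
  qed
  also have "\<dots> = ennreal (pi\<^sup>2 / 2)" using b by simp
  finally obtain j where j: "J = ennreal j" "0 \<le> j" by (cases J) (auto simp: top_unique)
  obtain d where d: "disc_moment k = ennreal d" "0 \<le> d" using disc_moment_finite[of k] by (cases "disc_moment k") auto
  have main: "(1 + s\<^sup>2) * (s ^ k)\<^sup>2 * j \<le> pi\<^sup>2 * d" if s: "0 < s" "s < 1" for s
  proof -
    let ?S = "?B - ball 0 s"
    \<comment> \<open>the pull-back of a function on the sphere is homogeneous of degree \<open>0\<close>\<close>
    have scale: "(\<integral>\<^sup>+x\<in>ball 0 s. ?F (sgn x) \<partial>lborel) = ennreal (s ^ 4) * J"
    proof -
      have "(\<integral>\<^sup>+x\<in>ball 0 s. ?F (sgn x) \<partial>lborel)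
          = ennreal (s ^ 4) * (\<integral>\<^sup>+x. ?F (sgn (s *\<^sub>R x)) * indicator (ball 0 s) (s *\<^sub>R x) \<partial>lborel)"
        using nn_integral_lborel_scale[OF Fg s(1), of "ball 0 s"] by simp
      also have "(\<integral>\<^sup>+x. ?F (sgn (s *\<^sub>R x)) * indicator (ball 0 s) (s *\<^sub>R x) \<partial>lborel) = J"
        unfolding J_def using s(1)
        by (intro nn_integral_cong) (auto simp: indicator_def sgn_scaleR)
      finally show ?thesis .
    qed
    have "J = (\<integral>\<^sup>+x. ?F (sgn x) * indicator (ball 0 s) x + ?F (sgn x) * indicator ?S x \<partial>lborel)"
      unfolding J_def using s(2) by (intro nn_integral_cong) (auto simp: indicator_def)
    also have "\<dots> = ennreal (s ^ 4) * J + (\<integral>\<^sup>+x\<in>?S. ?F (sgn x) \<partial>lborel)"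
      unfolding scale[symmetric] by (rule nn_integral_add[OF Fgl Fgl]) auto
    finally have split: "J = ennreal (s ^ 4) * J + (\<integral>\<^sup>+x\<in>?S. ?F (sgn x) \<partial>lborel)" .
    have "ennreal ((s ^ k)\<^sup>2) * (\<integral>\<^sup>+x\<in>?S. ?F (sgn x) \<partial>lborel)
        = (\<integral>\<^sup>+x. ennreal ((s ^ k)\<^sup>2) * (?F (sgn x) * indicator ?S x) \<partial>lborel)"
      by (rule nn_integral_cmult[OF Fgl, symmetric]) auto
    also have "\<dots> \<le> (\<integral>\<^sup>+x. ?F x * indicator ?S x \<partial>lborel)"
    proof (rule nn_integral_mono)
      fix x :: "complex \<times> complex"
      have "(s ^ k)\<^sup>2 * (norm (fst (sgn x) ^ k))\<^sup>2 \<le> (norm (fst x ^ k))\<^sup>2" if x: "s \<le> norm x"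
      proof -
        have nx: "0 < norm x" using s x by linarith
        have "norm (fst (sgn x)) = norm (fst x) / norm x"
          by (simp add: sgn_div_norm divide_inverse_commute)
        then have "s * norm (fst (sgn x)) = (s / norm x) * norm (fst x)" by simp
        also have "\<dots> \<le> 1 * norm (fst x)"
          using x nx s by (intro mult_right_mono) auto
        finally have le: "s * norm (fst (sgn x)) \<le> norm (fst x)" by simp
        have "((s * norm (fst (sgn x))) ^ k)\<^sup>2 \<le> (norm (fst x) ^ k)\<^sup>2"
          using s by (intro power_mono le) auto
        then show ?thesis by (simp add: norm_power power_mult_distrib)
      qed
      then show "ennreal ((s ^ k)\<^sup>2) * (?F (sgn x) * indicator ?S x) \<le> ?F x * indicator ?S x"
        by (auto simp: indicator_def simp flip: ennreal_mult)
    qed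
    also have "\<dots> = (\<integral>\<^sup>+x. ?F x * indicator ?S x \<partial>(lborel \<Otimes>\<^sub>M lborel))"
      by (simp only: lborel_prod)
    also have "\<dots> = (\<integral>\<^sup>+z. \<integral>\<^sup>+w. ?F (z, w) * indicator ?S (z, w) \<partial>lborel \<partial>lborel)"
    proof (rule lborel.nn_integral_fst[symmetric])
      show "(\<lambda>x. ?F x * indicator ?S x) \<in> borel_measurable (lborel \<Otimes>\<^sub>M lborel)"
        unfolding lborel_prod measurable_lborel2
        by (rule borel_measurable_times_ennreal[OF Fm borel_measurable_indicator]) simp
    qed
    also have "\<dots> \<le> (\<integral>\<^sup>+z. ennreal (pi\<^sup>2 * (1 - s\<^sup>2)) * (ennreal ((norm (z ^ k))\<^sup>2 / pi) * indicator (ball (0::complex) 1) z) \<partial>lborel)"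
    proof (rule nn_integral_mono)
      fix z :: complex
      have sec: "{w. (z, w) \<in> ?S} \<in> sets borel"
        using measurable_sets[of "\<lambda>w. (z, w)" borel borel ?S]
        by (simp add: vimage_def)
      have "(\<integral>\<^sup>+w. ?F (z, w) * indicator ?S (z, w) \<partial>lborel)
          = (\<integral>\<^sup>+w. ennreal ((norm (z ^ k))\<^sup>2) * indicator {w. (z, w) \<in> ?S} w \<partial>lborel)"
        by (intro nn_integral_cong) (auto simp: indicator_def)
      also have "\<dots> = ennreal ((norm (z ^ k))\<^sup>2) * emeasure lborel {w. (z, w) \<in> ?S}"
        using sec by (simp add: nn_integral_cmult_indicator)
      also have "\<dots> \<le> ennreal (pi\<^sup>2 * (1 - s\<^sup>2)) * (ennreal ((norm (z ^ k))\<^sup>2 / pi) * indicator (ball 0 1) z)"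
      proof (cases "norm z < 1")
        case True
        have s2: "s\<^sup>2 \<le> 1" using s by (simp add: power_le_one)
        have "ennreal ((norm (z ^ k))\<^sup>2) * emeasure lborel {w. (z, w) \<in> ?S}
            \<le> ennreal ((norm (z ^ k))\<^sup>2) * ennreal (pi * (1 - s\<^sup>2))"
          by (intro mult_left_mono emeasure_shell_section s) auto
        also have "\<dots> = ennreal (pi\<^sup>2 * (1 - s\<^sup>2)) * (ennreal ((norm (z ^ k))\<^sup>2 / pi))"
          using s2 by (subst (1 2) ennreal_mult[symmetric]) (auto simp: power2_eq_square)
        finally show ?thesis using True by simp
      next
        case False
        have "(z, w) \<notin> ?B" for w
          using False norm_fst_less[of "(z, w)"] by auto
        then have e: "{w. (z, w) \<in> ?S} = {}" by blast
        show ?thesis unfolding e by simp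
      qed
      finally show "(\<integral>\<^sup>+w. ?F (z, w) * indicator ?S (z, w) \<partial>lborel)
          \<le> ennreal (pi\<^sup>2 * (1 - s\<^sup>2)) * (ennreal ((norm (z ^ k))\<^sup>2 / pi) * indicator (ball 0 1) z)" .
    qed
    also have "\<dots> = ennreal (pi\<^sup>2 * (1 - s\<^sup>2)) * disc_moment k"
    proof -
      have "(\<lambda>z::complex. ennreal ((norm (z ^ k))\<^sup>2 / pi)) \<in> borel_measurable borel" by measurable
      then have "(\<lambda>z. ennreal ((norm (z ^ k))\<^sup>2 / pi) * indicator (ball (0::complex) 1) z) \<in> borel_measurable lborel"
        unfolding measurable_lborel2
        by (rule borel_measurable_times_ennreal[OF _ borel_measurable_indicator]) simp
      then show ?thesis unfolding disc_moment_def by (rule nn_integral_cmult)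
    qed
    finally have shell: "ennreal ((s ^ k)\<^sup>2) * (\<integral>\<^sup>+x\<in>?S. ?F (sgn x) \<partial>lborel)
        \<le> ennreal (pi\<^sup>2 * (1 - s\<^sup>2)) * disc_moment k" .
    have "(\<integral>\<^sup>+x\<in>?S. ?F (sgn x) \<partial>lborel) \<le> J"
      unfolding J_def by (rule nn_integral_mono) (auto simp: indicator_def)
    then obtain q where q: "(\<integral>\<^sup>+x\<in>?S. ?F (sgn x) \<partial>lborel) = ennreal q" "0 \<le> q"
      using j by (cases "\<integral>\<^sup>+x\<in>?S. ?F (sgn x) \<partial>lborel") (auto simp: top_unique)
    have "ennreal j = ennreal (s ^ 4 * j + q)"
      using split q j s by (simp add: ennreal_mult ennreal_plus)
    then have jq: "j = s ^ 4 * j + q" using j(2) q(2) s by (subst (asm) ennreal_inj) simp_all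
    have s2: "s\<^sup>2 < 1" using s by (simp add: power_less_one_iff)
    have "ennreal ((s ^ k)\<^sup>2 * q) \<le> ennreal (pi\<^sup>2 * (1 - s\<^sup>2) * d)"
      using shell q d s2 by (simp add: ennreal_mult)
    then have "(s ^ k)\<^sup>2 * q \<le> pi\<^sup>2 * (1 - s\<^sup>2) * d"
      using d s2 by (subst (asm) ennreal_le_iff) auto
    moreover have "q = (1 - s\<^sup>2) * (1 + s\<^sup>2) * j"
      using jq by (simp add: algebra_simps power4_eq_xxxx power2_eq_square)
    ultimately have "(1 - s\<^sup>2) * ((1 + s\<^sup>2) * (s ^ k)\<^sup>2 * j) \<le> (1 - s\<^sup>2) * (pi\<^sup>2 * d)"
      by (simp add: mult_ac)
    then show ?thesis using s2 by simp
  qed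
  have "((\<lambda>s. (1 + s\<^sup>2) * (s ^ k)\<^sup>2 * j) \<longlongrightarrow> (1 + 1\<^sup>2) * (1 ^ k)\<^sup>2 * j) (at_left (1::real))"
    by (intro tendsto_intros)
  moreover have "eventually (\<lambda>s. (1 + s\<^sup>2) * (s ^ k)\<^sup>2 * j \<le> pi\<^sup>2 * d) (at_left (1::real))"
    using eventually_at_left_real[of 0 1] main by (auto elim!: eventually_mono)
  ultimately have "(1 + 1\<^sup>2) * (1 ^ k)\<^sup>2 * j \<le> pi\<^sup>2 * d"
    by (intro tendsto_upperbound) auto
  then have "j / (pi\<^sup>2 / 2) \<le> d" by (simp add: field_simps)
  have "fst_moment_enn k \<le> J / emeasure lborel ?B"
    unfolding fst_moment_enn_def J_def by (rule nn_integral_sphere_le) measurable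
  also have "\<dots> = ennreal (j / (pi\<^sup>2 / 2))"
    unfolding b j(1) by (rule divide_ennreal) (use j in auto)
  also have "\<dots> \<le> ennreal d" by (rule ennreal_leI) fact
  finally show ?thesis by (simp add: d)
qed

lemma holomorphic2_fst:
  assumes "\<phi> holomorphic_on ball 0 1"
  shows "holomorphic2_on (\<lambda>p. \<phi> (fst p)) (ball 0 1)"
  unfolding holomorphic2_on_def
proof
  fix p :: "complex \<times> complex" assume "p \<in> ball 0 1"
  then have "fst p \<in> ball 0 1" using norm_fst_less[of p] by simp
  then obtain a where "(\<phi> has_field_derivative a) (at (fst p))"
    using assms by (meson holomorphic_on_open open_ball)
  then have "(\<phi> has_derivative (\<lambda>d. a * d)) (at (fst p))"
    by (simp add: has_field_derivative_def)
  from diff_chain_at[OF has_derivative_fst[OF has_derivative_ident] this]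
  have "((\<lambda>p. \<phi> (fst p)) has_derivative (\<lambda>(h, k). a * h + 0 * k)) (at p)"
    by (simp add: o_def case_prod_beta')
  then show "\<exists>a b. ((\<lambda>p. \<phi> (fst p)) has_derivative (\<lambda>(h, k). a * h + b * k)) (at p)" by blast
qed

lemma hardy_fst_integral:
  assumes \<phi>: "\<phi> holomorphic_on ball 0 1" and r: "0 \<le> r" "r < 1"
  shows "(\<integral>\<^sup>+x. ennreal ((norm (\<phi> (fst (r *\<^sub>R x))))\<^sup>2) \<partial>\<sigma>)
    = (\<Sum>k. ennreal ((norm (tcoeff \<phi> k))\<^sup>2 * (r ^ k)\<^sup>2) * fst_moment_enn k)"
proof -
  have n: "norm (of_real r * fst x) < 1" if "x \<in> space \<sigma>" for x :: "complex \<times> complex"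
  proof -
    have "norm (fst x) \<le> 1" using that norm_fst_le_norm[of x] by (simp add: space_sphere_measure)
    then show ?thesis using r mult_left_mono[of "norm (fst x)" 1 r] by (simp add: norm_mult)
  qed
  have fm: "(\<lambda>x. fst x ^ k) \<in> borel_measurable \<sigma>" for k
    by (rule measurable_sphere_continuous) (intro continuous_intros)
  have "(\<lambda>c::complex. ennreal ((norm c)\<^sup>2)) \<in> borel_measurable borel" by measurable
  from measurable_compose[OF fm this]
  have fm2: "(\<lambda>x. ennreal ((norm (fst x ^ k))\<^sup>2)) \<in> borel_measurable \<sigma>" for k .
  have "(\<integral>\<^sup>+x. ennreal ((norm (\<phi> (fst (r *\<^sub>R x))))\<^sup>2) \<partial>\<sigma>)
      = (\<Sum>k. \<integral>\<^sup>+x. ennreal ((norm (tcoeff \<phi> k * (of_real r * fst x) ^ k))\<^sup>2) \<partial>\<sigma>)"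
  proof (rule parseval_circle_action(2)[OF circle_action_cscale])
    show "(\<lambda>x. \<phi> (fst (r *\<^sub>R x))) \<in> borel_measurable \<sigma>"
      by (rule measurable_dilate[OF holomorphic2_fst[OF \<phi>] r])
    fix x :: "complex \<times> complex" assume x: "x \<in> space \<sigma>"
    show "summable (\<lambda>k. norm (tcoeff \<phi> k * (of_real r * fst x) ^ k))"
      by (rule circle_series(1)[OF \<phi> n[OF x]])
    show "\<phi> (fst (r *\<^sub>R cscale (cis t) x)) = (\<Sum>k. tcoeff \<phi> k * (of_real r * fst x) ^ k * cis (real k * t))" for t
      using circle_series(2)[OF \<phi> n[OF x], of t] by (simp add: cscale_def scaleR_conv_of_real mult_ac)
  qed
  also have "\<dots> = (\<Sum>k. ennreal ((norm (tcoeff \<phi> k))\<^sup>2 * (r ^ k)\<^sup>2) * fst_moment_enn k)"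
  proof (rule suminf_cong)
    fix k
    have "ennreal ((norm (tcoeff \<phi> k * (of_real r * fst x) ^ k))\<^sup>2)
        = ennreal ((norm (tcoeff \<phi> k))\<^sup>2 * (r ^ k)\<^sup>2) * ennreal ((norm (fst x ^ k))\<^sup>2)" for x :: "complex \<times> complex"
      using r by (simp add: norm_mult norm_power power_mult_distrib mult.assoc abs_of_nonneg flip: ennreal_mult)
    then show "(\<integral>\<^sup>+x. ennreal ((norm (tcoeff \<phi> k * (of_real r * fst x) ^ k))\<^sup>2) \<partial>\<sigma>)
        = ennreal ((norm (tcoeff \<phi> k))\<^sup>2 * (r ^ k)\<^sup>2) * fst_moment_enn k"
      unfolding fst_moment_enn_def using fm2[of k] by (simp only:) (rule nn_integral_cmult)
  qed
  finally show ?thesis .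
qed

text \<open>The monomials are orthogonal because the area of the disc is invariant under rotations.\<close>

lemma bergman_parseval:
  assumes \<phi>: "\<phi> holomorphic_on ball 0 1"
  shows "bergman_sqnorm \<phi> = (\<Sum>k. ennreal ((norm (tcoeff \<phi> k))\<^sup>2) * disc_moment k)"
proof -
  let ?M = "restrict_space lborel (ball (0::complex) 1)"
  have "\<phi> \<in> borel_measurable (restrict_space borel (ball 0 1))"
    by (rule borel_measurable_continuous_on_restrict[OF holomorphic_on_imp_continuous_on[OF \<phi>]])
  then have meas: "\<phi> \<in> borel_measurable ?M"
    by (subst measurable_cong_sets[of ?M "restrict_space borel (ball 0 1)" borel borel])
       (auto simp: sets_restrict_space)
  have bs: "bergman_sqnorm g = ennreal (1/pi) * (\<integral>\<^sup>+z. ennreal ((norm (g z))\<^sup>2) \<partial>?M)"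
    if [measurable]: "g \<in> borel_measurable ?M" for g
  proof -
    have "ennreal (1/pi) * (\<integral>\<^sup>+z. ennreal ((norm (g z))\<^sup>2) \<partial>?M)
        = (\<integral>\<^sup>+z. ennreal (1/pi) * ennreal ((norm (g z))\<^sup>2) \<partial>?M)"
      by (rule nn_integral_cmult[symmetric]) measurable
    also have "\<dots> = (\<integral>\<^sup>+z. ennreal ((norm (g z))\<^sup>2 / pi) \<partial>?M)"
      by (intro nn_integral_cong) (simp flip: ennreal_mult)
    also have "\<dots> = bergman_sqnorm g"
      unfolding bergman_sqnorm_def by (rule nn_integral_restrict_space) simp
    finally show ?thesis by simp
  qed
  have pm: "(\<lambda>z. z ^ k) \<in> borel_measurable ?M" for k
    by (rule measurable_restrict_space1) measurable
  have pm2: "(\<lambda>z::complex. ennreal ((norm (z ^ k))\<^sup>2)) \<in> borel_measurable ?M" for k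
    by (rule measurable_restrict_space1) measurable
  have "(\<integral>\<^sup>+z. ennreal ((norm (\<phi> z))\<^sup>2) \<partial>?M) = (\<Sum>k. \<integral>\<^sup>+z. ennreal ((norm (tcoeff \<phi> k * z ^ k))\<^sup>2) \<partial>?M)"
  proof (rule parseval_circle_action(2)[OF circle_action_disc meas])
    fix z assume "z \<in> space ?M"
    then have "norm z < 1" by (simp add: space_restrict_space)
    then show "summable (\<lambda>k. norm (tcoeff \<phi> k * z ^ k))"
      "\<phi> (z * cis t) = (\<Sum>k. tcoeff \<phi> k * z ^ k * cis (real k * t))" for t
      by (rule circle_series[OF \<phi>])+
  qed
  also have "\<dots> = (\<Sum>k. ennreal ((norm (tcoeff \<phi> k))\<^sup>2) * (\<integral>\<^sup>+z. ennreal ((norm (z ^ k))\<^sup>2) \<partial>?M))"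
  proof (rule suminf_cong)
    fix k
    have "ennreal ((norm (tcoeff \<phi> k * z ^ k))\<^sup>2) = ennreal ((norm (tcoeff \<phi> k))\<^sup>2) * ennreal ((norm (z ^ k))\<^sup>2)" for z
      by (simp add: norm_mult power_mult_distrib ennreal_mult)
    then show "(\<integral>\<^sup>+z. ennreal ((norm (tcoeff \<phi> k * z ^ k))\<^sup>2) \<partial>?M)
        = ennreal ((norm (tcoeff \<phi> k))\<^sup>2) * (\<integral>\<^sup>+z. ennreal ((norm (z ^ k))\<^sup>2) \<partial>?M)"
      using pm2[of k] by (simp only:) (rule nn_integral_cmult)
  qed
  finally have "bergman_sqnorm \<phi> = ennreal (1/pi) *
      (\<Sum>k. ennreal ((norm (tcoeff \<phi> k))\<^sup>2) * (\<integral>\<^sup>+z. ennreal ((norm (z ^ k))\<^sup>2) \<partial>?M))"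
    by (simp add: bs[OF meas])
  also have "\<dots> = (\<Sum>k. ennreal ((norm (tcoeff \<phi> k))\<^sup>2) * (ennreal (1/pi) * (\<integral>\<^sup>+z. ennreal ((norm (z ^ k))\<^sup>2) \<partial>?M)))"
    by (simp only: ennreal_suminf_cmult[symmetric] mult.left_commute)
  also have "\<dots> = (\<Sum>k. ennreal ((norm (tcoeff \<phi> k))\<^sup>2) * disc_moment k)"
    using bs[OF pm] by (simp add: disc_moment_def bergman_sqnorm_def)
  finally show ?thesis .
qed

text \<open>Both squared norms are sums over Taylor coefficients; compare the weights.\<close>

lemma hardy_fst_le_bergman:
  assumes \<phi>: "\<phi> holomorphic_on ball 0 1"
  shows "hardy_sqnorm (\<lambda>p. \<phi> (fst p)) \<le> bergman_sqnorm \<phi>"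
  unfolding hardy_sqnorm_def
proof (rule SUP_least)
  fix r :: real assume "r \<in> {0..<1}"
  then have r: "0 \<le> r" "r < 1" by auto
  have "(\<Sum>k. ennreal ((norm (tcoeff \<phi> k))\<^sup>2 * (r ^ k)\<^sup>2) * fst_moment_enn k) \<le> (\<Sum>k. ennreal ((norm (tcoeff \<phi> k))\<^sup>2) * disc_moment k)"
  proof (rule suminf_le)
    fix k
    have "(r ^ k)\<^sup>2 \<le> 1" using r by (simp add: power_le_one)
    then have "(norm (tcoeff \<phi> k))\<^sup>2 * (r ^ k)\<^sup>2 \<le> (norm (tcoeff \<phi> k))\<^sup>2"
      by (intro mult_left_le) auto
    then show "ennreal ((norm (tcoeff \<phi> k))\<^sup>2 * (r ^ k)\<^sup>2) * fst_moment_enn k \<le> ennreal ((norm (tcoeff \<phi> k))\<^sup>2) * disc_moment k"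
      by (intro mult_mono fst_moment_le_disc_moment ennreal_leI) auto
  qed auto
  then show "(\<integral>\<^sup>+x. ennreal ((norm (\<phi> (fst (r *\<^sub>R x))))\<^sup>2) \<partial>\<sigma>) \<le> bergman_sqnorm \<phi>"
    by (simp only: hardy_fst_integral[OF \<phi> r] bergman_parseval[OF \<phi>])
qed

section \<open>Multipliers of the Hardy space\<close>

lemma holomorphic2_const: "holomorphic2_on (\<lambda>p. c) U"
  unfolding holomorphic2_on_def
  by (intro ballI exI[of _ 0]) (auto simp: case_prod_beta')

lemma holomorphic2_mult:
  assumes "holomorphic2_on f U" "holomorphic2_on g U"
  shows "holomorphic2_on (\<lambda>p. f p * g p) U"
  unfolding holomorphic2_on_def
proof
  fix p assume p: "p \<in> U"
  obtain a b where f: "(f has_derivative (\<lambda>(h, k). a * h + b * k)) (at p)"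
    using assms(1) p unfolding holomorphic2_on_def by blast
  obtain c d where g: "(g has_derivative (\<lambda>(h, k). c * h + d * k)) (at p)"
    using assms(2) p unfolding holomorphic2_on_def by blast
  have "((\<lambda>p. f p * g p) has_derivative
      (\<lambda>(h, k). (f p * c + a * g p) * h + (f p * d + b * g p) * k)) (at p)"
    using has_derivative_mult[OF f g] by (simp add: case_prod_beta' algebra_simps)
  then show "\<exists>a b. ((\<lambda>p. f p * g p) has_derivative (\<lambda>(h, k). a * h + b * k)) (at p)" by blast
qed

lemma holomorphic2_diff:
  assumes "holomorphic2_on f U" "holomorphic2_on g U"
  shows "holomorphic2_on (\<lambda>p. f p - g p) U"
  unfolding holomorphic2_on_def
proof
  fix p assume p: "p \<in> U"
  obtain a b where f: "(f has_derivative (\<lambda>(h, k). a * h + b * k)) (at p)"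
    using assms(1) p unfolding holomorphic2_on_def by blast
  obtain c d where g: "(g has_derivative (\<lambda>(h, k). c * h + d * k)) (at p)"
    using assms(2) p unfolding holomorphic2_on_def by blast
  have "((\<lambda>p. f p - g p) has_derivative (\<lambda>(h, k). (a - c) * h + (b - d) * k)) (at p)"
    using has_derivative_diff[OF f g] by (simp add: case_prod_beta' algebra_simps)
  then show "\<exists>a b. ((\<lambda>p. f p - g p) has_derivative (\<lambda>(h, k). a * h + b * k)) (at p)" by blast
qed

lemma holomorphic2_dilate:
  assumes h: "holomorphic2_on h (ball 0 1)" and r: "0 \<le> r" "r < 1"
  shows "holomorphic2_on (\<lambda>p. h (r *\<^sub>R p)) (ball 0 1)"
  unfolding holomorphic2_on_def
proof
  fix p :: "complex \<times> complex" assume "p \<in> ball 0 1"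
  then have "r * norm p < 1" using mult_mono[of r 1 "norm p" 1] r
    by (cases "norm p = 0") (auto intro: le_less_trans[OF mult_left_le_one_le])
  then have "r *\<^sub>R p \<in> ball 0 1" using r by simp
  then obtain a b where "(h has_derivative (\<lambda>(u, v). a * u + b * v)) (at (r *\<^sub>R p))"
    using h unfolding holomorphic2_on_def by blast
  from diff_chain_at[OF has_derivative_scaleR_right[OF has_derivative_ident] this]
  have "((\<lambda>p. h (r *\<^sub>R p)) has_derivative (\<lambda>(u, v). (a * of_real r) * u + (b * of_real r) * v)) (at p)"
    by (simp add: o_def case_prod_beta' scaleR_conv_of_real mult.assoc)
  then show "\<exists>a b. ((\<lambda>p. h (r *\<^sub>R p)) has_derivative (\<lambda>(u, v). a * u + b * v)) (at p)" by blast
qed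

text \<open>A dilate is continuous on the closed ball.\<close>

lemma dilate_bounded:
  fixes h :: "complex \<times> complex \<Rightarrow> complex"
  assumes h: "holomorphic2_on h (ball 0 1)" and r: "0 \<le> r" "r < 1"
  obtains B where "0 < B" "\<And>p. norm p \<le> 1 \<Longrightarrow> norm (h (r *\<^sub>R p)) \<le> B"
proof -
  have "compact ((\<lambda>p. h (r *\<^sub>R p)) ` cball 0 1)"
    by (intro compact_continuous_image continuous_on_dilate holomorphic2_continuous_on h r) auto
  then have "bounded ((\<lambda>p. h (r *\<^sub>R p)) ` cball 0 1)" by (rule compact_imp_bounded)
  then obtain B where "0 < B" "\<forall>y\<in>(\<lambda>p. h (r *\<^sub>R p)) ` cball 0 1. norm y \<le> B"
    unfolding bounded_pos by blast
  then show ?thesis using that[of B] by auto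
qed

lemma scaled_sphere_in_ball:
  fixes x :: "complex \<times> complex"
  assumes "0 \<le> r" "r < 1" "x \<in> space \<sigma>"
  shows "r *\<^sub>R x \<in> ball 0 1"
  using assms by (simp add: space_sphere_measure)

text \<open>Stands in for the triangle inequality: pointwise bounds on squared moduli pass to the Hardy norm, and
  \<open>norm_add_sq_le\<close> supplies them for sums.\<close>

lemma hardy_sqnorm_le_combination:
  assumes F: "holomorphic2_on F (ball 0 1)" and G: "holomorphic2_on G (ball 0 1)"
    and c: "0 \<le> c" "0 \<le> d"
    and le: "\<And>p. p \<in> ball 0 1 \<Longrightarrow> (norm (H p))\<^sup>2 \<le> c * (norm (F p))\<^sup>2 + d * (norm (G p))\<^sup>2"
  shows "hardy_sqnorm H \<le> ennreal c * hardy_sqnorm F + ennreal d * hardy_sqnorm G"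
  unfolding hardy_sqnorm_def[of H]
proof (rule SUP_least)
  fix r :: real assume r: "r \<in> {0..<1}"
  then have r': "0 \<le> r" "r < 1" by auto
  note [measurable] = measurable_dilate[OF F r'] measurable_dilate[OF G r']
  have "(\<integral>\<^sup>+x. ennreal ((norm (H (r *\<^sub>R x)))\<^sup>2) \<partial>\<sigma>)
      \<le> (\<integral>\<^sup>+x. ennreal c * ennreal ((norm (F (r *\<^sub>R x)))\<^sup>2) + ennreal d * ennreal ((norm (G (r *\<^sub>R x)))\<^sup>2) \<partial>\<sigma>)"
  proof (rule nn_integral_mono)
    fix x assume "x \<in> space \<sigma>"
    from le[OF scaled_sphere_in_ball[OF r' this]]
    have "ennreal ((norm (H (r *\<^sub>R x)))\<^sup>2) \<le> ennreal (c * (norm (F (r *\<^sub>R x)))\<^sup>2 + d * (norm (G (r *\<^sub>R x)))\<^sup>2)"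
      by (rule ennreal_leI)
    then show "ennreal ((norm (H (r *\<^sub>R x)))\<^sup>2)
        \<le> ennreal c * ennreal ((norm (F (r *\<^sub>R x)))\<^sup>2) + ennreal d * ennreal ((norm (G (r *\<^sub>R x)))\<^sup>2)"
      using c by (simp add: ennreal_mult ennreal_plus)
  qed
  also have "\<dots> = ennreal c * (\<integral>\<^sup>+x. ennreal ((norm (F (r *\<^sub>R x)))\<^sup>2) \<partial>\<sigma>)
      + ennreal d * (\<integral>\<^sup>+x. ennreal ((norm (G (r *\<^sub>R x)))\<^sup>2) \<partial>\<sigma>)"
    by (simp add: nn_integral_add nn_integral_cmult)
  also have "\<dots> \<le> ennreal c * hardy_sqnorm F + ennreal d * hardy_sqnorm G"
    unfolding hardy_sqnorm_def using r by (intro add_mono mult_left_mono SUP_upper) auto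
  finally show "(\<integral>\<^sup>+x. ennreal ((norm (H (r *\<^sub>R x)))\<^sup>2) \<partial>\<sigma>)
      \<le> ennreal c * hardy_sqnorm F + ennreal d * hardy_sqnorm G" .
qed

lemma norm_add_sq_le: "(norm (a + b :: complex))\<^sup>2 \<le> 2 * (norm a)\<^sup>2 + 2 * (norm b)\<^sup>2"
proof -
  have "(norm (a + b))\<^sup>2 \<le> (norm a + norm b)\<^sup>2"
    by (intro power_mono norm_triangle_ineq) auto
  also have "\<dots> \<le> 2 * (norm a)\<^sup>2 + 2 * (norm b)\<^sup>2"
    using zero_le_power2[of "norm a - norm b"] by (simp add: power2_eq_square algebra_simps)
  finally show ?thesis .
qed

lemma hardy_sqnorm_mult_le:
  assumes F: "holomorphic2_on F (ball 0 1)" and B: "\<And>p. p \<in> ball 0 1 \<Longrightarrow> norm (u p) \<le> B"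
  shows "hardy_sqnorm (\<lambda>p. u p * F p) \<le> ennreal (B\<^sup>2) * hardy_sqnorm F"
proof -
  have "(norm (u p * F p))\<^sup>2 \<le> B\<^sup>2 * (norm (F p))\<^sup>2 + 0 * (norm (F p))\<^sup>2" if "p \<in> ball 0 1" for p
    using B[OF that] by (auto simp: norm_mult power_mult_distrib intro!: mult_right_mono power_mono)
  from hardy_sqnorm_le_combination[OF F F _ _ this] show ?thesis by simp
qed

lemma H_infI:
  assumes "holomorphic2_on u (ball 0 1)" "\<And>p. p \<in> ball 0 1 \<Longrightarrow> norm (u p) \<le> B"
  shows "u \<in> H_inf"
  using assms unfolding H_inf_def bounded_iff by blast

lemma H_inf_Mult:
  assumes "u \<in> H_inf"
  shows "u \<in> Mult hardy_space"
  unfolding Mult_def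
proof safe
  fix f assume f: "f \<in> hardy_space"
  have u: "holomorphic2_on u (ball 0 1)" "bounded (u ` ball 0 1)" using assms by (auto simp: H_inf_def)
  have fh: "holomorphic2_on f (ball 0 1)" "hardy_sqnorm f < \<infinity>" using f by (auto simp: hardy_space_def)
  obtain B where B: "\<And>p. p \<in> ball 0 1 \<Longrightarrow> norm (u p) \<le> B"
    using u(2) unfolding bounded_iff by blast
  have "hardy_sqnorm (\<lambda>x. u x * f x) \<le> ennreal (B\<^sup>2) * hardy_sqnorm f"
    by (rule hardy_sqnorm_mult_le[OF fh(1) B])
  also have "\<dots> < \<infinity>" using fh(2) by (simp add: ennreal_mult_less_top)
  finally show "(\<lambda>x. u x * f x) \<in> hardy_space"
    using holomorphic2_mult[OF u(1) fh(1)] by (simp add: hardy_space_def)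
qed

lemma hardy_sqnorm_one: "hardy_sqnorm (\<lambda>p. 1) = 1"
  unfolding hardy_sqnorm_def using sig.emeasure_space_1 by simp

lemma one_in_hardy_space: "(\<lambda>p. 1) \<in> hardy_space"
  by (simp add: hardy_space_def hardy_sqnorm_one holomorphic2_const)

lemma H_inf_subset_hardy: "u \<in> H_inf \<Longrightarrow> u \<in> hardy_space"
  using H_inf_Mult[of u] one_in_hardy_space unfolding Mult_def by fastforce

lemma hardy_norm_less:
  assumes "hardy_sqnorm F < ennreal (\<epsilon>\<^sup>2)" "0 < \<epsilon>"
  shows "hardy_norm F < \<epsilon>"
proof -
  obtain q where q: "hardy_sqnorm F = ennreal q" "0 \<le> q" using assms(1)
    by (cases "hardy_sqnorm F") auto
  then have "q < \<epsilon>\<^sup>2" using assms(1) by (simp add: ennreal_less_iff)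
  then have "sqrt q < \<epsilon>" using assms(2) by (simp add: real_less_lsqrt q)
  then show ?thesis by (simp add: hardy_norm_def q)
qed

lemma bergman_one: "(\<lambda>z. 1) \<in> bergman_space"
  using disc_moment_finite[of 0] by (simp add: bergman_space_def bergman_sqnorm_def disc_moment_def)

text \<open>This membership gives \<open>bergman_norm\<close> its meaning: the norm of a function with infinite
  integral would be \<open>0\<close>.\<close>

lemma bergman_one_minus:
  assumes g: "g \<in> bergman_space"
  shows "(\<lambda>z. 1 - g z) \<in> bergman_space"
proof -
  have hol: "g holomorphic_on ball 0 1" and fin: "bergman_sqnorm g < \<infinity>"
    using g by (auto simp: bergman_space_def)
  have "g \<in> borel_measurable (restrict_space borel (ball 0 1))"
    by (rule borel_measurable_continuous_on_restrict[OF holomorphic_on_imp_continuous_on[OF hol]])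
  then have m: "(\<lambda>z. ennreal ((norm (g z))\<^sup>2 / pi) * indicator (ball 0 1) z) \<in> borel_measurable borel"
    by (subst borel_measurable_restrict_space_iff_ennreal[symmetric]) auto
  then have m': "(\<lambda>z. ennreal ((norm (g z))\<^sup>2 / pi) * indicator (ball 0 1) z) \<in> borel_measurable lborel"
    by (simp only: measurable_lborel2)
  have one: "(\<lambda>z::complex. ennreal (1 / pi) * indicator (ball 0 1) z) \<in> borel_measurable lborel"
    by (rule borel_measurable_times_ennreal[OF borel_measurable_const borel_measurable_indicator]) simp
  have "bergman_sqnorm (\<lambda>z. 1 - g z)
      \<le> (\<integral>\<^sup>+z. ennreal 2 * (ennreal (1 / pi) * indicator (ball 0 1) z)
          + ennreal 2 * (ennreal ((norm (g z))\<^sup>2 / pi) * indicator (ball 0 1) z) \<partial>lborel)"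
    unfolding bergman_sqnorm_def
  proof (rule nn_integral_mono)
    fix z
    have "(norm (1 - g z))\<^sup>2 / pi \<le> 2 * (1 / pi) + 2 * ((norm (g z))\<^sup>2 / pi)"
      using norm_add_sq_le[of 1 "- g z"] by (simp add: field_simps)
    then have "ennreal ((norm (1 - g z))\<^sup>2 / pi) \<le> ennreal (2 * (1 / pi) + 2 * ((norm (g z))\<^sup>2 / pi))"
      by (rule ennreal_leI)
    also have "\<dots> = ennreal 2 * ennreal (1 / pi) + ennreal 2 * ennreal ((norm (g z))\<^sup>2 / pi)"
      by (subst ennreal_plus, simp, simp, subst (1 2) ennreal_mult) (simp_all del: ennreal_numeral)
    finally show "ennreal ((norm (1 - g z))\<^sup>2 / pi) * indicator (ball 0 1) z
        \<le> ennreal 2 * (ennreal (1 / pi) * indicator (ball 0 1) z)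
          + ennreal 2 * (ennreal ((norm (g z))\<^sup>2 / pi) * indicator (ball 0 1) z)"
      by (auto simp: indicator_def)
  qed
  also have "\<dots> = ennreal 2 * bergman_sqnorm (\<lambda>z. 1) + ennreal 2 * bergman_sqnorm g"
    unfolding bergman_sqnorm_def
    by (subst nn_integral_add) (simp_all only: m' one nn_integral_cmult power_one norm_one
        borel_measurable_times_ennreal[OF borel_measurable_const m']
        borel_measurable_times_ennreal[OF borel_measurable_const one])
  also have "\<dots> < \<infinity>"
    using fin bergman_one by (simp add: bergman_space_def ennreal_mult_less_top)
  finally show ?thesis using hol by (auto simp: bergman_space_def intro!: holomorphic_intros)
qed

lemma bergman_norm_less:
  assumes "g \<in> bergman_space" "bergman_norm g < \<epsilon>"
  shows "bergman_sqnorm g < ennreal (\<epsilon>\<^sup>2)"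
proof -
  obtain q where q: "bergman_sqnorm g = ennreal q" "0 \<le> q"
    using assms(1) by (cases "bergman_sqnorm g") (auto simp: bergman_space_def)
  have "sqrt q < \<epsilon>" using assms(2) q by (simp add: bergman_norm_def)
  then have "q < \<epsilon>\<^sup>2" using q(2) by (metis real_sqrt_ge_zero real_sqrt_pow2 power_strict_mono zero_less_numeral)
  then show ?thesis using q by (simp add: ennreal_less_iff)
qed

section \<open>Cyclicity in the Hardy space\<close>

text \<open>Given \<open>g\<close>, dilate it to a bounded function, take \<open>u\<close> with \<open>u S\<close> close to \<open>1\<close> in the Bergman
  space, and dilate \<open>u\<close> as well. The dilate of \<open>u\<close> is bounded, and multiplying the error by \<open>S\<close>
  does not enlarge it because \<open>norm (S z) \<le> 1\<close>. The product of the two dilates is the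
  multiplier.\<close>

lemma cyclic_hardy_fst:
  assumes hol: "S holomorphic_on ball 0 1" and le1: "\<And>z. z \<in> ball 0 1 \<Longrightarrow> norm (S z) \<le> 1"
    and cyc: "cyclic_in bergman_space bergman_norm S"
  shows "cyclic_in hardy_space hardy_norm (\<lambda>p. S (fst p))"
  unfolding cyclic_in_def
proof (intro conjI ballI allI impI)
  let ?f = "\<lambda>p::complex \<times> complex. S (fst p)"
  have fhol: "holomorphic2_on ?f (ball 0 1)" by (rule holomorphic2_fst[OF hol])
  have fle: "norm (?f p) \<le> 1" if "p \<in> ball 0 1" for p
    using that norm_fst_less[of p] by (intro le1) simp
  have "?f \<in> H_inf"
    using fhol fle by (rule H_infI)
  then show "?f \<in> hardy_space" by (rule H_inf_subset_hardy)
  fix g :: "complex \<times> complex \<Rightarrow> complex" and \<epsilon> :: real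
  assume g: "g \<in> hardy_space" and e: "0 < \<epsilon>"
  have ghol: "holomorphic2_on g (ball 0 1)" using g by (simp add: hardy_space_def)
  obtain \<rho> where \<rho>: "0 < \<rho>" "\<rho> < 1" "hardy_sqnorm (\<lambda>x. g x - g (\<rho> *\<^sub>R x)) < ennreal (\<epsilon>\<^sup>2 / 8)"
    using hardy_dilate_approx[OF g, of "\<epsilon>\<^sup>2 / 8"] e by auto
  have \<rho>': "0 \<le> \<rho>" using \<rho> by simp
  obtain B where B: "0 < B" "\<And>p. p \<in> ball 0 1 \<Longrightarrow> norm (g (\<rho> *\<^sub>R p)) \<le> B"
    using dilate_bounded[OF ghol \<rho>' \<rho>(2)] less_imp_le by (metis mem_ball_0)
  \<comment> \<open>the two errors add up to \<open>2 * (\<epsilon> ^ 2 / 8) + 2 * B ^ 2 * (4 * \<delta> ^ 2) = 3/4 * \<epsilon> ^ 2\<close>\<close>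
  define \<delta> where "\<delta> = \<epsilon> / (4 * B)"
  have \<delta>: "0 < \<delta>" using e B by (simp add: \<delta>_def)
  obtain u where u: "u \<in> Mult bergman_space" "bergman_norm (\<lambda>z. 1 - u z * S z) < \<delta>"
  proof -
    have "\<forall>\<epsilon>>0. \<exists>u\<in>Mult bergman_space. bergman_norm (\<lambda>x. 1 - u x * S x) < \<epsilon>"
      using cyc bergman_one unfolding cyclic_in_def by (elim conjE) (drule (1) bspec)
    then show ?thesis using \<delta> that by meson
  qed
  have ub: "u \<in> bergman_space"
    using u(1) bergman_one unfolding Mult_def by fastforce
  have uhol: "u holomorphic_on ball 0 1" using ub by (simp add: bergman_space_def)
  have "(\<lambda>z. u z * S z) \<in> bergman_space"
    using u(1) cyc unfolding Mult_def cyclic_in_def by simp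
  then have ob: "(\<lambda>z. 1 - u z * S z) \<in> bergman_space" by (rule bergman_one_minus)
  let ?U = "\<lambda>p::complex \<times> complex. u (fst p)"
  have Uhol: "holomorphic2_on ?U (ball 0 1)" by (rule holomorphic2_fst[OF uhol])
  have "hardy_sqnorm ?U \<le> bergman_sqnorm u" by (rule hardy_fst_le_bergman[OF uhol])
  then have Uh: "?U \<in> hardy_space"
    using ub Uhol by (auto simp: hardy_space_def bergman_space_def)
  obtain s where s: "0 < s" "s < 1" "hardy_sqnorm (\<lambda>x. ?U x - ?U (s *\<^sub>R x)) < ennreal (\<delta>\<^sup>2)"
    using hardy_dilate_approx[OF Uh, of "\<delta>\<^sup>2"] \<delta> by auto
  have s': "0 \<le> s" using s by simp
  obtain C where C: "0 < C" "\<And>p. p \<in> ball 0 1 \<Longrightarrow> norm (?U (s *\<^sub>R p)) \<le> C"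
    using dilate_bounded[OF Uhol s' s(2)] less_imp_le by (metis mem_ball_0)
  let ?q = "\<lambda>p. g (\<rho> *\<^sub>R p) * ?U (s *\<^sub>R p)"
  note hols = ghol Uhol fhol holomorphic2_dilate[OF ghol \<rho>' \<rho>(2)] holomorphic2_dilate[OF Uhol s' s(2)]
  have qb: "norm (?q p) \<le> B * C" if "p \<in> ball 0 1" for p
    unfolding norm_mult using B C that by (intro mult_mono) (auto intro: less_imp_le)
  have "?q \<in> H_inf"
    using holomorphic2_mult[OF hols(4,5)] qb by (rule H_infI)
  then have q: "?q \<in> Mult hardy_space" by (rule H_inf_Mult)
  let ?E = "\<lambda>p. (\<lambda>z. 1 - u z * S z) (fst p)"
  let ?D = "\<lambda>p. ?U p - ?U (s *\<^sub>R p)"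
  have Ehol: "holomorphic2_on ?E (ball 0 1)"
    by (intro holomorphic2_fst holomorphic_intros uhol hol)
  have E: "hardy_sqnorm ?E < ennreal (\<delta>\<^sup>2)"
  proof -
    have "(\<lambda>z. 1 - u z * S z) holomorphic_on ball 0 1" by (intro holomorphic_intros uhol hol)
    from hardy_fst_le_bergman[OF this] bergman_norm_less[OF ob u(2)] show ?thesis
      by (rule le_less_trans)
  qed
  let ?W = "\<lambda>p. 1 - ?U (s *\<^sub>R p) * ?f p"
  have Whol: "holomorphic2_on ?W (ball 0 1)"
    by (intro holomorphic2_diff holomorphic2_mult holomorphic2_const hols)
  have "hardy_sqnorm ?W \<le> ennreal 2 * hardy_sqnorm ?E + ennreal 2 * hardy_sqnorm ?D"
  proof (rule hardy_sqnorm_le_combination[OF Ehol holomorphic2_diff[OF hols(2,5)]])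
    fix p :: "complex \<times> complex" assume p: "p \<in> ball 0 1"
    \<comment> \<open>\<open>1 - u\<^sub>s S = (1 - u S) + (u - u\<^sub>s) S\<close>, where \<open>u\<^sub>s\<close> is the dilate\<close>
    have "?W p = ?E p + ?D p * ?f p" by (simp add: algebra_simps)
    then have "(norm (?W p))\<^sup>2 \<le> 2 * (norm (?E p))\<^sup>2 + 2 * (norm (?D p * ?f p))\<^sup>2"
      by (simp only: norm_add_sq_le)
    also have "(norm (?D p * ?f p))\<^sup>2 \<le> (norm (?D p))\<^sup>2"
      unfolding norm_mult using fle[OF p] by (intro power_mono mult_left_le) auto
    finally show "(norm (?W p))\<^sup>2 \<le> 2 * (norm (?E p))\<^sup>2 + 2 * (norm (?D p))\<^sup>2" by simp
  qed auto
  also have "\<dots> \<le> ennreal 2 * ennreal (\<delta>\<^sup>2) + ennreal 2 * ennreal (\<delta>\<^sup>2)"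
    using E s(3) by (intro add_mono mult_left_mono) (auto intro: less_imp_le)
  also have "\<dots> = ennreal (4 * \<delta>\<^sup>2)"
    using \<delta> by (simp only: ennreal_mult[symmetric] zero_le_power2 zero_le_numeral ennreal_plus[symmetric] mult_nonneg_nonneg) simp
  finally have W: "hardy_sqnorm ?W \<le> ennreal (4 * \<delta>\<^sup>2)" .
  let ?G = "\<lambda>p. g p - g (\<rho> *\<^sub>R p)"
  have "hardy_sqnorm (\<lambda>p. g p - ?q p * ?f p) \<le> ennreal 2 * hardy_sqnorm ?G + ennreal (2 * B\<^sup>2) * hardy_sqnorm ?W"
  proof (rule hardy_sqnorm_le_combination[OF holomorphic2_diff[OF hols(1,4)] Whol])
    fix p :: "complex \<times> complex" assume p: "p \<in> ball 0 1"
    have "g p - ?q p * ?f p = ?G p + g (\<rho> *\<^sub>R p) * ?W p" by (simp add: algebra_simps)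
    then have "(norm (g p - ?q p * ?f p))\<^sup>2 \<le> 2 * (norm (?G p))\<^sup>2 + 2 * (norm (g (\<rho> *\<^sub>R p) * ?W p))\<^sup>2"
      by (simp only: norm_add_sq_le)
    also have "(norm (g (\<rho> *\<^sub>R p) * ?W p))\<^sup>2 \<le> (B * norm (?W p))\<^sup>2"
      unfolding norm_mult using B(2)[OF p] by (intro power_mono mult_right_mono) auto
    finally show "(norm (g p - ?q p * ?f p))\<^sup>2 \<le> 2 * (norm (?G p))\<^sup>2 + 2 * B\<^sup>2 * (norm (?W p))\<^sup>2"
      by (simp add: power_mult_distrib)
  qed auto
  also have "\<dots> \<le> ennreal 2 * ennreal (\<epsilon>\<^sup>2 / 8) + ennreal (2 * B\<^sup>2) * ennreal (4 * \<delta>\<^sup>2)"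
    using W \<rho>(3) by (intro add_mono mult_left_mono) (auto intro: less_imp_le)
  also have "\<dots> = ennreal (2 * (\<epsilon>\<^sup>2 / 8) + (2 * B\<^sup>2) * (4 * \<delta>\<^sup>2))"
  proof -
    have e1: "ennreal (2 * (\<epsilon>\<^sup>2 / 8)) = ennreal 2 * ennreal (\<epsilon>\<^sup>2 / 8)"
      by (rule ennreal_mult) auto
    have e2: "ennreal ((2 * B\<^sup>2) * (4 * \<delta>\<^sup>2)) = ennreal (2 * B\<^sup>2) * ennreal (4 * \<delta>\<^sup>2)"
      by (rule ennreal_mult) auto
    show ?thesis by (subst ennreal_plus, simp, simp, simp only: e1 e2)
  qed
  also have "2 * (\<epsilon>\<^sup>2 / 8) + (2 * B\<^sup>2) * (4 * \<delta>\<^sup>2) = 3 / 4 * \<epsilon>\<^sup>2"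
    using B by (simp add: \<delta>_def power_divide power_mult_distrib field_simps)
  also have "ennreal (3 / 4 * \<epsilon>\<^sup>2) < ennreal (\<epsilon>\<^sup>2)"
    using e by (intro ennreal_lessI) auto
  finally have "hardy_norm (\<lambda>p. g p - ?q p * ?f p) < \<epsilon>" by (rule hardy_norm_less) (rule e)
  then show "\<exists>u\<in>Mult hardy_space. hardy_norm (\<lambda>x. g x - u x * S (fst x)) < \<epsilon>"
    by (rule bexI[OF _ q])
qed

section \<open>Poisson integrals of singular measures\<close>

definition poisson_kernel :: "complex \<Rightarrow> complex \<Rightarrow> real" where
  "poisson_kernel z \<zeta> = (1 - (norm z)\<^sup>2) / (norm (\<zeta> - z))\<^sup>2"

lemma Re_herglotz:
  assumes "norm \<zeta> = 1"
  shows "Re ((\<zeta> + z) / (\<zeta> - z)) = poisson_kernel z \<zeta>"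
proof -
  have "(Re \<zeta>)\<^sup>2 + (Im \<zeta>)\<^sup>2 = 1" using assms by (simp flip: cmod_power2)
  then have "Re (\<zeta> + z) * Re (\<zeta> - z) + Im (\<zeta> + z) * Im (\<zeta> - z) = 1 - ((Re z)\<^sup>2 + (Im z)\<^sup>2)"
    by (simp add: power2_eq_square algebra_simps)
  then show ?thesis
    unfolding poisson_kernel_def cmod_power2 Re_divide by (simp only:)
qed

lemma poisson_kernel_nonneg: "norm z < 1 \<Longrightarrow> 0 \<le> poisson_kernel z \<zeta>"
  by (simp add: poisson_kernel_def power_le_one)

lemma poisson_kernel_measurable2 [measurable]: "(\<lambda>(t, \<zeta>). poisson_kernel (of_real r * cis t) \<zeta>) \<in> borel_measurable (borel \<Otimes>\<^sub>M borel)"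
  unfolding poisson_kernel_def by measurable

lemma poisson_kernel_measurable [measurable]: "poisson_kernel z \<in> borel_measurable borel"
  unfolding poisson_kernel_def by measurable

text \<open>The mean value property of the Herglotz kernel \<open>(\<zeta> + z) / (\<zeta> - z)\<close>, which is \<open>1\<close> at
  \<open>z = 0\<close>.\<close>

lemma nn_integral_poisson_kernel:
  assumes \<zeta>: "norm \<zeta> = 1" and r: "0 \<le> r" "r < 1"
  shows "(\<integral>\<^sup>+t. ennreal (poisson_kernel (of_real r * cis t) \<zeta>) \<partial>angle) = 1"
proof -
  let ?F = "\<lambda>z. (\<zeta> + z) / (\<zeta> - z)"
  have z: "norm (of_real r * cis t) < 1" for t using r by (simp add: norm_mult)
  have hol: "?F holomorphic_on ball 0 1"
    using \<zeta> by (intro holomorphic_intros) auto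
  have Fm [measurable]: "?F \<in> borel_measurable borel" by measurable
  have int: "integrable angle (\<lambda>t. ?F (of_real r * cis t))"
  proof (rule angle.integrable_const_bound[where B = "2 / (1 - r)"])
    have "norm (?F (of_real r * cis t)) \<le> 2 / (1 - r)" for t
    proof -
      have "norm (\<zeta> + of_real r * cis t) \<le> 2"
        using norm_triangle_ineq[of \<zeta> "of_real r * cis t"] \<zeta> r by (simp add: norm_mult)
      moreover have "1 - r \<le> norm (\<zeta> - of_real r * cis t)"
        using norm_triangle_ineq2[of \<zeta> "of_real r * cis t"] \<zeta> r by (simp add: norm_mult)
      ultimately show ?thesis unfolding norm_divide using r by (intro frac_le) auto
    qed
    then show "AE t in angle. norm (?F (of_real r * cis t)) \<le> 2 / (1 - r)" by simp
  qed measurable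
  have "(\<integral>t. ?F (of_real r * cis t) \<partial>angle) = ?F 0"
    using r by (intro circle_mean_value[OF hol]) auto
  also have "\<dots> = 1" using \<zeta> by auto
  finally have "(\<integral>t. Re (?F (of_real r * cis t)) \<partial>angle) = 1"
    using int by (simp add: integral_Re)
  then have eq: "(\<integral>t. poisson_kernel (of_real r * cis t) \<zeta> \<partial>angle) = 1"
    by (simp only: Re_herglotz[OF \<zeta>])
  have "integrable angle (\<lambda>t. Re (?F (of_real r * cis t)))"
    using int by (rule integrable_Re)
  then have "integrable angle (\<lambda>t. poisson_kernel (of_real r * cis t) \<zeta>)"
    by (simp only: Re_herglotz[OF \<zeta>])
  then show ?thesis
    using eq by (subst nn_integral_eq_integral) (auto intro: poisson_kernel_nonneg z)
qed

locale singular_circle_measure = finite_measure \<mu> for \<mu> :: "complex measure" +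
  fixes N :: "complex set"
  assumes sets_mu: "sets \<mu> = sets (restrict_space borel (sphere (0::complex) 1))"
    and null_N: "N \<in> null_sets arc_length"
    and concentrated: "emeasure \<mu> (space \<mu> - N) = 0"
begin

lemma space_mu: "space \<mu> = sphere 0 1"
  using sets_eq_imp_space_eq[OF sets_mu] by (simp add: space_restrict_space)

lemma measurable_mu_if_borel: "f \<in> measurable borel M \<Longrightarrow> f \<in> measurable \<mu> M"
  by (subst measurable_cong_sets[OF sets_mu refl]) (rule measurable_restrict_space1)

text \<open>For the singular inner function of \<open>\<mu>\<close> this is \<open>- ln (norm (S z))\<close>.\<close>

definition poisson :: "complex \<Rightarrow> real" where
  "poisson z = (\<integral>\<zeta>. poisson_kernel z \<zeta> \<partial>\<mu>)"

lemma herglotz_integrable: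
  assumes "norm z < 1"
  shows "integrable \<mu> (\<lambda>\<zeta>. (\<zeta> + z) / (\<zeta> - z))"
proof (rule integrable_const_bound[where B = "2 / (1 - norm z)"])
  show "(\<lambda>\<zeta>. (\<zeta> + z) / (\<zeta> - z)) \<in> borel_measurable \<mu>"
    by (rule measurable_mu_if_borel) measurable
  have "norm ((\<zeta> + z) / (\<zeta> - z)) \<le> 2 / (1 - norm z)" if "\<zeta> \<in> space \<mu>" for \<zeta>
  proof -
    have n: "norm \<zeta> = 1" using that by (simp add: space_mu)
    have "norm (\<zeta> + z) \<le> 2"
      using norm_triangle_ineq[of \<zeta> z] n assms by simp
    moreover have "1 - norm z \<le> norm (\<zeta> - z)"
      using norm_triangle_ineq2[of \<zeta> z] n by simp
    ultimately show ?thesis unfolding norm_divide using assms by (intro frac_le) auto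
  qed
  then show "AE \<zeta> in \<mu>. norm ((\<zeta> + z) / (\<zeta> - z)) \<le> 2 / (1 - norm z)" by simp
qed

lemma poisson_eq_Re:
  assumes "norm z < 1"
  shows "poisson z = Re (\<integral>\<zeta>. (\<zeta> + z) / (\<zeta> - z) \<partial>\<mu>)"
proof -
  have "Re (\<integral>\<zeta>. (\<zeta> + z) / (\<zeta> - z) \<partial>\<mu>) = (\<integral>\<zeta>. Re ((\<zeta> + z) / (\<zeta> - z)) \<partial>\<mu>)"
    using herglotz_integrable[OF assms] by (rule integral_Re[symmetric])
  also have "\<dots> = poisson z"
    unfolding poisson_def by (intro Bochner_Integration.integral_cong) (auto simp: space_mu Re_herglotz)
  finally show ?thesis by simp
qed

lemma poisson_kernel_integrable: "norm z < 1 \<Longrightarrow> integrable \<mu> (poisson_kernel z)"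
  using integrable_Re[OF herglotz_integrable, of z]
  by (subst (asm) Bochner_Integration.integrable_cong[where g = "poisson_kernel z", OF refl]) (auto simp: space_mu Re_herglotz)

lemma poisson_nonneg: "norm z < 1 \<Longrightarrow> 0 \<le> poisson z"
  unfolding poisson_def by (intro Bochner_Integration.integral_nonneg) (auto intro: poisson_kernel_nonneg)

lemma ennreal_poisson: "norm z < 1 \<Longrightarrow> ennreal (poisson z) = (\<integral>\<^sup>+\<zeta>. ennreal (poisson_kernel z \<zeta>) \<partial>\<mu>)"
  unfolding poisson_def by (rule nn_integral_eq_integral[symmetric]) (auto intro: poisson_kernel_integrable poisson_kernel_nonneg)

text \<open>By Fubini's theorem, every \<open>\<zeta>\<close> in \<open>E\<close> contributes the mean \<open>1\<close> of its Poisson kernel.\<close>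

lemma nn_integral_poisson_part:
  assumes E: "E \<in> sets \<mu>" and r: "0 \<le> r" "r < 1"
  shows "(\<integral>\<^sup>+t. (\<integral>\<^sup>+\<zeta>\<in>E. ennreal (poisson_kernel (of_real r * cis t) \<zeta>) \<partial>\<mu>) \<partial>angle) = emeasure \<mu> E"
    and "(\<lambda>t. \<integral>\<^sup>+\<zeta>\<in>E. ennreal (poisson_kernel (of_real r * cis t) \<zeta>) \<partial>\<mu>) \<in> borel_measurable borel"
proof -
  interpret P: pair_sigma_finite angle \<mu>
    by (simp add: pair_sigma_finite_def angle.sigma_finite_measure_axioms sigma_finite_measure_axioms)
  have id: "(\<lambda>x. x) \<in> measurable \<mu> borel" by (rule measurable_mu_if_borel) simp
  have "(\<lambda>p. (fst p, snd p)) \<in> measurable (angle \<Otimes>\<^sub>M \<mu>) (borel \<Otimes>\<^sub>M borel)"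
    by (intro measurable_Pair measurable_compose[OF measurable_snd id]) measurable
  from measurable_compose[OF this poisson_kernel_measurable2]
  have [measurable]: "(\<lambda>(t, \<zeta>). poisson_kernel (of_real r * cis t) \<zeta>) \<in> borel_measurable (angle \<Otimes>\<^sub>M \<mu>)"
    by (simp add: case_prod_beta')
  have m: "(\<lambda>(t, \<zeta>). ennreal (poisson_kernel (of_real r * cis t) \<zeta>) * indicator E \<zeta>) \<in> borel_measurable (angle \<Otimes>\<^sub>M \<mu>)"
    using E by measurable
  have "(\<lambda>t. \<integral>\<^sup>+\<zeta>\<in>E. ennreal (poisson_kernel (of_real r * cis t) \<zeta>) \<partial>\<mu>) \<in> borel_measurable angle"
    using borel_measurable_nn_integral[OF m] by simp
  then show "(\<lambda>t. \<integral>\<^sup>+\<zeta>\<in>E. ennreal (poisson_kernel (of_real r * cis t) \<zeta>) \<partial>\<mu>) \<in> borel_measurable borel"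
    by simp
  have "(\<integral>\<^sup>+t. (\<integral>\<^sup>+\<zeta>\<in>E. ennreal (poisson_kernel (of_real r * cis t) \<zeta>) \<partial>\<mu>) \<partial>angle)
      = (\<integral>\<^sup>+\<zeta>. \<integral>\<^sup>+t. ennreal (poisson_kernel (of_real r * cis t) \<zeta>) * indicator E \<zeta> \<partial>angle \<partial>\<mu>)"
    by (rule P.Fubini'[OF m, symmetric])
  also have "\<dots> = (\<integral>\<^sup>+\<zeta>. indicator E \<zeta> \<partial>\<mu>)"
  proof (rule nn_integral_cong)
    fix \<zeta> assume "\<zeta> \<in> space \<mu>"
    then have "norm \<zeta> = 1" by (simp add: space_mu)
    from nn_integral_poisson_kernel[OF this r]
    show "(\<integral>\<^sup>+t. ennreal (poisson_kernel (of_real r * cis t) \<zeta>) * indicator E \<zeta> \<partial>angle) = indicator E \<zeta>"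
      by (subst nn_integral_multc) (auto simp: poisson_kernel_def)
  qed
  also have "\<dots> = emeasure \<mu> E" using E by simp
  finally show "(\<integral>\<^sup>+t. (\<integral>\<^sup>+\<zeta>\<in>E. ennreal (poisson_kernel (of_real r * cis t) \<zeta>) \<partial>\<mu>) \<partial>angle) = emeasure \<mu> E" .
qed

lemma nn_integral_poisson:
  assumes r: "0 \<le> r" "r < 1"
  shows "(\<integral>\<^sup>+t. ennreal (poisson (of_real r * cis t)) \<partial>angle) = emeasure \<mu> (space \<mu>)"
proof -
  have "(\<integral>\<^sup>+t. ennreal (poisson (of_real r * cis t)) \<partial>angle)
      = (\<integral>\<^sup>+t. (\<integral>\<^sup>+\<zeta>\<in>space \<mu>. ennreal (poisson_kernel (of_real r * cis t) \<zeta>) \<partial>\<mu>) \<partial>angle)"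
    using r by (intro nn_integral_cong)
      (auto simp: ennreal_poisson norm_mult intro!: nn_integral_cong)
  then show ?thesis using nn_integral_poisson_part(1)[OF sets.top r] by simp
qed

lemma null_preimage: "emeasure angle (cis -` N) = 0" "N \<in> sets borel" "N \<subseteq> sphere 0 1"
proof -
  have N: "N \<in> sets (restrict_space borel (sphere (0::complex) 1))"
    using null_setsD2[OF null_N] by (simp add: arc_length_def)
  then show "N \<in> sets borel" "N \<subseteq> sphere 0 1" by (auto simp: sets_restrict_space)
  have "cis \<in> measurable angle (restrict_space borel (sphere 0 1))"
    by (rule measurable_restrict_space2) auto
  from emeasure_distr[OF this N] show "emeasure angle (cis -` N) = 0"
    using null_setsD1[OF null_N] by (simp add: arc_length_def angle_def)
qed

text \<open>Inner regularity: all but a small part of \<open>\<mu>\<close> sits on a compact set of arc length zero.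
  Compactness keeps almost every point of the circle at a positive distance from it.\<close>

lemma compact_carrier:
  assumes e: "0 < e"
  obtains K where "compact K" "K \<subseteq> N" "K \<in> sets \<mu>" "emeasure \<mu> (space \<mu> - K) \<le> ennreal e"
proof -
  have id: "(\<lambda>x. x) \<in> measurable \<mu> borel" by (rule measurable_mu_if_borel) simp
  define \<nu> where "\<nu> = distr \<mu> borel (\<lambda>x. x)"
  have Nmu: "N \<in> sets \<mu>" using null_preimage(2,3) by (auto simp: sets_mu sets_restrict_space)
  have nu: "emeasure \<nu> A = emeasure \<mu> A" if "A \<in> sets borel" "A \<subseteq> sphere 0 1" for A
    unfolding \<nu>_def using that by (subst emeasure_distr[OF id]) (auto simp: space_mu Int_absorb2)
  have fin: "emeasure \<nu> (space \<nu>) \<noteq> \<infinity>"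
    unfolding \<nu>_def by (subst emeasure_distr[OF id]) (auto simp: emeasure_eq_measure)
  have "emeasure \<nu> N = (SUP K\<in>{K. K \<subseteq> N \<and> compact K}. emeasure \<nu> K)"
    by (rule inner_regular[OF _ fin null_preimage(2)]) (simp add: \<nu>_def)
  moreover have "emeasure \<nu> N < top"
    unfolding nu[OF null_preimage(2,3)] by (simp add: emeasure_eq_measure)
  ultimately have "\<exists>K\<in>{K. K \<subseteq> N \<and> compact K}. emeasure \<nu> N < emeasure \<nu> K + ennreal e"
    by (intro SUP_approx_ennreal[OF e]) (auto simp only: top.not_eq_extremum infinity_ennreal_def intro: compact_empty)
  then obtain K where K: "K \<subseteq> N" "compact K" "emeasure \<nu> N < emeasure \<nu> K + ennreal e" by blast
  have Kb: "K \<in> sets borel" "K \<subseteq> sphere 0 1"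
    using K null_preimage(3) by (auto intro: borel_compact)
  then have Kmu: "K \<in> sets \<mu>" by (auto simp: sets_mu sets_restrict_space)
  have lt: "emeasure \<mu> N < emeasure \<mu> K + ennreal e"
    using K(3) by (simp add: nu Kb null_preimage)
  have "emeasure \<mu> (space \<mu> - K) \<le> emeasure \<mu> (space \<mu> - N) + emeasure \<mu> (N - K)"
  proof -
    have "emeasure \<mu> (space \<mu> - K) \<le> emeasure \<mu> ((space \<mu> - N) \<union> (N - K))"
      using Nmu Kmu by (intro emeasure_mono) auto
    also have "\<dots> \<le> emeasure \<mu> (space \<mu> - N) + emeasure \<mu> (N - K)"
      using Nmu Kmu by (intro emeasure_subadditive) auto
    finally show ?thesis .
  qed
  also have "\<dots> = emeasure \<mu> N - emeasure \<mu> K"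
    unfolding concentrated by (simp add: emeasure_Diff[OF _ Nmu Kmu K(1)])
  also have "\<dots> \<le> ennreal e"
    using lt by (auto simp: emeasure_eq_measure ennreal_minus_le_iff add.commute intro: less_imp_le)
  finally show ?thesis using that K Kmu by blast
qed

text \<open>At a positive distance from \<open>\<zeta>\<close> the Poisson kernel is at most a constant times
  \<open>1 - r ^ 2\<close>.\<close>

lemma poisson_compact_tendsto:
  assumes K: "compact K" "K \<in> sets \<mu>" "cis t \<notin> K" and r: "\<And>n. 0 \<le> r n" "\<And>n. r n < 1" "r \<longlonglongrightarrow> 1"
  shows "(\<lambda>n. \<integral>\<^sup>+\<zeta>\<in>K. ennreal (poisson_kernel (of_real (r n) * cis t) \<zeta>) \<partial>\<mu>) \<longlonglongrightarrow> 0"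
proof -
  have "closed K" using K(1) by (rule compact_imp_closed)
  then obtain d where d: "0 < d" "\<And>\<zeta>. \<zeta> \<in> K \<Longrightarrow> d \<le> dist (cis t) \<zeta>"
    using separate_point_closed[of K "cis t"] K(3) by blast
  \<comment> \<open>the point \<open>r n * cis t\<close> is at distance \<open>1 - r n\<close> from \<open>cis t\<close>\<close>
  let ?b = "\<lambda>n. (1 - (r n)\<^sup>2) / (d - (1 - r n))\<^sup>2 * measure \<mu> K"
  have ev: "eventually (\<lambda>n. 1 - d < r n) sequentially"
    using r(3) by (rule order_tendstoD) (use d in simp)
  have bound: "(\<integral>\<^sup>+\<zeta>\<in>K. ennreal (poisson_kernel (of_real (r n) * cis t) \<zeta>) \<partial>\<mu>) \<le> ennreal (?b n)"
    if n: "1 - d < r n" for n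
  proof -
    have r2: "0 \<le> 1 - (r n)\<^sup>2" using r(1,2)[of n] by (simp add: power_le_one)
    have "poisson_kernel (of_real (r n) * cis t) \<zeta> \<le> (1 - (r n)\<^sup>2) / (d - (1 - r n))\<^sup>2" if "\<zeta> \<in> K" for \<zeta>
    proof -
      have "norm (cis t - of_real (r n) * cis t) = 1 - r n"
      proof -
        have "cis t - of_real (r n) * cis t = of_real (1 - r n) * cis t" by (simp add: algebra_simps)
        then show ?thesis using r(2)[of n] by (simp only: norm_mult norm_cis norm_of_real) simp
      qed
      moreover have "norm (cis t - \<zeta>) \<le> norm (cis t - of_real (r n) * cis t) + norm (\<zeta> - of_real (r n) * cis t)"
        using norm_triangle_ineq4[of "cis t - of_real (r n) * cis t" "\<zeta> - of_real (r n) * cis t"] by simp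
      moreover have "d \<le> norm (cis t - \<zeta>)" using d(2)[OF that] by (simp add: dist_norm)
      ultimately have le: "d - (1 - r n) \<le> norm (\<zeta> - of_real (r n) * cis t)" by linarith
      show ?thesis
      proof -
        have "norm (of_real (r n) * cis t) = r n" using r(1)[of n] by (simp add: norm_mult)
        moreover have "(1 - (r n)\<^sup>2) / (norm (\<zeta> - of_real (r n) * cis t))\<^sup>2 \<le> (1 - (r n)\<^sup>2) / (d - (1 - r n))\<^sup>2"
          by (intro frac_le r2 order_refl zero_less_power power_mono le) (use n in simp_all)
        ultimately show ?thesis unfolding poisson_kernel_def by (simp only:)
      qed
    qed
    then have "(\<integral>\<^sup>+\<zeta>\<in>K. ennreal (poisson_kernel (of_real (r n) * cis t) \<zeta>) \<partial>\<mu>)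
        \<le> (\<integral>\<^sup>+\<zeta>\<in>K. ennreal ((1 - (r n)\<^sup>2) / (d - (1 - r n))\<^sup>2) \<partial>\<mu>)"
      by (intro nn_integral_mono) (auto simp: indicator_def intro: ennreal_leI)
    also have "\<dots> = ennreal ((1 - (r n)\<^sup>2) / (d - (1 - r n))\<^sup>2) * emeasure \<mu> K"
      using K(2) by (rule nn_integral_cmult_indicator)
    also have "\<dots> = ennreal (?b n)"
      unfolding emeasure_eq_measure using r2 by (intro ennreal_mult[symmetric]) auto
    finally show ?thesis .
  qed
  have "?b \<longlonglongrightarrow> (1 - 1\<^sup>2) / (d - (1 - 1))\<^sup>2 * measure \<mu> K"
    using r(3) d(1) by (intro tendsto_intros) auto
  then have "(\<lambda>n. ennreal (?b n)) \<longlonglongrightarrow> ennreal 0"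
    by (intro tendsto_ennrealI) simp
  then have lim: "(\<lambda>n. ennreal (?b n)) \<longlonglongrightarrow> 0" by (simp only: ennreal_0)
  show ?thesis
  proof (rule tendsto_sandwich[OF _ _ tendsto_const lim])
    show "eventually (\<lambda>n. (\<integral>\<^sup>+\<zeta>\<in>K. ennreal (poisson_kernel (of_real (r n) * cis t) \<zeta>) \<partial>\<mu>) \<le> ennreal (?b n)) sequentially"
      using ev by (rule eventually_mono) (rule bound)
  qed simp_all
qed

text \<open>This is how singularity of the measure enters, and it says that the inner function has modulus
  \<open>1\<close> on the circle in quadratic mean. The part of the measure on a compact null set \<open>K\<close>
  contributes a bounded function that tends to \<open>0\<close> almost everywhere; the rest has small mean.\<close>

lemma one_minus_exp_poisson_tendsto:
  assumes r: "\<And>n. 0 \<le> r n" "\<And>n. r n < 1" "r \<longlonglongrightarrow> 1"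
  shows "(\<lambda>n. \<integral>\<^sup>+t. ennreal (1 - exp (- 2 * poisson (of_real (r n) * cis t))) \<partial>angle) \<longlonglongrightarrow> 0"
proof (rule tendsto_zero_ennreal)
  fix \<epsilon> :: real assume e: "0 < \<epsilon>"
  \<comment> \<open>the rest of \<open>\<mu>\<close> contributes \<open>2 * (\<epsilon> / 8)\<close>, the compact part eventually less than \<open>\<epsilon> / 2\<close>\<close>
  obtain K where K: "compact K" "K \<subseteq> N" "K \<in> sets \<mu>" "emeasure \<mu> (space \<mu> - K) \<le> ennreal (\<epsilon> / 8)"
    using compact_carrier[of "\<epsilon> / 8"] e by auto
  let ?L = "space \<mu> - K"
  have L: "?L \<in> sets \<mu>" using K(3) by auto
  define A where "A E n t = (\<integral>\<^sup>+\<zeta>\<in>E. ennreal (poisson_kernel (of_real (r n) * cis t) \<zeta>) \<partial>\<mu>)" for E n t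
  have Am: "A E n \<in> borel_measurable angle" if "E \<in> sets \<mu>" for E n
    unfolding A_def using nn_integral_poisson_part(2)[OF that r(1,2)] by simp
  note [measurable] = Am[OF K(3)] Am[OF L]
  have Kb: "K \<in> sets borel" using K(1) by (rule borel_compact)
  have pre: "cis -` K \<in> null_sets angle"
  proof -
    have s: "cis -` K \<in> sets borel" "cis -` N \<in> sets borel"
      using measurable_sets[OF cis_measurable Kb] measurable_sets[OF cis_measurable null_preimage(2)] by auto
    have "emeasure angle (cis -` K) \<le> emeasure angle (cis -` N)"
      using K(2) s by (intro emeasure_mono) auto
    then show ?thesis using null_preimage(1) s by (auto simp: null_sets_def)
  qed
  have "AE t in angle. cis t \<notin> K"
    using AE_not_in[OF pre] by simp
  then have lim: "AE t in angle. (\<lambda>n. min 1 (2 * A K n t)) \<longlonglongrightarrow> 0"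
  proof (rule AE_mp, intro AE_I2 impI)
    fix t assume "cis t \<notin> K"
    then have "(\<lambda>n. A K n t) \<longlonglongrightarrow> 0"
      unfolding A_def using K r by (intro poisson_compact_tendsto) auto
    then have "(\<lambda>n. min 1 (2 * A K n t)) \<longlonglongrightarrow> min 1 (2 * 0)"
      by (intro tendsto_min tendsto_const tendsto_mult_ennreal) auto
    then show "(\<lambda>n. min 1 (2 * A K n t)) \<longlonglongrightarrow> 0" by simp
  qed
  have "(\<lambda>n. \<integral>\<^sup>+t. min 1 (2 * A K n t) \<partial>angle) \<longlonglongrightarrow> (\<integral>\<^sup>+t. 0 \<partial>angle)"
    by (rule nn_integral_dominated_convergence[where w = "\<lambda>_. 1"])
       (use lim angle.emeasure_space_1 in \<open>auto simp: min_le_iff_disj\<close>)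
  then have "eventually (\<lambda>n. (\<integral>\<^sup>+t. min 1 (2 * A K n t) \<partial>angle) < ennreal (\<epsilon> / 2)) sequentially"
    by (rule order_tendstoD) (use e in simp)
  then show "eventually (\<lambda>n. (\<integral>\<^sup>+t. ennreal (1 - exp (- 2 * poisson (of_real (r n) * cis t))) \<partial>angle) < ennreal \<epsilon>) sequentially"
  proof eventually_elim
    case (elim n)
    have "(\<integral>\<^sup>+t. ennreal (1 - exp (- 2 * poisson (of_real (r n) * cis t))) \<partial>angle)
        \<le> (\<integral>\<^sup>+t. min 1 (2 * A K n t) + 2 * A ?L n t \<partial>angle)"
    proof (rule nn_integral_mono)
      fix t
      have z: "norm (of_real (r n) * cis t) < 1" using r(1,2)[of n] by (simp add: norm_mult)
      let ?q = "poisson (of_real (r n) * cis t)"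
      have q0: "0 \<le> ?q" by (rule poisson_nonneg[OF z])
      have "ennreal ?q = A K n t + A ?L n t"
        unfolding A_def ennreal_poisson[OF z]
      proof (subst nn_integral_add[symmetric])
        have pm: "(\<lambda>\<zeta>. ennreal (poisson_kernel (of_real (r n) * cis t) \<zeta>)) \<in> borel_measurable \<mu>"
          by (rule measurable_mu_if_borel) measurable
        show "(\<lambda>\<zeta>. ennreal (poisson_kernel (of_real (r n) * cis t) \<zeta>) * indicator K \<zeta>) \<in> borel_measurable \<mu>"
          "(\<lambda>\<zeta>. ennreal (poisson_kernel (of_real (r n) * cis t) \<zeta>) * indicator ?L \<zeta>) \<in> borel_measurable \<mu>"
          using pm K(3) L by (auto intro!: borel_measurable_times_ennreal borel_measurable_indicator)
        show "(\<integral>\<^sup>+\<zeta>. ennreal (poisson_kernel (of_real (r n) * cis t) \<zeta>) \<partial>\<mu>)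
            = (\<integral>\<^sup>+\<zeta>. ennreal (poisson_kernel (of_real (r n) * cis t) \<zeta>) * indicator K \<zeta>
               + ennreal (poisson_kernel (of_real (r n) * cis t) \<zeta>) * indicator ?L \<zeta> \<partial>\<mu>)"
          by (intro nn_integral_cong) (auto simp: indicator_def)
      qed
      then have dbl: "ennreal (2 * ?q) = 2 * A K n t + 2 * A ?L n t"
        using q0 by (simp add: ennreal_mult distrib_left)
      have "1 - exp (- 2 * ?q) \<le> 2 * ?q" using exp_ge_add_one_self[of "- 2 * ?q"] by simp
      moreover have "1 - exp (- 2 * ?q) \<le> 1" by simp
      ultimately have "ennreal (1 - exp (- 2 * ?q)) \<le> min 1 (ennreal (2 * ?q))"
        by (auto intro: ennreal_leI simp: ennreal_le_1)
      also have "\<dots> \<le> min 1 (2 * A K n t) + 2 * A ?L n t"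
      proof (cases "2 * A K n t \<le> 1")
        case True
        then show ?thesis unfolding dbl by (intro order_trans[OF min.cobounded2]) (simp add: min_absorb2)
      next
        case False
        then have "min 1 (2 * A K n t) = 1" by simp
        then show ?thesis by (intro order_trans[OF min.cobounded1]) simp
      qed
      finally show "ennreal (1 - exp (- 2 * ?q)) \<le> min 1 (2 * A K n t) + 2 * A ?L n t" .
    qed
    also have "\<dots> = (\<integral>\<^sup>+t. min 1 (2 * A K n t) \<partial>angle) + 2 * (\<integral>\<^sup>+t. A ?L n t \<partial>angle)"
      by (simp add: nn_integral_add nn_integral_cmult)
    also have "(\<integral>\<^sup>+t. A ?L n t \<partial>angle) = emeasure \<mu> ?L"
      unfolding A_def using L r by (intro nn_integral_poisson_part(1)) auto
    also have "(\<integral>\<^sup>+t. min 1 (2 * A K n t) \<partial>angle) + 2 * emeasure \<mu> ?L \<le> ennreal (\<epsilon> / 2) + ennreal 2 * ennreal (\<epsilon> / 8)"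
      using elim K(4) by (intro add_mono) (auto intro: less_imp_le mult_left_mono)
    also have "\<dots> = ennreal (\<epsilon> / 2 + 2 * (\<epsilon> / 8))"
      using e by (subst ennreal_mult[symmetric], simp, simp, subst ennreal_plus) auto
    also have "\<dots> < ennreal \<epsilon>" using e by (intro ennreal_lessI) auto
    finally show ?case .
  qed
qed

lemma poisson_measurable:
  assumes r: "0 \<le> r" "r < 1"
  shows "(\<lambda>t. poisson (of_real r * cis t)) \<in> borel_measurable borel"
proof -
  have "(\<integral>\<^sup>+\<zeta>\<in>space \<mu>. ennreal (poisson_kernel (of_real r * cis t) \<zeta>) \<partial>\<mu>) = ennreal (poisson (of_real r * cis t))" for t
    using r by (subst ennreal_poisson) (auto simp: norm_mult intro!: nn_integral_cong)
  then have "(\<lambda>t. ennreal (poisson (of_real r * cis t))) \<in> borel_measurable borel"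
    using nn_integral_poisson_part(2)[OF sets.top r] by simp
  then have "(\<lambda>t. enn2real (ennreal (poisson (of_real r * cis t)))) \<in> borel_measurable borel"
    by (rule borel_measurable_enn2real)
  then show ?thesis using r by (simp add: poisson_nonneg norm_mult)
qed

text \<open>The right-hand side is the arithmetic mean of \<open>M * (1 - exp (- 2 * x))\<close> and
  \<open>exp (2 * x) / M\<close>, whose product \<open>exp (2 * x) - 1\<close> is at least \<open>x ^ 2\<close>.\<close>

lemma exp_interpolation:
  fixes x M :: real
  assumes x: "0 \<le> x" and M: "0 < M"
  shows "x \<le> M / 2 * (1 - exp (- 2 * x)) + 1 / (2 * M) * exp (2 * x)"
proof -
  define a where "a = M * (1 - exp (- 2 * x))"
  define b where "b = exp (2 * x) / M"
  have nn: "0 \<le> a" "0 \<le> b" using x M by (auto simp: a_def b_def)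
  have "a * b = exp (2 * x) - exp (- 2 * x) * exp (2 * x)"
    using M by (simp add: a_def b_def algebra_simps)
  also have "\<dots> = exp (2 * x) - 1" by (simp flip: exp_add)
  finally have ab: "a * b = exp (2 * x) - 1" .
  have "1 + 2 * x + (2 * x)\<^sup>2 / 2 \<le> exp (2 * x)"
    using x by (intro exp_lower_Taylor_quadratic) simp
  then have "1 + 2 * x + 2 * x\<^sup>2 \<le> exp (2 * x)" by (simp add: power_mult_distrib)
  then have "x\<^sup>2 \<le> a * b" unfolding ab using x zero_le_power2[of x] by linarith
  moreover have "4 * (a * b) \<le> (a + b)\<^sup>2"
    using zero_le_power2[of "a - b"] by (simp add: power2_eq_square algebra_simps)
  ultimately have "(2 * x)\<^sup>2 \<le> (a + b)\<^sup>2" by (simp add: power_mult_distrib)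
  then have "2 * x \<le> a + b" using nn by (rule power2_le_imp_le[OF _ add_nonneg_nonneg])
  then show ?thesis by (simp add: a_def b_def)
qed

text \<open>Integrate \<open>exp_interpolation\<close> over circles. The first term vanishes in the limit because \<open>\<mu>\<close> is
  singular, the second is at most \<open>C / (2 * M)\<close> with \<open>M\<close> arbitrary, and the left-hand side is the
  total mass on every circle.\<close>

lemma total_mass_zero:
  assumes r: "\<And>n. 0 \<le> r n" "\<And>n. r n < 1" "r \<longlonglongrightarrow> 1" and C: "0 \<le> C"
    and bd: "\<And>n. (\<integral>\<^sup>+t. ennreal (exp (2 * poisson (of_real (r n) * cis t))) \<partial>angle) \<le> ennreal C"
  shows "emeasure \<mu> (space \<mu>) = 0"
proof -
  define m where "m = measure \<mu> (space \<mu>)"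
  have m: "emeasure \<mu> (space \<mu>) = ennreal m" "0 \<le> m" by (simp_all add: m_def emeasure_eq_measure)
  define I where "I n = (\<integral>\<^sup>+t. ennreal (1 - exp (- 2 * poisson (of_real (r n) * cis t))) \<partial>angle)" for n
  have I: "I \<longlonglongrightarrow> 0" unfolding I_def by (rule one_minus_exp_poisson_tendsto[OF r])
  have le: "m \<le> C / (2 * M)" if M: "0 < M" for M
  proof -
    have "ennreal m \<le> ennreal (M / 2) * I n + ennreal (C / (2 * M))" for n
    proof -
      note [measurable] = poisson_measurable[OF r(1,2)]
      have z: "norm (of_real (r n) * cis t) < 1" for t using r(1,2)[of n] by (simp add: norm_mult)
      have "ennreal m = (\<integral>\<^sup>+t. ennreal (poisson (of_real (r n) * cis t)) \<partial>angle)"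
        using nn_integral_poisson[OF r(1,2)] by (simp add: m)
      also have "\<dots> \<le> (\<integral>\<^sup>+t. ennreal (M / 2) * ennreal (1 - exp (- 2 * poisson (of_real (r n) * cis t)))
          + ennreal (1 / (2 * M)) * ennreal (exp (2 * poisson (of_real (r n) * cis t))) \<partial>angle)"
      proof (rule nn_integral_mono)
        fix t
        let ?q = "poisson (of_real (r n) * cis t)"
        have q: "0 \<le> ?q" by (rule poisson_nonneg[OF z])
        have "ennreal ?q \<le> ennreal (M / 2 * (1 - exp (- 2 * ?q)) + 1 / (2 * M) * exp (2 * ?q))"
          by (rule ennreal_leI[OF exp_interpolation[OF q M]])
        also have "\<dots> = ennreal (M / 2 * (1 - exp (- 2 * ?q))) + ennreal (1 / (2 * M) * exp (2 * ?q))"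
          using M q by (intro ennreal_plus) auto
        also have "\<dots> = ennreal (M / 2) * ennreal (1 - exp (- 2 * ?q)) + ennreal (1 / (2 * M)) * ennreal (exp (2 * ?q))"
          using M q by (subst (1 2) ennreal_mult) auto
        finally show "ennreal ?q \<le> ennreal (M / 2) * ennreal (1 - exp (- 2 * ?q)) + ennreal (1 / (2 * M)) * ennreal (exp (2 * ?q))" .
      qed
      also have "\<dots> = ennreal (M / 2) * I n
          + ennreal (1 / (2 * M)) * (\<integral>\<^sup>+t. ennreal (exp (2 * poisson (of_real (r n) * cis t))) \<partial>angle)"
        unfolding I_def by (simp add: nn_integral_add nn_integral_cmult)
      also have "\<dots> \<le> ennreal (M / 2) * I n + ennreal (1 / (2 * M)) * ennreal C"
        by (intro add_left_mono mult_left_mono bd) simp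
      also have "ennreal (1 / (2 * M)) * ennreal C = ennreal (C / (2 * M))"
        using M C by (subst ennreal_mult[symmetric]) auto
      finally show ?thesis .
    qed
    moreover have "(\<lambda>n. ennreal (M / 2) * I n + ennreal (C / (2 * M))) \<longlonglongrightarrow> ennreal (M / 2) * 0 + ennreal (C / (2 * M))"
      using I by (intro tendsto_add tendsto_const tendsto_mult_ennreal) auto
    ultimately have "ennreal m \<le> ennreal (C / (2 * M))"
      using LIMSEQ_le_const[of _ "ennreal (M / 2) * 0 + ennreal (C / (2 * M))"] by force
    then show ?thesis using M C by (subst (asm) ennreal_le_iff) auto
  qed
  have "m = 0"
  proof (rule ccontr)
    assume "m \<noteq> 0"
    then have m0: "0 < m" using m by simp
    \<comment> \<open>\<open>C + 1\<close> instead of \<open>C\<close> keeps \<open>M\<close> positive when \<open>C = 0\<close>\<close>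
    then have "m \<le> C / (2 * ((C + 1) / m))" using C by (intro le) auto
    also have "\<dots> = m * (C / (2 * (C + 1)))" by simp
    also have "\<dots> < m * 1" using C m0 by (intro mult_strict_left_mono) (auto simp: field_simps)
    finally show False by simp
  qed
  then show ?thesis by (simp add: m)
qed

end

section \<open>Uniform boundedness\<close>

text \<open>The uniform boundedness principle for point evaluations as functionals on \<open>l\<^sup>1\<close>, by Sokal's
  elementary argument. If the supremum of the \<open>j\<close>-th function of a subsequence exceeds \<open>4 ^ j\<close>
  and is nearly attained at \<open>p j\<close>, use the weights \<open>3 ^ (- j)\<close> at \<open>p j\<close> with signs chosen one
  after the other such that the \<open>j\<close>-th term does not shorten the partial sum that it extends.\<close>

lemma uniform_boundedness_l1:
  fixes \<Phi> :: "nat \<Rightarrow> 'a \<Rightarrow> complex"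
  assumes D: "D \<noteq> {}" and bdd: "\<And>n. \<exists>B. \<forall>p\<in>D. norm (\<Phi> n p) \<le> B"
    and bd: "\<And>e p. (\<And>l. norm (e l) = 1) \<Longrightarrow> (\<And>l. p l \<in> D) \<Longrightarrow>
        \<exists>B. \<forall>n. norm (\<Sum>l. complex_of_real (e l * (1/3) ^ l) * \<Phi> n (p l)) \<le> B"
  shows "\<exists>C. \<forall>n. \<forall>p\<in>D. norm (\<Phi> n p) \<le> C"
proof (rule ccontr)
  assume unb: "\<not> ?thesis"
  define s where "s n = (SUP p\<in>D. norm (\<Phi> n p))" for n
  have ba: "bdd_above ((\<lambda>p. norm (\<Phi> n p)) ` D)" for n
    using bdd[of n] unfolding bdd_above_def by blast
  have le_s: "norm (\<Phi> n p) \<le> s n" if "p \<in> D" for n p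
    unfolding s_def using that ba by (rule cSUP_upper)
  have "\<exists>n. 4 ^ j < s n" for j :: nat
    using unb le_s by (meson not_le order_trans)
  then obtain N where N: "\<And>j. 4 ^ j < s (N j)" by metis
  have s0: "0 < s (N j)" for j
    using N[of j] zero_less_power[of "4::real" j] by linarith
  have "\<exists>p\<in>D. 3/4 * s (N j) < norm (\<Phi> (N j) p)" for j
  proof -
    have "3/4 * s (N j) < s (N j)" using s0[of j] by simp
    then show ?thesis unfolding s_def[of "N j"]
      using less_cSUP_iff[OF D ba[of "N j"]] by blast
  qed
  then obtain p where p: "\<And>j. p j \<in> D" "\<And>j. 3/4 * s (N j) < norm (\<Phi> (N j) (p j))" by metis
  define P where "P e j r \<longleftrightarrow> norm r = 1 \<and>
     (1/3) ^ j * norm (\<Phi> (N j) (p j))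
      \<le> norm ((\<Sum>l<j. complex_of_real (e l * (1/3) ^ l) * \<Phi> (N j) (p l))
          + complex_of_real (r * (1/3) ^ j) * \<Phi> (N j) (p j))"
    for e :: "nat \<Rightarrow> real" and j :: nat and r :: real
  \<comment> \<open>one of the two signs does not shorten the vector\<close>
  have "\<exists>e. \<forall>j. P e j (e j)"
  proof (rule dependent_wellorder_choice)
    fix r :: real and f g :: "nat \<Rightarrow> real" and x :: nat
    assume "\<And>y. y < x \<Longrightarrow> f y = g y"
    then show "P f x r = P g x r" by (simp add: P_def)
  next
    fix x :: nat and f :: "nat \<Rightarrow> real"
    define a where "a = (\<Sum>l<x. complex_of_real (f l * (1/3) ^ l) * \<Phi> (N x) (p l))"
    define b where "b = complex_of_real ((1/3) ^ x) * \<Phi> (N x) (p x)"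
    have nb: "norm b = (1/3) ^ x * norm (\<Phi> (N x) (p x))"
      by (simp add: b_def norm_mult norm_power norm_divide)
    have "2 * norm b = norm ((a + b) - (a - b))" by simp
    also have "\<dots> \<le> norm (a + b) + norm (a - b)" by (rule norm_triangle_ineq4)
    finally have "norm b \<le> norm (a + b) \<or> norm b \<le> norm (a - b)" by linarith
    moreover have "P f x r \<longleftrightarrow> norm r = 1 \<and> norm b \<le> norm (a + of_real r * b)" for r
      unfolding P_def nb[symmetric] a_def[symmetric] by (simp only: b_def of_real_mult mult.assoc)
    from this[of 1] this[of "-1"]
    have "P f x 1 \<longleftrightarrow> norm b \<le> norm (a + b)" "P f x (-1) \<longleftrightarrow> norm b \<le> norm (a - b)" by simp_all
    ultimately show "\<exists>r. P f x r" by blast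
  qed
  then obtain e where e: "\<And>j. P e j (e j)" by blast
  have e1: "norm (e l) = 1" for l using e[of l] by (simp add: P_def)
  obtain B where B: "\<And>n. norm (\<Sum>l. complex_of_real (e l * (1/3) ^ l) * \<Phi> n (p l)) \<le> B"
    using bd[of e p] e1 p(1) by blast
  have big: "1/4 * (4/3) ^ j \<le> B" for j
  proof -
    \<comment> \<open>of \<open>s (N j) / 3 ^ j\<close>, the terms up to \<open>j\<close> give at least \<open>3/4\<close> and the geometric tail takes at most \<open>1/2\<close>\<close>
    let ?t = "\<lambda>l. complex_of_real (e l * (1/3) ^ l) * \<Phi> (N j) (p l)"
    have nt: "norm (?t l) \<le> (1/3) ^ l * s (N j)" for l
      unfolding norm_mult using e1[of l] le_s[OF p(1)]
      by (intro mult_mono) (auto simp: norm_mult norm_power abs_mult norm_divide)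
    have gs: "summable (\<lambda>l. (1/3) ^ l * s (N j) :: real)"
      by (intro summable_mult2 summable_geometric) simp
    have sm: "summable ?t"
      by (rule summable_comparison_test'[OF gs]) (rule nt)
    have split: "(\<Sum>l. ?t l) = (\<Sum>l. ?t (l + Suc j)) + (\<Sum>l<Suc j. ?t l)"
      by (rule suminf_split_initial_segment[OF sm])
    have gs': "(\<lambda>l. (1/3) ^ (l + Suc j) * s (N j)) sums (1/2 * (1/3) ^ j * s (N j))"
    proof -
      have "(\<lambda>l. (1/3) ^ l * ((1/3) ^ Suc j * s (N j))) sums (1 / (1 - 1/3) * ((1/3) ^ Suc j * s (N j)))"
        by (intro sums_mult2 geometric_sums) simp
      then show ?thesis by (simp add: power_add mult_ac)
    qed
    have "norm (\<Sum>l. ?t (l + Suc j)) \<le> (\<Sum>l. (1/3) ^ (l + Suc j) * s (N j))"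
      by (rule norm_suminf_le[OF nt]) (use gs' in \<open>simp add: sums_iff\<close>)
    also have "\<dots> = 1/2 * (1/3) ^ j * s (N j)" using gs' by (simp add: sums_iff)
    finally have tail: "norm (\<Sum>l. ?t (l + Suc j)) \<le> 1/2 * (1/3) ^ j * s (N j)" .
    have "(1/3) ^ j * (3/4 * s (N j)) \<le> (1/3) ^ j * norm (\<Phi> (N j) (p j))"
      using p(2)[of j] by (intro mult_left_mono) auto
    also have "\<dots> \<le> norm (\<Sum>l<Suc j. ?t l)"
      using e[of j] by (simp add: P_def)
    finally have head: "3/4 * (1/3) ^ j * s (N j) \<le> norm (\<Sum>l<Suc j. ?t l)" by (simp add: mult_ac)
    have "1/4 * (4/3) ^ j = 1/4 * (1/3) ^ j * (4 ^ j :: real)"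
      by (simp add: power_divide)
    also have "\<dots> \<le> 1/4 * (1/3) ^ j * s (N j)"
      using N[of j] by (intro mult_left_mono) auto
    also have "\<dots> \<le> norm (\<Sum>l. ?t l)"
      using head tail norm_triangle_ineq[of "\<Sum>l. ?t l" "- (\<Sum>l. ?t (l + Suc j))"]
      unfolding norm_minus_cancel split by (simp add: algebra_simps)
    also have "\<dots> \<le> B" by (rule B)
    finally show ?thesis .
  qed
  obtain j where "4 * B < (4/3 :: real) ^ j"
    using real_arch_pow[of "4/3" "4 * B"] by auto
  with big[of j] show False by simp
qed

section \<open>Reproducing kernels at points of the first axis\<close>

definition fst_moment :: "nat \<Rightarrow> real" where
  "fst_moment k = enn2real (fst_moment_enn k)"

lemma fst_moment_le_1: "fst_moment_enn k \<le> 1"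
proof -
  have "fst_moment_enn k \<le> (\<integral>\<^sup>+x. 1 \<partial>\<sigma>)"
    unfolding fst_moment_enn_def
  proof (rule nn_integral_mono)
    fix x :: "complex \<times> complex" assume "x \<in> space \<sigma>"
    then have "norm (fst x) \<le> 1" using norm_fst_le_norm[of x] by (simp add: space_sphere_measure)
    then show "ennreal ((norm (fst x ^ k))\<^sup>2) \<le> 1"
      by (simp add: norm_power power_le_one ennreal_le_1)
  qed
  also have "\<dots> = 1" using sig.emeasure_space_1 by simp
  finally show ?thesis .
qed

lemma fst_moment_ennreal: "fst_moment_enn k = ennreal (fst_moment k)"
  unfolding fst_moment_def using fst_moment_le_1[of k] by (subst ennreal_enn2real) (auto intro: le_less_trans)

lemma fst_moment_nonneg: "0 \<le> fst_moment k" by (simp add: fst_moment_def)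

text \<open>The moments do not decay exponentially: the part of the sphere where \<open>norm z ^ 2 \<ge> s\<close> has
  positive measure, since it is the radial image of a set with nonempty interior. Hence the kernel
  series below converges up to the boundary.\<close>

lemma fst_moment_lower:
  assumes s: "0 < s" "s < 1"
  obtains c where "0 < c" "\<And>k. c * s ^ k \<le> fst_moment k"
proof -
  define A where "A = {x :: complex \<times> complex. s \<le> (norm (fst x))\<^sup>2} \<inter> sphere 0 1"
  have Ac: "closed A"
    unfolding A_def by (intro closed_Int closed_Collect_le closed_sphere continuous_intros)
  then have Ab: "A \<in> sets borel" "A \<subseteq> sphere 0 1" by (auto simp: A_def)
  then have As: "A \<in> sets \<sigma>" by (auto simp: sets_sphere_measure sets_restrict_space)
  \<comment> \<open>an open cone, cut off by the ball, whose radial image lies in \<open>A\<close>\<close>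
  define U where "U = {x :: complex \<times> complex. s * (norm x)\<^sup>2 < (norm (fst x))\<^sup>2} \<inter> ball 0 1"
  have Uo: "open U"
    unfolding U_def by (intro open_Int open_Collect_less open_ball continuous_intros)
  have U1: "(1/2, 0) \<in> U" using s by (simp add: U_def norm_Pair power2_eq_square norm_divide)
  have US: "U \<subseteq> ball 0 1 \<inter> sgn -` A"
  proof
    fix x assume x: "x \<in> U"
    have x0: "x \<noteq> 0" using x by (auto simp: U_def)
    then have n0: "0 < (norm x)\<^sup>2" by simp
    have "(norm (fst (sgn x)))\<^sup>2 = (norm (fst x))\<^sup>2 / (norm x)\<^sup>2"
      by (simp add: sgn_div_norm power_inverse power_mult_distrib divide_inverse mult.commute)
    moreover have "s \<le> (norm (fst x))\<^sup>2 / (norm x)\<^sup>2"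
      using x n0 by (simp add: U_def pos_le_divide_eq less_imp_le)
    ultimately have "s \<le> (norm (fst (sgn x)))\<^sup>2" by simp
    then show "x \<in> ball 0 1 \<inter> sgn -` A"
      using x x0 by (simp add: A_def U_def norm_sgn)
  qed
  have Upos: "emeasure lborel U \<noteq> 0"
  proof
    assume "emeasure lborel U = 0"
    then have "negligible U"
      using Uo by (intro negligible_iff_null_sets[THEN iffD2] null_sets_completionI)
         (auto simp: null_sets_def)
    then show False using open_not_negligible[OF Uo] U1 by blast
  qed
  have sA: "sgn -` A \<in> sets borel"
    using measurable_sets[OF measurable_sgn_borel Ab(1)] by simp
  have "emeasure \<sigma> A = emeasure lborel (ball 0 1 \<inter> sgn -` A) / emeasure lborel (ball (0::complex \<times> complex) 1)"
    unfolding emeasure_sphere_measure[OF Ab] using sA by (subst emeasure_uniform_measure) auto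
  moreover have "emeasure lborel U \<le> emeasure lborel (ball 0 1 \<inter> sgn -` A)"
    using US sA by (intro emeasure_mono) auto
  ultimately have pos: "emeasure \<sigma> A \<noteq> 0"
    using Upos emeasure_lborel_unit_ball(2)[where 'a = "complex \<times> complex"]
    by (auto simp: ennreal_divide_eq_0_iff)
  define c where "c = measure \<sigma> A"
  have c: "emeasure \<sigma> A = ennreal c" by (simp add: c_def sig.emeasure_eq_measure)
  have c0: "0 < c" using pos c by (metis c_def ennreal_0 measure_nonneg less_eq_real_def)
  have "c * s ^ k \<le> fst_moment k" for k
  proof -
    have "ennreal (s ^ k) * emeasure \<sigma> A = (\<integral>\<^sup>+x. ennreal (s ^ k) * indicator A x \<partial>\<sigma>)"
      using As by (simp add: nn_integral_cmult_indicator)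
    also have "\<dots> \<le> fst_moment_enn k"
      unfolding fst_moment_enn_def
    proof (rule nn_integral_mono)
      fix x :: "complex \<times> complex"
      have "s ^ k \<le> ((norm (fst x))\<^sup>2) ^ k" if "x \<in> A"
        using that s by (intro power_mono) (auto simp: A_def)
      then show "ennreal (s ^ k) * indicator A x \<le> ennreal ((norm (fst x ^ k))\<^sup>2)"
        by (auto simp: indicator_def norm_power power_mult[symmetric] mult.commute intro: ennreal_leI)
    qed
    finally have "ennreal (s ^ k * c) \<le> ennreal (fst_moment k)"
      using s c0 by (simp add: fst_moment_ennreal c ennreal_mult)
    then show ?thesis by (simp add: fst_moment_nonneg mult.commute)
  qed
  then show ?thesis using that c0 by blast
qed

lemma fst_moment_pos: "0 < fst_moment k"
proof -
  obtain c where c: "0 < c" "\<And>k. c * (1/2) ^ k \<le> fst_moment k" using fst_moment_lower[of "1/2"] by auto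
  have "0 < c * (1/2) ^ k" using c(1) by simp
  also have "\<dots> \<le> fst_moment k" by (rule c(2))
  finally show ?thesis .
qed

text \<open>Both expansions are Fourier expansions of the same function on the circle of radius \<open>1 / 2\<close>.\<close>

lemma tcoeff_unique:
  assumes s: "\<And>z. norm z < 1 \<Longrightarrow> (\<lambda>k. c k * z ^ k) sums F z"
  shows "F holomorphic_on ball 0 1" "tcoeff F k = c k"
proof -
  show hol: "F holomorphic_on ball 0 1"
    by (rule power_series_holomorphic[where a = c]) (use s in auto)
  have half: "norm (1/2 :: complex) < 1" by simp
  have "summable (\<lambda>k. c k * complex_of_real (3/4) ^ k)"
    using s[of "of_real (3/4)"] by (simp add: sums_iff)
  then have c1: "summable (\<lambda>k. norm (c k * (1/2) ^ k))"
    by (rule powser_insidea) simp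
  have c2: "F (1/2 * cis t) = (\<Sum>k. (c k * (1/2) ^ k) * cis (of_nat k * t))" for t
  proof -
    have "(\<lambda>k. c k * (1/2 * cis t) ^ k) sums F (1/2 * cis t)"
      by (rule s) (simp add: norm_mult)
    moreover have "c k * (1/2 * cis t) ^ k = (c k * (1/2) ^ k) * cis (of_nat k * t)" for k
      by (simp only: power_mult_distrib Complex.DeMoivre mult.assoc)
    ultimately have "(\<lambda>k. (c k * (1/2) ^ k) * cis (of_nat k * t)) sums F (1/2 * cis t)"
      by (simp only:)
    then show ?thesis by (rule sums_unique)
  qed
  have "c k * (1/2) ^ k = (\<integral>t. F (1/2 * cis t) * cis (- of_nat k * t) \<partial>angle)"
    unfolding c2 by (rule integral_angle_fourier_coeff[OF c1, symmetric])
  also have "\<dots> = tcoeff F k * (1/2) ^ k"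
    unfolding circle_series(2)[OF hol half]
    by (rule integral_angle_fourier_coeff[OF circle_series(1)[OF hol half]])
  finally show "tcoeff F k = c k" by simp
qed

text \<open>The reproducing kernel of the Hardy space at \<open>(p, 0)\<close>, as a function of the first coordinate.
  In closed form it is \<open>1 / (1 - cnj p * z) ^ 2\<close>; the series is used because only orthogonality
  of the monomials enters.\<close>

definition hardy_kernel :: "complex \<Rightarrow> complex \<Rightarrow> complex" where
  "hardy_kernel p z = (\<Sum>k. cnj p ^ k / of_real (fst_moment k) * z ^ k)"

lemma hardy_kernel_summable:
  assumes p: "norm p < 1"
  shows "summable (\<lambda>k. norm p ^ k / fst_moment k)"
proof -
  \<comment> \<open>any exponential rate between \<open>norm p\<close> and \<open>1\<close> beats the decay of the moments\<close>
  obtain s where s: "norm p < s" "s < 1" using p dense by blast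
  have s0: "0 < s" using s(1) norm_ge_zero[of p] by linarith
  obtain c where c: "0 < c" "\<And>k. c * s ^ k \<le> fst_moment k" using fst_moment_lower[OF s0 s(2)] by blast
  have "summable (\<lambda>k. (1 / c) * (norm p / s) ^ k)"
    using s s0 by (intro summable_mult summable_geometric) (simp add: norm_divide)
  then show ?thesis
  proof (rule summable_comparison_test')
    fix k
    have "norm p ^ k / fst_moment k \<le> norm p ^ k / (c * s ^ k)"
      using c s0 by (intro frac_le) auto
    then show "norm (norm p ^ k / fst_moment k) \<le> (1 / c) * (norm p / s) ^ k"
      using fst_moment_pos[of k] by (simp add: power_divide mult.commute)
  qed
qed

lemma hardy_kernel_sums:
  assumes p: "norm p < 1" and z: "norm z < 1"
  shows "(\<lambda>k. cnj p ^ k / of_real (fst_moment k) * z ^ k) sums hardy_kernel p z"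
  unfolding hardy_kernel_def
proof (rule summable_sums, rule summable_comparison_test'[OF hardy_kernel_summable[OF p]])
  fix k
  have "norm z ^ k \<le> 1" using z by (simp add: power_le_one)
  from mult_left_mono[OF this, of "norm p ^ k / fst_moment k"]
  show "norm (cnj p ^ k / of_real (fst_moment k) * z ^ k) \<le> norm p ^ k / fst_moment k"
    using fst_moment_pos[of k] by (simp add: norm_mult norm_power norm_divide)
qed

lemma hardy_kernel_holomorphic: "norm p < 1 \<Longrightarrow> hardy_kernel p holomorphic_on ball 0 1"
  and hardy_kernel_tcoeff: "norm p < 1 \<Longrightarrow> tcoeff (hardy_kernel p) k = cnj p ^ k / of_real (fst_moment k)"
  using tcoeff_unique[where c = "\<lambda>k. cnj p ^ k / of_real (fst_moment k)" and F = "hardy_kernel p"] hardy_kernel_sums by auto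

text \<open>The squared Hardy norm of the kernel, which is also its value at \<open>p\<close>.\<close>

definition hardy_kernel_norm2 :: "complex \<Rightarrow> real" where
  "hardy_kernel_norm2 p = (\<Sum>k. ((norm p)\<^sup>2) ^ k / fst_moment k)"

lemma hardy_kernel_norm2_sums:
  assumes p: "norm p < 1"
  shows "(\<lambda>k. ((norm p)\<^sup>2) ^ k / fst_moment k) sums hardy_kernel_norm2 p"
proof -
  have "norm (of_real ((norm p)\<^sup>2) :: complex) < 1" using p by (simp add: power_less_one_iff norm_power)
  from hardy_kernel_summable[OF this] show ?thesis
    unfolding hardy_kernel_norm2_def by (intro summable_sums) (simp add: norm_power)
qed

lemma hardy_kernel_norm2_pos:
  assumes p: "norm p < 1"
  shows "0 < hardy_kernel_norm2 p"
proof -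
  have "0 < ((norm p)\<^sup>2) ^ 0 / fst_moment 0" using fst_moment_pos[of 0] by simp
  also have "\<dots> = (\<Sum>k\<in>{0}. ((norm p)\<^sup>2) ^ k / fst_moment k)" by simp
  also have "\<dots> \<le> hardy_kernel_norm2 p"
    unfolding hardy_kernel_norm2_def using hardy_kernel_norm2_sums[OF p] fst_moment_pos
    by (intro sum_le_suminf) (auto simp: sums_iff fst_moment_nonneg)
  finally show ?thesis .
qed

lemma hardy_kernel_diag:
  assumes p: "norm p < 1"
  shows "hardy_kernel p p = of_real (hardy_kernel_norm2 p)"
proof -
  have "(\<lambda>k. of_real (((norm p)\<^sup>2) ^ k / fst_moment k)) sums (of_real (hardy_kernel_norm2 p) :: complex)"
    using hardy_kernel_norm2_sums[OF p] by (rule sums_of_real)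
  moreover have e: "of_real (((norm p)\<^sup>2) ^ k / fst_moment k) = cnj p ^ k / of_real (fst_moment k) * p ^ k" for k
    unfolding of_real_divide of_real_power[of "(norm p)\<^sup>2"] complex_norm_square
    by (simp add: power_mult_distrib)
  ultimately have "(\<lambda>k. cnj p ^ k / of_real (fst_moment k) * p ^ k) sums (of_real (hardy_kernel_norm2 p) :: complex)"
    by (simp only:)
  with hardy_kernel_sums[OF p p] show ?thesis by (rule sums_unique2)
qed

lemma hardy_kernel_sqnorm_le:
  assumes p: "norm p < 1"
  shows "hardy_sqnorm (\<lambda>x. hardy_kernel p (fst x)) \<le> ennreal (hardy_kernel_norm2 p)"
  unfolding hardy_sqnorm_def
proof (rule SUP_least)
  fix r :: real assume "r \<in> {0..<1}"
  then have r: "0 \<le> r" "r < 1" by auto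
  have "(\<integral>\<^sup>+x. ennreal ((norm (hardy_kernel p (fst (r *\<^sub>R x))))\<^sup>2) \<partial>\<sigma>)
      = (\<Sum>k. ennreal ((norm (tcoeff (hardy_kernel p) k))\<^sup>2 * (r ^ k)\<^sup>2) * fst_moment_enn k)"
    by (rule hardy_fst_integral[OF hardy_kernel_holomorphic[OF p] r])
  also have "\<dots> \<le> (\<Sum>k. ennreal (((norm p)\<^sup>2) ^ k / fst_moment k))"
  proof (rule suminf_le)
    fix k
    have "(norm (tcoeff (hardy_kernel p) k))\<^sup>2 * (r ^ k)\<^sup>2 \<le> (norm (tcoeff (hardy_kernel p) k))\<^sup>2 * 1"
      using r by (intro mult_left_mono) (auto simp: power_le_one)
    also have "\<dots> = ((norm p)\<^sup>2) ^ k / (fst_moment k)\<^sup>2"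
      using fst_moment_pos[of k] by (simp add: hardy_kernel_tcoeff[OF p] norm_divide norm_power power_divide power_mult[symmetric] mult.commute)
    finally have "(norm (tcoeff (hardy_kernel p) k))\<^sup>2 * (r ^ k)\<^sup>2 * fst_moment k \<le> ((norm p)\<^sup>2) ^ k / (fst_moment k)\<^sup>2 * fst_moment k"
      using fst_moment_nonneg by (rule mult_right_mono)
    also have "\<dots> = ((norm p)\<^sup>2) ^ k / fst_moment k"
      using fst_moment_pos[of k] by (simp add: power2_eq_square)
    finally show "ennreal ((norm (tcoeff (hardy_kernel p) k))\<^sup>2 * (r ^ k)\<^sup>2) * fst_moment_enn k \<le> ennreal (((norm p)\<^sup>2) ^ k / fst_moment k)"
      unfolding fst_moment_ennreal using fst_moment_nonneg by (subst ennreal_mult[symmetric]) (auto intro: ennreal_leI)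
  qed auto
  also have "\<dots> = ennreal (hardy_kernel_norm2 p)"
    unfolding hardy_kernel_norm2_def using hardy_kernel_norm2_sums[OF p] fst_moment_pos
    by (intro suminf_ennreal2) (auto simp: sums_iff fst_moment_nonneg)
  finally show "(\<integral>\<^sup>+x. ennreal ((norm (hardy_kernel p (fst (r *\<^sub>R x))))\<^sup>2) \<partial>\<sigma>) \<le> ennreal (hardy_kernel_norm2 p)" .
qed

lemma norm_pair_scale_le:
  "norm (a * u, b * v) \<le> max (norm a) (norm b) * norm (u :: complex, v :: complex)"
proof -
  let ?m = "max (norm a) (norm b)"
  have "(norm (a * u))\<^sup>2 + (norm (b * v))\<^sup>2 \<le> (?m * norm u)\<^sup>2 + (?m * norm v)\<^sup>2"
    unfolding norm_mult by (intro add_mono power_mono mult_right_mono) auto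
  also have "\<dots> = (?m * norm (u, v))\<^sup>2"
    by (simp add: norm_Pair power_mult_distrib distrib_left)
  finally show ?thesis
    unfolding norm_Pair[of "a * u"] by (intro real_le_lsqrt) (auto simp: le_max_iff_disj)
qed

text \<open>Needed for the mean value property under the rotation of the second coordinate.\<close>

lemma holomorphic2_section:
  assumes g: "holomorphic2_on g (ball 0 1)" and r: "norm a < 1" and x: "norm x \<le> 1"
  shows "(\<lambda>l. g (a * fst x, l * snd x)) holomorphic_on ball 0 1"
proof (rule holomorphic_onI)
  fix l :: complex assume l: "l \<in> ball 0 1"
  have "norm (a * fst x, l * snd x) \<le> max (norm a) (norm l) * norm x"
    using norm_pair_scale_le[of a "fst x" l "snd x"] by simp
  also have "\<dots> \<le> max (norm a) (norm l) * 1" using x by (intro mult_left_mono) (auto simp: le_max_iff_disj)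
  also have "\<dots> < 1" using l r by simp
  finally have "(a * fst x, l * snd x) \<in> ball 0 1" by simp
  then obtain c d where cd: "(g has_derivative (\<lambda>(u, v). c * u + d * v)) (at (a * fst x, l * snd x))"
    using g unfolding holomorphic2_on_def by blast
  have "((\<lambda>l. (a * fst x, l * snd x)) has_derivative (\<lambda>h. (0, h * snd x))) (at l)"
    by (auto intro!: derivative_eq_intros)
  from diff_chain_at[OF this cd]
  have "((\<lambda>l. g (a * fst x, l * snd x)) has_derivative (\<lambda>h. (d * snd x) * h)) (at l)"
    by (simp add: o_def algebra_simps)
  then have "((\<lambda>l. g (a * fst x, l * snd x)) has_field_derivative (d * snd x)) (at l)"
    by (simp add: has_field_derivative_def)
  then show "(\<lambda>l. g (a * fst x, l * snd x)) field_differentiable at l within ball 0 1"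
    by (meson field_differentiable_at_within field_differentiable_def)
qed

lemma holomorphic_first_axis:
  assumes "holomorphic2_on g (ball 0 1)"
  shows "(\<lambda>z. g (z, 0)) holomorphic_on ball 0 1"
  using holomorphic2_slice[OF assms, of "(1, 0)"] by (simp add: cscale_def norm_Pair)

text \<open>A function of \<open>z\<close> alone is invariant under rotations of \<open>w\<close>, and averaging \<open>g\<close> over these
  leaves \<open>g(z, 0)\<close>. What remains is the inner product of two power series in \<open>z\<close>, with
  orthogonal monomials.\<close>

lemma sphere_inner_fst:
  assumes g: "holomorphic2_on g (ball 0 1)" and \<kappa>: "\<kappa> holomorphic_on ball 0 1" and r: "0 \<le> r" "r < 1"
  shows "(\<integral>x. g (r *\<^sub>R x) * cnj (\<kappa> (fst (r *\<^sub>R x))) \<partial>\<sigma>)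
     = (\<Sum>k. tcoeff (\<lambda>z. g (z, 0)) k * cnj (tcoeff \<kappa> k) * of_real ((r\<^sup>2) ^ k * fst_moment k))"
proof -
  let ?\<phi> = "\<lambda>z. g (z, 0)"
  have \<phi>: "?\<phi> holomorphic_on ball 0 1" by (rule holomorphic_first_axis[OF g])
  let ?g0 = "\<lambda>p. ?\<phi> (fst p)"
  let ?\<kappa>2 = "\<lambda>p::complex \<times> complex. \<kappa> (fst p)"
  have g0: "holomorphic2_on ?g0 (ball 0 1)" by (rule holomorphic2_fst[OF \<phi>])
  have \<kappa>2: "holomorphic2_on ?\<kappa>2 (ball 0 1)" by (rule holomorphic2_fst[OF \<kappa>])
  have mg: "(\<lambda>x. h (r *\<^sub>R x) * cnj (?\<kappa>2 (r *\<^sub>R x))) \<in> borel_measurable \<sigma>"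
    if h: "holomorphic2_on h (ball 0 1)" for h
    by (intro measurable_sphere_continuous continuous_on_mult continuous_on_cnj
        continuous_on_dilate[OF holomorphic2_continuous_on[OF h] r]
        continuous_on_dilate[OF holomorphic2_continuous_on[OF \<kappa>2] r])
  have bnd: "\<exists>B. \<forall>x\<in>space \<sigma>. norm (h (r *\<^sub>R x)) \<le> B" if h: "holomorphic2_on h (ball 0 1)" for h
  proof -
    obtain B where "0 < B" "\<And>p. norm p \<le> 1 \<Longrightarrow> norm (h (r *\<^sub>R p)) \<le> B"
      using dilate_bounded[OF h r] by blast
    then show ?thesis by (intro exI[of _ B]) (simp add: space_sphere_measure)
  qed
  obtain B1 where B1: "\<And>x. x \<in> space \<sigma> \<Longrightarrow> norm (g (r *\<^sub>R x)) \<le> B1" using bnd[OF g] by blast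
  obtain B0 where B0: "\<And>x. x \<in> space \<sigma> \<Longrightarrow> norm (?g0 (r *\<^sub>R x)) \<le> B0" using bnd[OF g0] by blast
  obtain B2 where B2: "\<And>x. x \<in> space \<sigma> \<Longrightarrow> norm (?\<kappa>2 (r *\<^sub>R x)) \<le> B2" using bnd[OF \<kappa>2] by blast
  have nx: "norm x = 1" if "x \<in> space \<sigma>" for x :: "complex \<times> complex"
    using that by (simp add: space_sphere_measure)
  have nf: "norm (of_real r * fst x) < 1" if "x \<in> space \<sigma>" for x :: "complex \<times> complex"
  proof -
    have "norm (fst x) \<le> 1" using nx[OF that] norm_fst_le_norm[of x] by simp
    then show ?thesis using r mult_left_mono[of "norm (fst x)" 1 r] by (simp add: norm_mult)
  qed
  \<comment> \<open>rotating the second coordinate replaces it by zero\<close>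
  have "(\<integral>x. g (r *\<^sub>R x) * cnj (?\<kappa>2 (r *\<^sub>R x)) \<partial>\<sigma>)
      = (\<integral>x. \<integral>t. g (r *\<^sub>R snd_rotation t x) * cnj (?\<kappa>2 (r *\<^sub>R snd_rotation t x)) \<partial>angle \<partial>\<sigma>)"
  proof (rule integral_circle_average[OF circle_action_snd_rotation, where B = "B1 * B2"])
    show "norm (g (r *\<^sub>R x) * cnj (?\<kappa>2 (r *\<^sub>R x))) \<le> B1 * B2" if "x \<in> space \<sigma>" for x
      unfolding norm_mult complex_mod_cnj using B1[OF that] B2[OF that]
      by (intro mult_mono) (auto intro: order_trans[OF norm_ge_zero])
  qed (rule mg[OF g], rule sig.finite_measure_axioms)
  also have "\<dots> = (\<integral>x. ?g0 (r *\<^sub>R x) * cnj (?\<kappa>2 (r *\<^sub>R x)) \<partial>\<sigma>)"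
  proof (intro Bochner_Integration.integral_cong refl)
    fix x :: "complex \<times> complex" assume x: "x \<in> space \<sigma>"
    have hol: "(\<lambda>l. g (of_real r * fst x, l * snd x)) holomorphic_on ball 0 1"
      using r nx[OF x] by (intro holomorphic2_section[OF g]) auto
    have "(\<integral>t. g (r *\<^sub>R snd_rotation t x) * cnj (?\<kappa>2 (r *\<^sub>R snd_rotation t x)) \<partial>angle)
        = (\<integral>t. g (of_real r * fst x, (of_real r * cis t) * snd x) * cnj (\<kappa> (of_real r * fst x)) \<partial>angle)"
      by (simp add: snd_rotation_def scaleR_conv_of_real mult.assoc)
    also have "\<dots> = (\<integral>t. g (of_real r * fst x, (of_real r * cis t) * snd x) \<partial>angle) * cnj (\<kappa> (of_real r * fst x))"
      by simp
    also have "(\<integral>t. g (of_real r * fst x, (of_real r * cis t) * snd x) \<partial>angle) = g (of_real r * fst x, 0 * snd x)"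
      using r by (intro circle_mean_value[OF hol]) auto
    finally show "(\<integral>t. g (r *\<^sub>R snd_rotation t x) * cnj (?\<kappa>2 (r *\<^sub>R snd_rotation t x)) \<partial>angle)
        = ?g0 (r *\<^sub>R x) * cnj (?\<kappa>2 (r *\<^sub>R x))"
      by (simp add: scaleR_conv_of_real)
  qed
  \<comment> \<open>rotating both coordinates isolates the diagonal terms\<close>
  also have "\<dots> = (\<integral>x. \<integral>t. ?g0 (r *\<^sub>R cscale (cis t) x) * cnj (?\<kappa>2 (r *\<^sub>R cscale (cis t) x)) \<partial>angle \<partial>\<sigma>)"
  proof (rule integral_circle_average[OF circle_action_cscale, where B = "B0 * B2"])
    show "norm (?g0 (r *\<^sub>R x) * cnj (?\<kappa>2 (r *\<^sub>R x))) \<le> B0 * B2" if "x \<in> space \<sigma>" for x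
      unfolding norm_mult complex_mod_cnj using B0[OF that] B2[OF that]
      by (intro mult_mono) (auto intro: order_trans[OF norm_ge_zero])
  qed (rule mg[OF g0], rule sig.finite_measure_axioms)
  also have "\<dots> = (\<integral>x. (\<Sum>k. tcoeff ?\<phi> k * cnj (tcoeff \<kappa> k) * of_real ((r\<^sup>2) ^ k * (norm (fst x ^ k))\<^sup>2)) \<partial>\<sigma>)"
  proof (intro Bochner_Integration.integral_cong refl)
    fix x :: "complex \<times> complex" assume x: "x \<in> space \<sigma>"
    note c1 = circle_series[OF \<phi> nf[OF x]] and c2 = circle_series[OF \<kappa> nf[OF x]]
    have "(\<integral>t. ?g0 (r *\<^sub>R cscale (cis t) x) * cnj (?\<kappa>2 (r *\<^sub>R cscale (cis t) x)) \<partial>angle)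
        = (\<integral>t. ?\<phi> (of_real r * fst x * cis t) * cnj (\<kappa> (of_real r * fst x * cis t)) \<partial>angle)"
      by (simp add: cscale_def scaleR_conv_of_real mult_ac)
    also have "\<dots> = (\<Sum>k. tcoeff ?\<phi> k * (of_real r * fst x) ^ k * cnj (tcoeff \<kappa> k * (of_real r * fst x) ^ k))"
      unfolding c1(2) c2(2) by (rule parseval_polarized[OF c1(1) c2(1)])
    also have "\<dots> = (\<Sum>k. tcoeff ?\<phi> k * cnj (tcoeff \<kappa> k) * of_real ((r\<^sup>2) ^ k * (norm (fst x ^ k))\<^sup>2))"
    proof (rule suminf_cong)
      fix k
      have "of_real ((r\<^sup>2) ^ k * (norm (fst x ^ k))\<^sup>2) = (of_real r * fst x) ^ k * cnj ((of_real r * fst x) ^ k)"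
        unfolding of_real_mult complex_norm_square by (simp add: power_mult_distrib power2_eq_square)
      then show "tcoeff ?\<phi> k * (of_real r * fst x) ^ k * cnj (tcoeff \<kappa> k * (of_real r * fst x) ^ k)
          = tcoeff ?\<phi> k * cnj (tcoeff \<kappa> k) * of_real ((r\<^sup>2) ^ k * (norm (fst x ^ k))\<^sup>2)"
        by simp
    qed
    finally show "(\<integral>t. ?g0 (r *\<^sub>R cscale (cis t) x) * cnj (?\<kappa>2 (r *\<^sub>R cscale (cis t) x)) \<partial>angle)
        = (\<Sum>k. tcoeff ?\<phi> k * cnj (tcoeff \<kappa> k) * of_real ((r\<^sup>2) ^ k * (norm (fst x ^ k))\<^sup>2))" .
  qed
  also have "\<dots> = (\<Sum>k. \<integral>x. tcoeff ?\<phi> k * cnj (tcoeff \<kappa> k) * of_real ((r\<^sup>2) ^ k * (norm (fst x ^ k))\<^sup>2) \<partial>\<sigma>)"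
  proof (rule integral_suminf)
    let ?M = "\<lambda>k. norm (tcoeff ?\<phi> k) * norm (tcoeff \<kappa> k) * (r\<^sup>2) ^ k"
    have fm: "(\<lambda>x. (norm (fst x ^ k))\<^sup>2) \<in> borel_measurable \<sigma>" for k
      by (rule measurable_sphere_continuous) (intro continuous_intros)
    have le1: "(norm (fst x ^ k))\<^sup>2 \<le> 1" if "x \<in> space \<sigma>" for x :: "complex \<times> complex" and k
      using nx[OF that] norm_fst_le_norm[of x] by (simp add: norm_power power_le_one)
    have nle: "norm (tcoeff ?\<phi> k * cnj (tcoeff \<kappa> k) * of_real ((r\<^sup>2) ^ k * (norm (fst x ^ k))\<^sup>2)) \<le> ?M k"
      if "x \<in> space \<sigma>" for x :: "complex \<times> complex" and k
    proof -
      have "?M k * (norm (fst x ^ k))\<^sup>2 \<le> ?M k * 1" by (intro mult_left_mono le1 that) auto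
      then show ?thesis by (simp add: norm_mult norm_power mult_ac)
    qed
    have Ms: "summable ?M"
    proof -
      have r': "norm (complex_of_real r) < 1" using r by simp
      have s1: "summable (\<lambda>k. norm (tcoeff ?\<phi> k * of_real r ^ k))" by (rule tcoeff_summable[OF \<phi> r'])
      have s2: "summable (\<lambda>k. norm (tcoeff \<kappa> k * of_real r ^ k))" by (rule tcoeff_summable[OF \<kappa> r'])
      have ev: "eventually (\<lambda>k. norm (tcoeff \<kappa> k * of_real r ^ k) < 1) sequentially"
        using summable_LIMSEQ_zero[OF s2] by (rule order_tendstoD) simp
      show ?thesis
      proof (rule summable_comparison_test_ev[OF _ s1], use ev in eventually_elim)
        case (elim k)
        have "?M k = norm (tcoeff ?\<phi> k * of_real r ^ k) * norm (tcoeff \<kappa> k * of_real r ^ k)"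
          using r by (simp add: norm_mult norm_power power2_eq_square power_mult_distrib)
        moreover have "\<dots> \<le> norm (tcoeff ?\<phi> k * of_real r ^ k)"
          using elim by (intro mult_left_le) auto
        ultimately show ?case by simp
      qed
    qed
    show int: "integrable \<sigma> (\<lambda>x. tcoeff ?\<phi> k * cnj (tcoeff \<kappa> k) * of_real ((r\<^sup>2) ^ k * (norm (fst x ^ k))\<^sup>2))" for k
    proof (rule sig.integrable_const_bound[where B = "?M k"])
      show "AE x in \<sigma>. norm (tcoeff ?\<phi> k * cnj (tcoeff \<kappa> k) * of_real ((r\<^sup>2) ^ k * (norm (fst x ^ k))\<^sup>2)) \<le> ?M k"
        using nle by (intro AE_I2)
      show "(\<lambda>x. tcoeff ?\<phi> k * cnj (tcoeff \<kappa> k) * of_real ((r\<^sup>2) ^ k * (norm (fst x ^ k))\<^sup>2)) \<in> borel_measurable \<sigma>"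
        by (rule measurable_sphere_continuous) (intro continuous_intros)
    qed
    show "AE x in \<sigma>. summable (\<lambda>k. norm (tcoeff ?\<phi> k * cnj (tcoeff \<kappa> k) * of_real ((r\<^sup>2) ^ k * (norm (fst x ^ k))\<^sup>2)))"
      by (intro AE_I2 summable_comparison_test'[OF Ms]) (use nle in auto)
    have "(\<integral>x. norm (tcoeff ?\<phi> k * cnj (tcoeff \<kappa> k) * of_real ((r\<^sup>2) ^ k * (norm (fst x ^ k))\<^sup>2)) \<partial>\<sigma>) \<le> ?M k" for k
      by (intro sig.integral_le_const integrable_norm int AE_I2 nle)
    then show "summable (\<lambda>k. \<integral>x. norm (tcoeff ?\<phi> k * cnj (tcoeff \<kappa> k) * of_real ((r\<^sup>2) ^ k * (norm (fst x ^ k))\<^sup>2)) \<partial>\<sigma>)"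
      by (intro summable_comparison_test'[OF Ms]) auto
  qed
  also have "\<dots> = (\<Sum>k. tcoeff ?\<phi> k * cnj (tcoeff \<kappa> k) * of_real ((r\<^sup>2) ^ k * fst_moment k))"
  proof (rule suminf_cong)
    fix k
    have fm: "(\<lambda>x. (norm (fst x ^ k))\<^sup>2) \<in> borel_measurable \<sigma>"
      by (rule measurable_sphere_continuous) (intro continuous_intros)
    have "(\<integral>x. (norm (fst x ^ k))\<^sup>2 \<partial>\<sigma>) = enn2real (fst_moment_enn k)"
      unfolding fst_moment_enn_def using fm by (intro integral_eq_nn_integral) auto
    then have m: "(\<integral>x. (norm (fst x ^ k))\<^sup>2 \<partial>\<sigma>) = fst_moment k" by (simp add: fst_moment_def)
    have "(\<integral>x. tcoeff ?\<phi> k * cnj (tcoeff \<kappa> k) * of_real ((r\<^sup>2) ^ k * (norm (fst x ^ k))\<^sup>2) \<partial>\<sigma>)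
        = tcoeff ?\<phi> k * cnj (tcoeff \<kappa> k) * (\<integral>x. of_real ((r\<^sup>2) ^ k * (norm (fst x ^ k))\<^sup>2) \<partial>\<sigma>)"
      by (rule integral_mult_right_zero)
    also have "(\<integral>x. complex_of_real ((r\<^sup>2) ^ k * (norm (fst x ^ k))\<^sup>2) \<partial>\<sigma>) = of_real (\<integral>x. (r\<^sup>2) ^ k * (norm (fst x ^ k))\<^sup>2 \<partial>\<sigma>)"
      by (rule integral_complex_of_real)
    also have "(\<integral>x. (r\<^sup>2) ^ k * (norm (fst x ^ k))\<^sup>2 \<partial>\<sigma>) = (r\<^sup>2) ^ k * fst_moment k"
      unfolding m[symmetric] by (rule integral_mult_right_zero)
    finally show "(\<integral>x. tcoeff ?\<phi> k * cnj (tcoeff \<kappa> k) * of_real ((r\<^sup>2) ^ k * (norm (fst x ^ k))\<^sup>2) \<partial>\<sigma>)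
        = tcoeff ?\<phi> k * cnj (tcoeff \<kappa> k) * of_real ((r\<^sup>2) ^ k * fst_moment k)" .
  qed
  finally show ?thesis .
qed

text \<open>The reproducing property. At radius \<open>r\<close> the inner product is the value of \<open>g\<close> at
  \<open>(r ^ 2 * p, 0)\<close>, because the coefficients of the kernel cancel the moments.\<close>

lemma hardy_inner_kernel:
  assumes g: "holomorphic2_on g (ball 0 1)" and p: "norm p < 1"
  shows "hardy_inner g (\<lambda>x. \<beta> * hardy_kernel p (fst x)) = cnj \<beta> * g (p, 0)"
proof -
  let ?\<phi> = "\<lambda>z. g (z, 0)"
  have \<phi>: "?\<phi> holomorphic_on ball 0 1" by (rule holomorphic_first_axis[OF g])
  have eq: "(\<integral>x. g (r *\<^sub>R x) * cnj (\<beta> * hardy_kernel p (fst (r *\<^sub>R x))) \<partial>\<sigma>) = cnj \<beta> * ?\<phi> (of_real (r\<^sup>2) * p)"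
    if r: "0 < r" "r < 1" for r
  proof -
    have r': "0 \<le> r" using r by simp
    have "(\<integral>x. g (r *\<^sub>R x) * cnj (\<beta> * hardy_kernel p (fst (r *\<^sub>R x))) \<partial>\<sigma>)
        = (\<integral>x. cnj \<beta> * (g (r *\<^sub>R x) * cnj (hardy_kernel p (fst (r *\<^sub>R x)))) \<partial>\<sigma>)"
      by (intro Bochner_Integration.integral_cong refl) (simp add: mult_ac)
    also have "\<dots> = cnj \<beta> * (\<integral>x. g (r *\<^sub>R x) * cnj (hardy_kernel p (fst (r *\<^sub>R x))) \<partial>\<sigma>)"
      by (rule integral_mult_right_zero)
    also have "(\<integral>x. g (r *\<^sub>R x) * cnj (hardy_kernel p (fst (r *\<^sub>R x))) \<partial>\<sigma>)
        = (\<Sum>k. tcoeff ?\<phi> k * cnj (tcoeff (hardy_kernel p) k) * of_real ((r\<^sup>2) ^ k * fst_moment k))"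
      by (rule sphere_inner_fst[OF g hardy_kernel_holomorphic[OF p] r' r(2)])
    also have "\<dots> = (\<Sum>k. tcoeff ?\<phi> k * (of_real (r\<^sup>2) * p) ^ k)"
    proof (rule suminf_cong)
      fix k
      show "tcoeff ?\<phi> k * cnj (tcoeff (hardy_kernel p) k) * of_real ((r\<^sup>2) ^ k * fst_moment k) = tcoeff ?\<phi> k * (of_real (r\<^sup>2) * p) ^ k"
        using fst_moment_pos[of k] by (simp add: hardy_kernel_tcoeff[OF p] power_mult_distrib)
    qed
    also have "\<dots> = ?\<phi> (of_real (r\<^sup>2) * p)"
    proof (rule sums_unique[symmetric], rule tcoeff_sums[OF \<phi>])
      have "r\<^sup>2 * norm p \<le> 1 * norm p" using r by (intro mult_right_mono) (auto simp: power_le_one)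
      then show "norm (of_real (r\<^sup>2) * p) < 1" using p by (simp add: norm_mult norm_power)
    qed
    finally show ?thesis .
  qed
  have "continuous_on (ball 0 1) ?\<phi>" by (rule holomorphic_on_imp_continuous_on[OF \<phi>])
  then have cont: "isCont ?\<phi> p" using p by (simp add: continuous_on_eq_continuous_at)
  have "((\<lambda>r. of_real (r\<^sup>2) * p) \<longlongrightarrow> of_real (1\<^sup>2) * p) (at_left (1::real))"
    by (intro tendsto_intros)
  then have "((\<lambda>r. of_real (r\<^sup>2) * p) \<longlongrightarrow> p) (at_left (1::real))" by simp
  from isCont_tendsto_compose[OF cont this]
  have "((\<lambda>r. cnj \<beta> * ?\<phi> (of_real (r\<^sup>2) * p)) \<longlongrightarrow> cnj \<beta> * ?\<phi> p) (at_left (1::real))"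
    by (rule tendsto_mult_left)
  moreover have "eventually (\<lambda>r. cnj \<beta> * ?\<phi> (of_real (r\<^sup>2) * p)
      = (\<integral>x. g (r *\<^sub>R x) * cnj (\<beta> * hardy_kernel p (fst (r *\<^sub>R x))) \<partial>\<sigma>)) (at_left (1::real))"
    by (rule eventually_mono[OF eventually_at_left_real[of 0 1]]) (simp_all only: eq greaterThanLessThan_iff zero_less_one)
  ultimately have "((\<lambda>r. \<integral>x. g (r *\<^sub>R x) * cnj (\<beta> * hardy_kernel p (fst (r *\<^sub>R x))) \<partial>\<sigma>) \<longlongrightarrow> cnj \<beta> * ?\<phi> p) (at_left (1::real))"
    by (rule Lim_transform_eventually)
  then show ?thesis unfolding hardy_inner_def by (intro tendsto_Lim) auto
qed

section \<open>Weak-star convergence on the first axis\<close>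

text \<open>Test against the trace class operator \<open>\<Sum>l. w l * (e l \<otimes> e l)\<close>, where \<open>e l\<close> is the normalized
  kernel at \<open>(p l, 0)\<close>: multiplication by a function pairs with \<open>e l \<otimes> e l\<close> to its value at
  \<open>(p l, 0)\<close>. The weight is split into two square roots, the first of which carries the
  sign.\<close>

lemma weak_star_tendsto_points:
  assumes conv: "weak_star_tendsto \<Phi> \<phi>"
    and hol: "\<And>n. holomorphic2_on (\<Phi> n) (ball 0 1)" "holomorphic2_on \<phi> (ball 0 1)"
    and p: "\<And>l. norm (p l) < 1" and w: "summable (\<lambda>l. \<bar>w l\<bar>)"
  shows "(\<lambda>n. \<Sum>l. of_real (w l) * \<Phi> n (p l, 0)) \<longlonglongrightarrow> (\<Sum>l. of_real (w l) * \<phi> (p l, 0))"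
proof -
  define G where "G l = hardy_kernel_norm2 (p l)" for l
  have G: "0 < G l" for l unfolding G_def by (rule hardy_kernel_norm2_pos[OF p])
  define b where "b l = sqrt (\<bar>w l\<bar> / G l)" for l
  define a where "a l = sgn (w l) * b l" for l
  have bb: "b l * b l = \<bar>w l\<bar> / G l" for l
    using G[of l] by (simp add: b_def)
  have aa: "\<bar>a l\<bar> \<le> \<bar>b l\<bar>" for l by (simp add: a_def abs_mult abs_sgn_eq)
  define x where "x l = (\<lambda>q::complex \<times> complex. of_real (a l) * hardy_kernel (p l) (fst q))" for l
  define y where "y l = (\<lambda>q::complex \<times> complex. of_real (b l) * hardy_kernel (p l) (fst q))" for l
  have khol: "holomorphic2_on (\<lambda>q. hardy_kernel (p l) (fst q)) (ball 0 1)" for l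
    by (rule holomorphic2_fst[OF hardy_kernel_holomorphic[OF p]])
  have mem: "(\<lambda>q. of_real c * hardy_kernel (p l) (fst q)) \<in> hardy_space \<and>
      (hardy_norm (\<lambda>q. of_real c * hardy_kernel (p l) (fst q)))\<^sup>2 \<le> \<bar>w l\<bar>" if c: "\<bar>c\<bar> \<le> \<bar>b l\<bar>" for c l
  proof -
    let ?k = "\<lambda>q. of_real c * hardy_kernel (p l) (fst q)"
    have "hardy_sqnorm ?k \<le> ennreal (\<bar>c\<bar>\<^sup>2) * hardy_sqnorm (\<lambda>q. hardy_kernel (p l) (fst q))"
      by (rule hardy_sqnorm_mult_le[OF khol]) simp
    also have "\<dots> \<le> ennreal (\<bar>c\<bar>\<^sup>2) * ennreal (G l)"
      unfolding G_def by (intro mult_left_mono hardy_kernel_sqnorm_le p) simp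
    also have "\<dots> = ennreal (\<bar>c\<bar>\<^sup>2 * G l)" using G[of l] by (simp add: ennreal_mult)
    also have "\<dots> \<le> ennreal \<bar>w l\<bar>"
    proof (rule ennreal_leI)
      have "\<bar>c\<bar>\<^sup>2 \<le> \<bar>b l\<bar>\<^sup>2" using c by (intro power_mono) auto
      also have "\<dots> = \<bar>w l\<bar> / G l" using bb[of l] by (simp add: power2_eq_square)
      finally show "\<bar>c\<bar>\<^sup>2 * G l \<le> \<bar>w l\<bar>" using G[of l] by (simp add: pos_le_divide_eq)
    qed
    finally have le: "hardy_sqnorm ?k \<le> ennreal \<bar>w l\<bar>" .
    then have "hardy_sqnorm ?k < \<infinity>" by (rule le_less_trans) simp
    moreover have "holomorphic2_on ?k (ball 0 1)" by (intro holomorphic2_mult holomorphic2_const khol)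
    moreover have "(hardy_norm ?k)\<^sup>2 \<le> \<bar>w l\<bar>"
      using enn2real_mono[OF le] by (simp add: hardy_norm_def)
    ultimately show ?thesis by (simp add: hardy_space_def)
  qed
  have x: "x l \<in> hardy_space" "(hardy_norm (x l))\<^sup>2 \<le> \<bar>w l\<bar>" for l
    using mem[OF aa] by (simp_all add: x_def)
  have y: "y l \<in> hardy_space" "(hardy_norm (y l))\<^sup>2 \<le> \<bar>w l\<bar>" for l
    using mem[of "b l" l] by (simp_all add: y_def)
  have "summable (\<lambda>l. (hardy_norm (x l))\<^sup>2)" "summable (\<lambda>l. (hardy_norm (y l))\<^sup>2)"
    using x(2) y(2) by (auto intro: summable_comparison_test'[OF w])
  then have lim: "(\<lambda>n. trace_pairing (\<Phi> n) x y) \<longlonglongrightarrow> trace_pairing \<phi> x y"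
    using conv x(1) y(1) unfolding weak_star_tendsto_def by blast
  have tp: "trace_pairing \<psi> x y = (\<Sum>l. of_real (w l) * \<psi> (p l, 0))" if \<psi>: "holomorphic2_on \<psi> (ball 0 1)" for \<psi>
    unfolding trace_pairing_def
  proof (rule suminf_cong)
    fix l
    have "holomorphic2_on (\<lambda>q. \<psi> q * x l q) (ball 0 1)"
      unfolding x_def by (intro holomorphic2_mult holomorphic2_const khol \<psi>)
    then have "hardy_inner (\<lambda>q. \<psi> q * x l q) (y l) = cnj (of_real (b l)) * (\<psi> (p l, 0) * x l (p l, 0))"
      unfolding y_def by (rule hardy_inner_kernel[OF _ p])
    also have "\<dots> = of_real (b l * a l * G l) * \<psi> (p l, 0)"
      using hardy_kernel_diag[OF p, of l] by (simp add: x_def G_def)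
    also have "b l * a l * G l = w l"
    proof -
      have "b l * a l * G l = sgn (w l) * (b l * b l) * G l" by (simp add: a_def)
      also have "\<dots> = sgn (w l) * \<bar>w l\<bar>" using G[of l] unfolding bb by simp
      finally show ?thesis by (simp add: mult.commute[of "sgn _"] abs_mult_sgn)
    qed
    finally show "hardy_inner (\<lambda>q. \<psi> q * x l q) (y l) = of_real (w l) * \<psi> (p l, 0)" .
  qed
  show ?thesis using lim by (simp add: tp hol)
qed

lemma weak_star_tendsto_bounded:
  assumes conv: "weak_star_tendsto \<Phi> \<phi>" and \<Phi>: "\<And>n. \<Phi> n \<in> H_inf" and \<phi>: "\<phi> \<in> H_inf"
  obtains C where "\<And>n z. norm z < 1 \<Longrightarrow> norm (\<Phi> n (z, 0)) \<le> C"
proof -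
  have hol: "\<And>n. holomorphic2_on (\<Phi> n) (ball 0 1)" "holomorphic2_on \<phi> (ball 0 1)"
    using \<Phi> \<phi> by (auto simp: H_inf_def)
  have "\<exists>C. \<forall>n. \<forall>z\<in>ball 0 1. norm (\<Phi> n (z, 0)) \<le> C"
  proof (rule uniform_boundedness_l1)
    show "ball (0::complex) 1 \<noteq> {}" by simp
    fix n
    obtain B where B: "\<forall>y\<in>\<Phi> n ` ball 0 1. norm y \<le> B"
      using \<Phi>[of n] unfolding H_inf_def bounded_iff by blast
    have "norm (\<Phi> n (z, 0)) \<le> B" if "z \<in> ball 0 1" for z
      by (rule B[rule_format], rule imageI) (use that in \<open>simp add: norm_Pair\<close>)
    then show "\<exists>B. \<forall>z\<in>ball 0 1. norm (\<Phi> n (z, 0)) \<le> B" by blast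
  next
    fix e :: "nat \<Rightarrow> real" and p :: "nat \<Rightarrow> complex"
    assume e: "\<And>l. norm (e l) = 1" and p: "\<And>l. p l \<in> ball 0 1"
    have "summable (\<lambda>l. \<bar>e l * (1/3) ^ l\<bar>)"
      using e by (simp add: abs_mult power_abs summable_geometric)
    then have "(\<lambda>n. \<Sum>l. of_real (e l * (1/3) ^ l) * \<Phi> n (p l, 0))
        \<longlonglongrightarrow> (\<Sum>l. of_real (e l * (1/3) ^ l) * \<phi> (p l, 0))"
      using p by (intro weak_star_tendsto_points[OF conv hol]) auto
    then have "Bseq (\<lambda>n. \<Sum>l. of_real (e l * (1/3) ^ l) * \<Phi> n (p l, 0))"
      by (intro convergent_imp_Bseq convergentI)
    then show "\<exists>B. \<forall>n. norm (\<Sum>l. of_real (e l * (1/3) ^ l) * \<Phi> n (p l, 0)) \<le> B"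
      unfolding Bseq_def by blast
  qed
  then obtain C where "\<forall>n. \<forall>z\<in>ball 0 1. norm (\<Phi> n (z, 0)) \<le> C" by blast
  then show ?thesis using that[of C] by simp
qed

lemma weak_star_tendsto_pointwise:
  assumes conv: "weak_star_tendsto \<Phi> \<phi>" and \<Phi>: "\<And>n. \<Phi> n \<in> H_inf" and \<phi>: "\<phi> \<in> H_inf"
    and z: "norm z < 1"
  shows "(\<lambda>n. \<Phi> n (z, 0)) \<longlonglongrightarrow> \<phi> (z, 0)"
proof -
  have hol: "\<And>n. holomorphic2_on (\<Phi> n) (ball 0 1)" "holomorphic2_on \<phi> (ball 0 1)"
    using \<Phi> \<phi> by (auto simp: H_inf_def)
  let ?w = "\<lambda>l. if l = 0 then 1 else 0 :: real"
  have "summable (\<lambda>l. \<bar>?w l\<bar>)"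
    by (rule summable_finite[of "{0}"]) auto
  then have "(\<lambda>n. \<Sum>l. of_real (?w l) * \<Phi> n (z, 0)) \<longlonglongrightarrow> (\<Sum>l. of_real (?w l) * \<phi> (z, 0))"
    using z by (intro weak_star_tendsto_points[OF conv hol]) auto
  moreover have "(\<Sum>l. of_real (?w l) * c) = c" for c :: complex
  proof -
    have e: "(\<lambda>l. of_real (?w l) * c) = (\<lambda>l. if l = 0 then c else 0)" by auto
    show ?thesis unfolding e using sums_unique[OF sums_single[of 0 "\<lambda>_. c"]] by (rule sym)
  qed
  ultimately show ?thesis by simp
qed

section \<open>Division by a singular inner function\<close>

lemma circle_mean_sq:
  assumes F: "F holomorphic_on ball 0 1" and r: "0 \<le> r" "r < 1"
  shows "(\<integral>\<^sup>+t. ennreal ((norm (F (of_real r * cis t)))\<^sup>2) \<partial>angle)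
    = (\<Sum>k. ennreal ((norm (tcoeff F k))\<^sup>2 * (r ^ k)\<^sup>2))"
proof -
  have r': "norm (complex_of_real r) < 1" using r by simp
  have "(\<integral>\<^sup>+t. ennreal ((norm (F (of_real r * cis t)))\<^sup>2) \<partial>angle)
      = (\<Sum>k. ennreal ((norm (tcoeff F k * of_real r ^ k))\<^sup>2))"
    unfolding circle_series(2)[OF F r'] by (rule parseval[OF circle_series(1)[OF F r']])
  then show ?thesis using r by (simp add: norm_mult norm_power power_mult_distrib)
qed

lemma circle_mean_sq_mono:
  assumes F: "F holomorphic_on ball 0 1" and r: "0 \<le> r" "r \<le> s" "s < 1"
  shows "(\<integral>\<^sup>+t. ennreal ((norm (F (of_real r * cis t)))\<^sup>2) \<partial>angle)
    \<le> (\<integral>\<^sup>+t. ennreal ((norm (F (of_real s * cis t)))\<^sup>2) \<partial>angle)"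
proof -
  have "(\<Sum>k. ennreal ((norm (tcoeff F k))\<^sup>2 * (r ^ k)\<^sup>2)) \<le> (\<Sum>k. ennreal ((norm (tcoeff F k))\<^sup>2 * (s ^ k)\<^sup>2))"
    using r by (intro suminf_le ennreal_leI mult_left_mono power_mono) auto
  then show ?thesis using r by (simp add: circle_mean_sq[OF F])
qed

lemma continuous_circle_measurable:
  assumes F: "continuous_on (ball 0 1) F" and r: "0 \<le> r" "r < 1"
  shows "(\<lambda>t. F (of_real r * cis t)) \<in> borel_measurable borel"
proof (rule borel_measurable_continuous_onI, rule continuous_on_compose2[OF F])
  show "continuous_on UNIV (\<lambda>t. of_real r * cis t)" by (intro continuous_intros)
qed (use r in \<open>auto simp: norm_mult\<close>)

lemma radii_to_one:
  obtains s :: "nat \<Rightarrow> real" where "\<And>n. 0 \<le> s n" "\<And>n. s n < 1" "s \<longlonglongrightarrow> 1"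
proof -
  have "(\<lambda>n. 1 - 1 / real (n + 2)) \<longlonglongrightarrow> 1 - 0"
    by (intro tendsto_diff tendsto_const LIMSEQ_ignore_initial_segment[OF lim_1_over_n])
  then show ?thesis
    by (intro that[of "\<lambda>n. 1 - 1 / real (n + 2)"]) (auto simp: divide_simps)
qed

text \<open>On a circle of radius close to \<open>1\<close>, \<open>norm F ^ 2\<close> is \<open>norm (F S) ^ 2\<close> plus
  \<open>norm F ^ 2 * (1 - norm S ^ 2)\<close>. The mean of the last term tends to \<open>0\<close> since \<open>F\<close> is bounded,
  and the means of \<open>norm F ^ 2\<close> increase with the radius. The conclusion is uniform
  over all bounded \<open>F\<close>, whatever their bounds \<open>B\<close>.\<close>

lemma (in singular_circle_measure) quotient_mean_le:
  assumes F: "F holomorphic_on ball 0 1" and B: "\<And>z. norm z < 1 \<Longrightarrow> norm (F z) \<le> B"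
    and S: "continuous_on (ball 0 1) S" "\<And>z. norm z < 1 \<Longrightarrow> norm (S z) = exp (- poisson z)"
    and C: "\<And>z. norm z < 1 \<Longrightarrow> norm (F z * S z) \<le> C"
    and r: "0 \<le> r" "r < 1"
  shows "(\<integral>\<^sup>+t. ennreal ((norm (F (of_real r * cis t)))\<^sup>2) \<partial>angle) \<le> ennreal (C\<^sup>2)"
proof -
  obtain s :: "nat \<Rightarrow> real" where s: "\<And>n. 0 \<le> s n" "\<And>n. s n < 1" and slim: "s \<longlonglongrightarrow> 1"
    using radii_to_one by blast
  define I where "I n = (\<integral>\<^sup>+t. ennreal (1 - exp (- 2 * poisson (of_real (s n) * cis t))) \<partial>angle)" for n
  have I: "I \<longlonglongrightarrow> 0" unfolding I_def by (rule one_minus_exp_poisson_tendsto[OF s slim])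
  have bnd: "(\<integral>\<^sup>+t. ennreal ((norm (F (of_real (s n) * cis t)))\<^sup>2) \<partial>angle) \<le> ennreal (C\<^sup>2) + ennreal (B\<^sup>2) * I n" for n
  proof -
    note [measurable] = poisson_measurable[OF s]
    have "(\<integral>\<^sup>+t. ennreal ((norm (F (of_real (s n) * cis t)))\<^sup>2) \<partial>angle)
        \<le> (\<integral>\<^sup>+t. ennreal (C\<^sup>2) + ennreal (B\<^sup>2) * ennreal (1 - exp (- 2 * poisson (of_real (s n) * cis t))) \<partial>angle)"
    proof (rule nn_integral_mono)
      fix t
      let ?z = "of_real (s n) * cis t"
      have z: "norm ?z < 1" using s[of n] by (simp add: norm_mult)
      have q: "0 \<le> poisson ?z" by (rule poisson_nonneg[OF z])
      have S2: "(norm (S ?z))\<^sup>2 = exp (- 2 * poisson ?z)"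
        by (simp add: S(2)[OF z] power2_eq_square flip: exp_add)
      have "(norm (F ?z))\<^sup>2 = (norm (F ?z * S ?z))\<^sup>2 + (norm (F ?z))\<^sup>2 * (1 - (norm (S ?z))\<^sup>2)"
        by (simp add: norm_mult power_mult_distrib algebra_simps)
      also have "\<dots> \<le> C\<^sup>2 + B\<^sup>2 * (1 - exp (- 2 * poisson ?z))"
        unfolding S2 using B[OF z] C[OF z] q
        by (intro add_mono mult_right_mono power_mono) auto
      finally have "ennreal ((norm (F ?z))\<^sup>2) \<le> ennreal (C\<^sup>2 + B\<^sup>2 * (1 - exp (- 2 * poisson ?z)))"
        by (rule ennreal_leI)
      also have "\<dots> = ennreal (C\<^sup>2) + ennreal (B\<^sup>2 * (1 - exp (- 2 * poisson ?z)))"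
        using q by (intro ennreal_plus) auto
      also have "ennreal (B\<^sup>2 * (1 - exp (- 2 * poisson ?z))) = ennreal (B\<^sup>2) * ennreal (1 - exp (- 2 * poisson ?z))"
        using q by (intro ennreal_mult) auto
      finally show "ennreal ((norm (F ?z))\<^sup>2) \<le> ennreal (C\<^sup>2) + ennreal (B\<^sup>2) * ennreal (1 - exp (- 2 * poisson ?z))" .
    qed
    also have "\<dots> = ennreal (C\<^sup>2) + ennreal (B\<^sup>2) * I n"
      unfolding I_def using angle.emeasure_space_1 by (simp add: nn_integral_add nn_integral_cmult)
    finally show ?thesis .
  qed
  have "eventually (\<lambda>n. r < s n) sequentially"
    using slim r(2) by (rule order_tendstoD)
  then have ev: "eventually (\<lambda>n. (\<integral>\<^sup>+t. ennreal ((norm (F (of_real r * cis t)))\<^sup>2) \<partial>angle)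
      \<le> ennreal (C\<^sup>2) + ennreal (B\<^sup>2) * I n) sequentially"
  proof eventually_elim
    case (elim n)
    show ?case
      by (rule order_trans[OF circle_mean_sq_mono[OF F r(1) less_imp_le[OF elim] s(2)] bnd])
  qed
  have "(\<lambda>n. ennreal (C\<^sup>2) + ennreal (B\<^sup>2) * I n) \<longlonglongrightarrow> ennreal (C\<^sup>2) + ennreal (B\<^sup>2) * 0"
    using I by (intro tendsto_add tendsto_const tendsto_mult_ennreal) auto
  then have "(\<lambda>n. ennreal (C\<^sup>2) + ennreal (B\<^sup>2) * I n) \<longlonglongrightarrow> ennreal (C\<^sup>2)" by simp
  then show ?thesis by (rule tendsto_lowerbound[OF _ ev]) simp
qed

theorem theorem7p1:
  fixes S :: "complex \<Rightarrow> complex"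
  assumes "singular_inner S"
    and "\<not> S constant_on ball 0 1"
    and "cyclic_in bergman_space bergman_norm S"
  shows "(\<lambda>(z, w). S z) \<in> H_inf \<and>
    cyclic_in hardy_space hardy_norm (\<lambda>(z, w). S z) \<and>
    \<not> weak_star_seq_cyclic (\<lambda>(z, w). S z)"
proof -
  obtain c \<mu> N where c: "norm c = 1" and \<mu>: "finite_measure \<mu>"
      "sets \<mu> = sets (restrict_space borel (sphere (0::complex) 1))"
      "N \<in> null_sets arc_length" "emeasure \<mu> (space \<mu> - N) = 0"
    and S: "\<And>z. z \<in> ball 0 1 \<Longrightarrow> S z = c * exp (- (\<integral>\<zeta>. (\<zeta> + z) / (\<zeta> - z) \<partial>\<mu>))"
    using assms(1) unfolding singular_inner_def by blast
  interpret finite_measure \<mu> by fact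
  interpret singular_circle_measure \<mu> N by unfold_locales (use \<mu> in auto)
  have nS: "norm (S z) = exp (- poisson z)" if "norm z < 1" for z
    using that c by (simp add: S norm_mult poisson_eq_Re)
  have Sle: "norm (S z) \<le> 1" if "z \<in> ball 0 1" for z
    using that poisson_nonneg[of z] nS[of z] by simp
  have hol: "S holomorphic_on ball 0 1"
    using assms(3) by (simp add: cyclic_in_def bergman_space_def)
  have Scont: "continuous_on (ball 0 1) S" by (rule holomorphic_on_imp_continuous_on[OF hol])
  let ?f = "\<lambda>p::complex \<times> complex. S (fst p)"
  have f_eq: "(\<lambda>(z, w). S z) = ?f" by auto
  have fH: "?f \<in> H_inf"
  proof (rule H_infI[OF holomorphic2_fst[OF hol]])
    show "norm (S (fst p)) \<le> 1" if "p \<in> ball 0 1" for p :: "complex \<times> complex"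
      using that norm_fst_less[of p] by (intro Sle) simp
  qed
  have "cyclic_in hardy_space hardy_norm ?f"
    using hol Sle assms(3) by (rule cyclic_hardy_fst)
  moreover have "\<not> weak_star_seq_cyclic ?f"
  proof
    assume "weak_star_seq_cyclic ?f"
    then obtain u where u: "range u \<subseteq> H_inf" and conv: "weak_star_tendsto (\<lambda>n p. u n p * ?f p) (\<lambda>p. 1)"
      unfolding weak_star_seq_cyclic_def by blast
    have uH: "u n \<in> H_inf" for n using u by blast
    have \<Phi>: "(\<lambda>p. u n p * ?f p) \<in> H_inf" for n
    proof -
      obtain B where B: "\<forall>y\<in>u n ` ball 0 1. norm y \<le> B"
        using uH[of n] unfolding H_inf_def bounded_iff by blast
      show ?thesis
      proof (rule H_infI)
        show "holomorphic2_on (\<lambda>p. u n p * ?f p) (ball 0 1)"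
          using uH[of n] by (intro holomorphic2_mult holomorphic2_fst[OF hol]) (simp add: H_inf_def)
        fix p :: "complex \<times> complex" assume p: "p \<in> ball 0 1"
        have "norm (u n p) \<le> B" using B p by blast
        moreover have "norm (?f p) \<le> 1" using p norm_fst_less[of p] by (intro Sle) simp
        ultimately show "norm (u n p * ?f p) \<le> B * 1"
          unfolding norm_mult by (intro mult_mono) (auto intro: order_trans[OF norm_ge_zero])
      qed
    qed
    have one: "(\<lambda>p. 1) \<in> H_inf" by (rule H_infI[where B = 1, OF holomorphic2_const]) simp
    define v where "v n z = u n (z, 0)" for n z
    have vhol: "v n holomorphic_on ball 0 1" for n
      unfolding v_def using uH[of n] by (intro holomorphic_first_axis) (simp add: H_inf_def)
    obtain C where C: "\<And>n z. norm z < 1 \<Longrightarrow> norm (v n z * S z) \<le> C"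
      using weak_star_tendsto_bounded[OF conv \<Phi> one] unfolding v_def by auto
    have lim: "(\<lambda>n. v n z * S z) \<longlonglongrightarrow> 1" if "norm z < 1" for z
      using weak_star_tendsto_pointwise[OF conv \<Phi> one that] by (simp add: v_def)
    have mean: "(\<integral>\<^sup>+t. ennreal ((norm (v n (of_real r * cis t)))\<^sup>2) \<partial>angle) \<le> ennreal (C\<^sup>2)"
      if r: "0 \<le> r" "r < 1" for n r
    proof -
      obtain B where B: "\<forall>y\<in>u n ` ball 0 1. norm y \<le> B"
        using uH[of n] unfolding H_inf_def bounded_iff by blast
      have "norm (v n z) \<le> B" if "norm z < 1" for z
        unfolding v_def by (rule B[rule_format], rule imageI) (use that in \<open>simp add: norm_Pair\<close>)
      from quotient_mean_le[OF vhol this Scont nS C r] show ?thesis by simp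
    qed
    \<comment> \<open>Fatou's lemma for \<open>v n \<longlonglongrightarrow> 1 / S\<close>\<close>
    have inv_mean: "(\<integral>\<^sup>+t. ennreal (exp (2 * poisson (of_real r * cis t))) \<partial>angle) \<le> ennreal (C\<^sup>2)"
      if r: "0 \<le> r" "r < 1" for r
    proof -
      have "(\<integral>\<^sup>+t. ennreal (exp (2 * poisson (of_real r * cis t))) \<partial>angle)
          = (\<integral>\<^sup>+t. liminf (\<lambda>n. ennreal ((norm (v n (of_real r * cis t)))\<^sup>2)) \<partial>angle)"
      proof (rule nn_integral_cong)
        fix t
        let ?z = "of_real r * cis t"
        have z: "norm ?z < 1" using r by (simp add: norm_mult)
        have S0: "S ?z \<noteq> 0" using nS[OF z] by auto
        have "(\<lambda>n. v n ?z * S ?z / S ?z) \<longlonglongrightarrow> 1 / S ?z"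
          by (intro tendsto_divide tendsto_const lim z S0)
        then have "(\<lambda>n. v n ?z) \<longlonglongrightarrow> 1 / S ?z" using S0 by simp
        then have "(\<lambda>n. ennreal ((norm (v n ?z))\<^sup>2)) \<longlonglongrightarrow> ennreal ((norm (1 / S ?z))\<^sup>2)"
          by (intro tendsto_ennrealI tendsto_power tendsto_norm)
        moreover have "norm (1 / S ?z) = exp (poisson ?z)"
          by (simp add: norm_divide nS[OF z] exp_minus inverse_eq_divide)
        then have "(norm (1 / S ?z))\<^sup>2 = exp (2 * poisson ?z)"
          by (simp add: exp_double)
        ultimately have "(\<lambda>n. ennreal ((norm (v n ?z))\<^sup>2)) \<longlonglongrightarrow> ennreal (exp (2 * poisson ?z))" by simp
        then show "ennreal (exp (2 * poisson ?z)) = liminf (\<lambda>n. ennreal ((norm (v n ?z))\<^sup>2))"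
          by (intro lim_imp_Liminf[symmetric]) auto
      qed
      also have "\<dots> \<le> liminf (\<lambda>n. \<integral>\<^sup>+t. ennreal ((norm (v n (of_real r * cis t)))\<^sup>2) \<partial>angle)"
      proof (rule nn_integral_liminf)
        fix n
        have [measurable]: "(\<lambda>t. v n (of_real r * cis t)) \<in> borel_measurable borel"
          by (rule continuous_circle_measurable[OF holomorphic_on_imp_continuous_on[OF vhol] r])
        show "(\<lambda>t. ennreal ((norm (v n (of_real r * cis t)))\<^sup>2)) \<in> borel_measurable angle"
          by measurable
      qed
      also have "\<dots> \<le> liminf (\<lambda>n::nat. ennreal (C\<^sup>2))"
        by (intro Liminf_mono always_eventually allI mean r)
      also have "\<dots> = ennreal (C\<^sup>2)" by (simp add: Liminf_const)
      finally show ?thesis .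
    qed
    obtain s :: "nat \<Rightarrow> real" where s: "\<And>n. 0 \<le> s n" "\<And>n. s n < 1" and slim: "s \<longlonglongrightarrow> 1"
      using radii_to_one by blast
    have zero: "emeasure \<mu> (space \<mu>) = 0"
      by (rule total_mass_zero[OF s slim _ inv_mean[OF s]]) simp
    have "S z = c" if "z \<in> ball 0 1" for z
    proof -
      have "AE \<zeta> in \<mu>. (\<zeta> + z) / (\<zeta> - z) = 0"
        by (rule AE_I[of _ _ "space \<mu>"]) (use zero in auto)
      then have "(\<integral>\<zeta>. (\<zeta> + z) / (\<zeta> - z) \<partial>\<mu>) = 0" by (rule integral_eq_zero_AE)
      then show ?thesis using S[OF that] by simp
    qed
    then have "S constant_on ball 0 1" unfolding constant_on_def by blast
    with assms(2) show False by simp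
  qed
  ultimately show ?thesis using fH unfolding f_eq by blast
qed

end
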